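(* Each of the families $\mathcal{U}_1,\mathcal{U}_2,\mathcal{U}_3,\mathcal{U}_4$ defined in the context is a convex cone closed under the operations of $\sup$-convolution and conjugacy with respect to $x$: for $u,u_1,u_2$ in the family and $c>0$, the functions $cu$, $u_1+u_2$, $u_1\oplus u_2$ and $u^*$ belong to the family, where $(u_1\oplus u_2)(t,x):=\sup_{x_1+x_2=x}\{u_1(t,x_1)+u_2(t,x_2)\}$ and $u^*(t,x):=\inf_{y>0}(xy-u(t,y))$ for $(t,x)\in[0,1]\times(0,\infty)$.
   Context: $\mathcal{U}_1$: continuously differentiable functions $u$ on $[0,1]\times(0,\infty)$ such that each $u(t,\cdot)$ is strictly increasing and strictly concave with $\lim_{x\to0}u_x(t,x)=\infty$, $\lim_{x\to\infty}u_x(t,x)=0$. $\mathcal{U}_2$: $u\in\mathcal{U}_1$ twice weakly differentiable in $x$ with $1/N\le a(t,x):=-xu_{xx}/u_x\le N$ on $[0,1]\times(0,\infty)$ for some $N>0$ depending on $u$. $\mathcal{U}_3$: $u\in\mathcal{U}_2$ three times weakly differentiable in $x$ with $-N\le p(t,x):=-xu_{xxx}/u_{xx}\le N$ for some $N>0$. $\mathcal{U}_4$: $u\in\mathcal{U}_3$ such that $u_x$ is continuously differentiable in $t$ and $(t,s)\mapsto a(t,s\cdot):=(a(t,sx))_{x>0}$, $(t,s)\mapsto p(t,s\cdot)$, $(t,s)\mapsto q(t,s\cdot)$ are analytic maps of $[0,1]\times(0,\infty)$ to $\mathbf{C}((0,\infty))$ (continuous functions on $(0,\infty)$ with uniform norm),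 where $q(t,x):=-u_{xt}/u_x$. A map from a subset of $\mathbb{R}^2$ to a Banach space is analytic if near each point it equals a norm-convergent power series with coefficients in the Banach space. *)

theory Defs
  imports "HOL-Analysis.Analysis"
begin

text \<open>Functions u(t,x) are represented curried as real => real => real;
  only their values on [0,1] x (0,oo) matter.\<close>

definition Dom :: "(real \<times> real) set" where
  "Dom = {0..1} \<times> {0<..}"

definition C1_on_Dom :: "(real \<Rightarrow> real \<Rightarrow> real) \<Rightarrow> bool" where
  "C1_on_Dom u \<longleftrightarrow> (\<exists>ut ux.
      continuous_on Dom (\<lambda>p. ut (fst p) (snd p)) \<and>
      continuous_on Dom (\<lambda>p. ux (fst p) (snd p)) \<and>
      (\<forall>p\<in>Dom. ((\<lambda>q. u (fst q) (snd q)) has_derivative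
          (\<lambda>h. ut (fst p) (snd p) * fst h + ux (fst p) (snd p) * snd h)) (at p within Dom)))"

definition strictly_concave_on :: "real set \<Rightarrow> (real \<Rightarrow> real) \<Rightarrow> bool" where
  "strictly_concave_on S f \<longleftrightarrow> convex S \<and>
     (\<forall>x\<in>S. \<forall>y\<in>S. \<forall>l::real. x \<noteq> y \<longrightarrow> 0 < l \<longrightarrow> l < 1 \<longrightarrow>
        f (l * x + (1 - l) * y) > l * f x + (1 - l) * f y)"

definition ux :: "(real \<Rightarrow> real \<Rightarrow> real) \<Rightarrow> real \<Rightarrow> real \<Rightarrow> real" where
  "ux u t x = deriv (u t) x"

definition U1 :: "(real \<Rightarrow> real \<Rightarrow> real) \<Rightarrow> bool" where
  "U1 u \<longleftrightarrow> C1_on_Dom u \<and>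
     (\<forall>t\<in>{0..1}. strict_mono_on {0<..} (u t) \<and> strictly_concave_on {0<..} (u t) \<and>
        filterlim (ux u t) at_top (at_right 0) \<and>
        ((ux u t) \<longlongrightarrow> 0) at_top)"

definition weak_deriv_x :: "(real \<Rightarrow> real \<Rightarrow> real) \<Rightarrow> (real \<Rightarrow> real \<Rightarrow> real) \<Rightarrow> bool" where
  "weak_deriv_x f g \<longleftrightarrow> (\<forall>t\<in>{0..1}. \<forall>a b. 0 < a \<longrightarrow> a \<le> b \<longrightarrow>
      g t absolutely_integrable_on {a..b} \<and> f t b - f t a = integral {a..b} (g t))"

definition U2 :: "(real \<Rightarrow> real \<Rightarrow> real) \<Rightarrow> bool" where
  "U2 u \<longleftrightarrow> U1 u \<and> (\<exists>uxx N. N > 0 \<and> weak_deriv_x (ux u) uxx \<and>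
     (\<forall>t\<in>{0..1}. \<forall>x>0. 1 / N \<le> - x * uxx t x / ux u t x \<and> - x * uxx t x / ux u t x \<le> N))"

definition U3 :: "(real \<Rightarrow> real \<Rightarrow> real) \<Rightarrow> bool" where
  "U3 u \<longleftrightarrow> U2 u \<and> (\<exists>uxx uxxx N. N > 0 \<and> weak_deriv_x (ux u) uxx \<and> weak_deriv_x uxx uxxx \<and>
     (\<forall>t\<in>{0..1}. \<forall>x>0. - N \<le> - x * uxxx t x / uxx t x \<and> - x * uxxx t x / uxx t x \<le> N))"

definition supnorm :: "(real \<Rightarrow> real) \<Rightarrow> real" where
  "supnorm g = (SUP x\<in>{0<..}. \<bar>g x\<bar>)"

definition bcont :: "(real \<Rightarrow> real) \<Rightarrow> bool" where
  "bcont g \<longleftrightarrow> continuous_on {0<..} g \<and> bounded (g ` {0<..})"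

text \<open>(t,s) |-> F(t, s .) is an analytic map [0,1] x (0,oo) -> C((0,oo)):
  near every point it is a power series in (t - t0, s - s0) with coefficients in C((0,oo)),
  convergent in the uniform norm (absolutely).\<close>
definition analytic_C :: "(real \<Rightarrow> real \<Rightarrow> real) \<Rightarrow> bool" where
  "analytic_C F \<longleftrightarrow>
     (\<forall>t\<in>{0..1}. \<forall>s>0. bcont (\<lambda>x. F t (s * x))) \<and>
     (\<forall>t0\<in>{0..1}. \<forall>s0>0. \<exists>c :: nat \<Rightarrow> nat \<Rightarrow> real \<Rightarrow> real. \<exists>\<epsilon>>0.
        (\<forall>m n. bcont (c m n)) \<and>
        (\<forall>t s. t \<in> {0..1} \<longrightarrow> s > 0 \<longrightarrow> \<bar>t - t0\<bar> < \<epsilon> \<longrightarrow> \<bar>s - s0\<bar> < \<epsilon> \<longrightarrow>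
           (\<lambda>(m, n). supnorm (c m n) * \<bar>t - t0\<bar> ^ m * \<bar>s - s0\<bar> ^ n) summable_on UNIV \<and>
           (\<forall>x>0. ((\<lambda>(m, n). c m n x * (t - t0) ^ m * (s - s0) ^ n) has_sum F t (s * x)) UNIV)))"

definition U4 :: "(real \<Rightarrow> real \<Rightarrow> real) \<Rightarrow> bool" where
  "U4 u \<longleftrightarrow> U3 u \<and> (\<exists>uxx uxxx uxt.
     weak_deriv_x (ux u) uxx \<and> weak_deriv_x uxx uxxx \<and>
     (\<forall>x>0. \<forall>t\<in>{0..1}. ((\<lambda>s. ux u s x) has_real_derivative uxt t x) (at t within {0..1})) \<and>
     (\<forall>x>0. continuous_on {0..1} (\<lambda>t. uxt t x)) \<and>
     analytic_C (\<lambda>t x. - x * uxx t x / ux u t x) \<and>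
     analytic_C (\<lambda>t x. - x * uxxx t x / uxx t x) \<and>
     analytic_C (\<lambda>t x. - uxt t x / ux u t x))"

definition supconv :: "(real \<Rightarrow> real \<Rightarrow> real) \<Rightarrow> (real \<Rightarrow> real \<Rightarrow> real) \<Rightarrow> real \<Rightarrow> real \<Rightarrow> real" where
  "supconv u1 u2 t x = (SUP x1\<in>{0<..<x}. u1 t x1 + u2 t (x - x1))"

definition conj_x :: "(real \<Rightarrow> real \<Rightarrow> real) \<Rightarrow> real \<Rightarrow> real \<Rightarrow> real" where
  "conj_x u t x = (INF y\<in>{0<..}. x * y - u t y)"

definition closed_cone_family :: "((real \<Rightarrow> real \<Rightarrow> real) \<Rightarrow> bool) \<Rightarrow> bool" where
  "closed_cone_family P \<longleftrightarrow>
     (\<forall>u c. P u \<longrightarrow> c > 0 \<longrightarrow> P (\<lambda>t x. c * u t x)) \<and>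
     (\<forall>u1 u2. P u1 \<longrightarrow> P u2 \<longrightarrow> P (\<lambda>t x. u1 t x + u2 t x)) \<and>
     (\<forall>u1 u2. P u1 \<longrightarrow> P u2 \<longrightarrow> P (supconv u1 u2)) \<and>
     (\<forall>u. P u \<longrightarrow> P (conj_x u))"

end

theory Submission
  imports Defs
begin

text \<open>
  Everything is expressed through the marginal utility \<open>v = u\<^sub>x\<close>. Addition of utilities adds
  marginals, conjugation replaces \<open>v t\<close> by its inverse function \<open>J t\<close> (envelope theorem), and
  \<open>sup\<close>-convolution is the conjugate of the sum of the conjugates, so only scaling, addition and
  conjugation matter. For a sum, \<open>a\<close>, \<open>p\<close> and \<open>q\<close> are weighted means of those of the summands with
  weights proportional to \<open>u\<^sub>x\<close> (for \<open>a\<close>, \<open>q\<close>) or \<open>u\<^sub>x\<^sub>x\<close> (for \<open>p\<close>); for the conjugate they are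
  \<open>1 / a\<close>, \<open>p / a\<close> and \<open>q / a\<close> evaluated at \<open>J t y\<close>. This settles the first three families up to
  the chain rule for weak derivatives. For analyticity, \<open>\<partial> ln v (t, s x) = - (a / s) ds - q dt\<close> shows
  that \<open>v (t, s x) / v (t0, x)\<close> is a power series in \<open>(t - t0, s - 1)\<close> converging uniformly in \<open>x\<close>;
  this gives the weights, and since \<open>a\<close> is bounded away from zero the equation
  \<open>v (t, (1 + w) x) = s v (t0, x)\<close> is solved for \<open>w\<close> by a contraction in a weighted norm on such
  power series.
\<close>

section \<open>Marginal utilities and conjugation\<close>

text \<open>Two obstacles shape the proof. A weak derivative is determined only almost everywhere,
  whereas the bounds in the families are demanded at every point, so representatives have to be
  chosen with care. For \<open>U2\<close> the marginal utility need not be differentiable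
  everywhere; its inverse is treated through image measures, and the derivative is corrected on a
  null set. From \<open>U3\<close> on, \<open>u_xx\<close> is itself a primitive, hence continuous,
  and the inverse function rule is classical; only \<open>u_xxx\<close> stays weak. The second
  obstacle is that \<open>u_x\<close> blows up at 0 and is no element of the bounded functions in
  which analyticity is measured, so only its growth factor relative to the centre can be expanded.
  Smallness always comes from one fact: a power series without constant term shrinks with its
  polydisc. The constants 1/4, for the nonlinear part, and \<open>e / 2\<close>, for the right-hand
  side, keep the iteration inside the ball of radius \<open>e\<close>. Since time ranges over a
  closed interval, identities are claimed only for \<open>t\<close> in it, while the series live on
  a full polydisc.\<close>

definition has_partials ::
    "(real \<Rightarrow> real \<Rightarrow> real) \<Rightarrow> (real \<Rightarrow> real \<Rightarrow> real) \<Rightarrow> (real \<Rightarrow> real \<Rightarrow> real) \<Rightarrow> bool" where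
  "has_partials u ut v \<longleftrightarrow>
     continuous_on Dom (\<lambda>p. ut (fst p) (snd p)) \<and> continuous_on Dom (\<lambda>p. v (fst p) (snd p)) \<and>
     (\<forall>t\<in>{0..1}. \<forall>x>0. ((\<lambda>s. u s x) has_real_derivative ut t x) (at t within {0..1}) \<and>
        (u t has_real_derivative v t x) (at x))"

text \<open>What \<open>U1\<close> demands of the marginal utility: positivity and strict decrease
  stand for strict monotonicity and strict concavity of \<open>u\<close>.\<close>

definition Inada :: "(real \<Rightarrow> real \<Rightarrow> real) \<Rightarrow> bool" where
  "Inada v \<longleftrightarrow> continuous_on Dom (\<lambda>p. v (fst p) (snd p)) \<and>
     (\<forall>t\<in>{0..1}. (\<forall>x>0. v t x > 0) \<and> (\<forall>x y. 0 < x \<longrightarrow> x < y \<longrightarrow> v t y < v t x) \<and>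
        filterlim (v t) at_top (at_right 0) \<and> (v t \<longlongrightarrow> 0) at_top)"

lemma in_Dom [simp]: "(t, x) \<in> Dom \<longleftrightarrow> t \<in> {0..1} \<and> x > 0"
  by (auto simp: Dom_def)

lemma continuous_on_Dom_cong:
  assumes "continuous_on Dom (\<lambda>p. v (fst p) (snd p))"
    and "\<And>t x. t \<in> {0..1} \<Longrightarrow> x > 0 \<Longrightarrow> v' t x = v t x"
  shows "continuous_on Dom (\<lambda>p. v' (fst p) (snd p))"
  using assms(1) by (rule continuous_on_eq) (use assms(2) in \<open>auto simp: Dom_def\<close>)

text \<open>Continuity of a single partial derivative upgrades partial to joint differentiability.
  Here it is the \<open>x\<close>-partial, while the \<open>t\<close>-partial enters only at the
  point itself and may be one-sided at 0 and 1.\<close>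

lemma C1_on_Dom_if_has_partials:
  assumes "has_partials u ut v"
  shows "C1_on_Dom u"
proof -
  have cont: "continuous_on Dom (\<lambda>p. ut (fst p) (snd p))" "continuous_on Dom (\<lambda>p. v (fst p) (snd p))"
    using assms by (auto simp: has_partials_def)
  have "((\<lambda>q. u (fst q) (snd q)) has_derivative
          (\<lambda>h. ut (fst p) (snd p) * fst h + v (fst p) (snd p) * snd h)) (at p within Dom)"
    if "p \<in> Dom" for p
  proof -
    obtain t x where p: "p = (t, x)" "t \<in> {0..1}" "x > 0" using \<open>p \<in> Dom\<close> by (cases p) auto
    have "((\<lambda>(x, y). u x y) has_derivative (\<lambda>(tx, ty). ut t x * tx + blinfun_scaleR_left (v t x) ty))
         (at (t, x) within {0..1} \<times> {0<..})"
    proof (rule has_derivative_partialsI)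
      show "((\<lambda>s. u s x) has_derivative (\<lambda>h. ut t x * h)) (at t within {0..1})"
        using assms p by (auto simp: has_partials_def has_field_derivative_def)
      show "(u s has_derivative blinfun_apply (blinfun_scaleR_left (v s y))) (at y within {0<..})"
        if "s \<in> {0..1}" "y \<in> {0<..}" for s y
      proof -
        have "(u s has_real_derivative v s y) (at y)"
          using assms that by (auto simp: has_partials_def)
        then have "(u s has_derivative blinfun_apply (blinfun_scaleR_left (v s y))) (at y)"
          by (simp add: has_field_derivative_def mult.commute[of _ "v s y"])
        then show ?thesis by (rule has_derivative_at_withinI)
      qed
      have "continuous (at (t, x) within Dom) (\<lambda>p. v (fst p) (snd p))"
        using cont(2) p that unfolding continuous_on_eq_continuous_within by auto
      then have "continuous (at (t, x) within {0..1} \<times> {0<..}) (\<lambda>p. v (fst p) (snd p))"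
        by (simp add: Dom_def)
      then show "continuous (at (t, x) within {0..1} \<times> {0<..})
                   (\<lambda>(s, y). blinfun_scaleR_left (v s y))"
        by (auto simp: split_beta' intro!: bounded_linear.continuous[OF bounded_linear_blinfun_scaleR_left])
    qed (use p in auto)
    then show ?thesis by (simp add: Dom_def p split_beta' mult.commute)
  qed
  with cont show ?thesis unfolding C1_on_Dom_def by blast
qed

lemma has_partials_if_C1_on_Dom:
  assumes "C1_on_Dom u"
  obtains ut v where "has_partials u ut v"
proof -
  from assms obtain ut v where
    cont: "continuous_on Dom (\<lambda>p. ut (fst p) (snd p))" "continuous_on Dom (\<lambda>p. v (fst p) (snd p))"
    and d: "\<And>p. p \<in> Dom \<Longrightarrow> ((\<lambda>q. u (fst q) (snd q)) has_derivative
          (\<lambda>h. ut (fst p) (snd p) * fst h + v (fst p) (snd p) * snd h)) (at p within Dom)"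
    unfolding C1_on_Dom_def by (elim exE conjE) (rule that, assumption, assumption, drule bspec)
  have "((\<lambda>s. u s x) has_real_derivative ut t x) (at t within {0..1})"
    and "(u t has_real_derivative v t x) (at x)" if t: "t \<in> {0..1}" "x > 0" for t x
  proof -
    have D: "((\<lambda>q. u (fst q) (snd q)) has_derivative (\<lambda>h. ut t x * fst h + v t x * snd h))
        (at (t, x) within Dom)"
      using d[of "(t, x)"] t by simp
    have 1: "((\<lambda>s. (s, x)) has_derivative (\<lambda>h. (h, 0))) (at t within {0..1})"
      by (rule has_derivative_Pair[OF has_derivative_ident has_derivative_const])
    have "((\<lambda>q. u (fst q) (snd q)) has_derivative (\<lambda>h. ut t x * fst h + v t x * snd h))
        (at (t, x) within (\<lambda>s. (s, x)) ` {0..1})"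
      by (rule has_derivative_subset[OF D]) (use t in auto)
    from has_derivative_in_compose[OF 1 this]
    have "((\<lambda>s. u s x) has_derivative (\<lambda>h. ut t x * h)) (at t within {0..1})" by simp
    then show "((\<lambda>s. u s x) has_real_derivative ut t x) (at t within {0..1})"
      by (simp add: has_field_derivative_def)
    have 2: "((\<lambda>y. (t, y)) has_derivative (\<lambda>h. (0, h))) (at x within {0<..})"
      by (rule has_derivative_Pair[OF has_derivative_const has_derivative_ident])
    have "((\<lambda>q. u (fst q) (snd q)) has_derivative (\<lambda>h. ut t x * fst h + v t x * snd h))
        (at (t, x) within (\<lambda>y. (t, y)) ` {0<..})"
      by (rule has_derivative_subset[OF D]) (use t in auto)
    from has_derivative_in_compose[OF 2 this]
    have "(u t has_derivative (\<lambda>h. v t x * h)) (at x within {0<..})" by simp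
    then show "(u t has_real_derivative v t x) (at x)"
      using t by (simp add: has_field_derivative_def at_within_open[of x "{0<..}"])
  qed
  with cont have "has_partials u ut v" by (auto simp: has_partials_def)
  then show ?thesis by (rule that)
qed

lemma ux_eq_if_has_partials:
  "has_partials u ut v \<Longrightarrow> t \<in> {0..1} \<Longrightarrow> x > 0 \<Longrightarrow> ux u t x = v t x"
  by (auto simp: has_partials_def ux_def intro!: DERIV_imp_deriv)

lemma has_partials_cong:
  assumes "has_partials u ut v"
    and "\<And>t x. t \<in> {0..1} \<Longrightarrow> x > 0 \<Longrightarrow> u' t x = u t x"
    and "\<And>t x. t \<in> {0..1} \<Longrightarrow> x > 0 \<Longrightarrow> v' t x = v t x"
  shows "has_partials u' ut v'"
  unfolding has_partials_def
proof (intro conjI ballI allI impI)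
  show "continuous_on Dom (\<lambda>p. ut (fst p) (snd p))" using assms by (auto simp: has_partials_def)
  show "continuous_on Dom (\<lambda>p. v' (fst p) (snd p))"
    by (rule continuous_on_Dom_cong[OF _ assms(3)]) (use assms(1) in \<open>auto simp: has_partials_def\<close>)
  fix t x :: real assume t: "t \<in> {0..1}" and x: "0 < x"
  show "((\<lambda>s. u' s x) has_real_derivative ut t x) (at t within {0..1})"
  proof (rule has_field_derivative_transform_within)
    show "((\<lambda>s. u s x) has_real_derivative ut t x) (at t within {0..1})"
      using assms(1) t x by (auto simp: has_partials_def)
  qed (use t x assms(2) in auto)
  have "(u t has_real_derivative v t x) (at x)" using assms(1) t x by (auto simp: has_partials_def)
  then have "(u' t has_real_derivative v t x) (at x)"
    by (rule has_field_derivative_transform_within_open[where S="{0<..}"]) (use t x assms(2) in auto)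
  then show "(u' t has_real_derivative v' t x) (at x)" using assms(3)[OF t x] by simp
qed

lemma Inada_cong:
  assumes "Inada v" and eq: "\<And>t x. t \<in> {0..1} \<Longrightarrow> x > 0 \<Longrightarrow> v' t x = v t x"
  shows "Inada v'"
  unfolding Inada_def
proof (intro conjI ballI allI impI)
  show "continuous_on Dom (\<lambda>p. v' (fst p) (snd p))"
    by (rule continuous_on_Dom_cong[OF _ eq]) (use assms(1) in \<open>auto simp: Inada_def\<close>)
  fix t :: real assume t: "t \<in> {0..1}"
  show "v' t x > 0" if "x > 0" for x using assms(1) t that eq by (auto simp: Inada_def)
  show "v' t y < v' t x" if "0 < x" "x < y" for x y using assms(1) t that eq by (auto simp: Inada_def)
  have "eventually (\<lambda>x. v t x = v' t x) (at_right 0)"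
    using eq[OF t] by (auto simp: eventually_at_right_less eventually_at_filter)
  moreover have "filterlim (v t) at_top (at_right 0)" using assms(1) t by (auto simp: Inada_def)
  ultimately show "filterlim (v' t) at_top (at_right 0)"
    using filterlim_cong[OF refl refl] by blast
  have "eventually (\<lambda>x. v t x = v' t x) at_top"
    using eventually_gt_at_top[of 0] by eventually_elim (use eq[OF t] in auto)
  moreover have "(v t \<longlongrightarrow> 0) at_top" using assms(1) t by (auto simp: Inada_def)
  ultimately show "(v' t \<longlongrightarrow> 0) at_top"
    using filterlim_cong[OF refl refl] by blast
qed

text \<open>The tangent inequality for convex functions is not strict. It is applied at the midpoint
  of \<open>x\<close> and \<open>y\<close>, where strict concavity leaves a gap, and then
  doubled.\<close>

lemma strictly_concave_tangent:
  assumes sc: "strictly_concave_on {0<..} f" and d: "(f has_real_derivative d) (at x)"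
    and "x > 0" "y > 0" "x \<noteq> y"
  shows "f y < f x + d * (y - x)"
proof -
  have "convex_on {0<..} (\<lambda>x. - f x)"
  proof (rule convex_onI)
    fix l a b :: real assume l: "0 < l" "l < 1" and ab: "a \<in> {0<..}" "b \<in> {0<..}"
    show "- f ((1 - l) *\<^sub>R a + l *\<^sub>R b) \<le> (1 - l) * - f a + l * - f b"
    proof (cases "a = b")
      case True then show ?thesis by (simp add: algebra_simps)
    next
      case False
      with sc l ab have "f ((1 - l) * a + (1 - (1 - l)) * b) > (1 - l) * f a + (1 - (1 - l)) * f b"
        using sc[unfolded strictly_concave_on_def, THEN conjunct2, rule_format, of a b "1 - l"] by simp
      then show ?thesis by simp
    qed
  qed auto
  then have "- f ((x + y) / 2) - - f x \<ge> - d * ((x + y) / 2 - x)"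
    by (rule convex_on_imp_above_tangent)
      (use assms has_field_derivative_at_within[OF DERIV_minus[OF d]] in \<open>auto simp: interior_open\<close>)
  moreover have "f ((x + y) / 2) > (f x + f y) / 2"
    using sc[unfolded strictly_concave_on_def, THEN conjunct2, rule_format, of x y "1/2"] assms(3-5)
    by (simp add: add_divide_distrib)
  moreover have "d * ((x + y) / 2 - x) = d * (y - x) / 2" by (simp add: field_simps)
  ultimately show ?thesis by auto
qed

text \<open>The mean value theorem on the two sides of the convex combination gives two slopes,
  ordered by the decrease of \<open>g\<close>. Weighting the increments by \<open>l\<close> and
  \<open>1 - l\<close> makes the lengths of the two sides agree.\<close>

lemma strictly_concave_if_deriv_decreasing:
  fixes f :: "real \<Rightarrow> real"
  assumes d: "\<And>x. x > 0 \<Longrightarrow> (f has_real_derivative g x) (at x)"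
    and g: "\<And>x y. 0 < x \<Longrightarrow> x < y \<Longrightarrow> g y < g x"
  shows "strictly_concave_on {0<..} f"
proof -
  have less: "f (l * x + (1 - l) * y) > l * f x + (1 - l) * f y"
    if xy: "0 < x" "x < y" and l: "0 < l" "l < 1" for x y l
  proof -
    define z where "z = l * x + (1 - l) * y"
    have zx: "z - x = (1 - l) * (y - x)" and yz: "y - z = l * (y - x)" by (auto simp: z_def algebra_simps)
    have "0 < z - x" "0 < y - z" unfolding zx yz using l xy by auto
    then have "x < z" "z < y" by auto
    have "\<exists>a>x. a < z \<and> f z - f x = (z - x) * g a"
      by (rule MVT2[OF \<open>x < z\<close>]) (use d xy in auto)
    then obtain a where a: "x < a" "a < z" "f z - f x = (z - x) * g a" by blast
    have "\<exists>b>z. b < y \<and> f y - f z = (y - z) * g b"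
      by (rule MVT2[OF \<open>z < y\<close>]) (use d xy \<open>x < z\<close> in auto)
    then obtain b where b: "z < b" "b < y" "f y - f z = (y - z) * g b" by blast
    have "g b < g a" using g a b xy by simp
    then have "l * (1 - l) * (y - x) * g b < l * (1 - l) * (y - x) * g a" using l xy by simp
    moreover have "l * (f z - f x) = l * (1 - l) * (y - x) * g a" using a(3) zx by simp
    moreover have "(1 - l) * (f y - f z) = l * (1 - l) * (y - x) * g b" using b(3) yz by simp
    ultimately show ?thesis unfolding z_def[symmetric] by (simp add: algebra_simps)
  qed
  show ?thesis unfolding strictly_concave_on_def
  proof (intro conjI ballI allI impI)
    fix x y l :: real assume *: "x \<in> {0<..}" "y \<in> {0<..}" "x \<noteq> y" "0 < l" "l < 1"
    show "l * f x + (1 - l) * f y < f (l * x + (1 - l) * y)"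
    proof (cases "x < y")
      case True then show ?thesis using less[of x y l] * by auto
    next
      case False then show ?thesis using less[of y x "1 - l"] * by (auto simp: algebra_simps)
    qed
  qed auto
qed

lemma U1D:
  assumes "U1 u"
  obtains ut where "has_partials u ut (ux u)" "Inada (ux u)"
proof -
  obtain ut v where p: "has_partials u ut v"
    using assms has_partials_if_C1_on_Dom unfolding U1_def by blast
  then have p': "has_partials u ut (ux u)"
    by (rule has_partials_cong) (auto simp: ux_eq_if_has_partials[OF p])
  have d: "(u t has_real_derivative ux u t x) (at x)" if "t \<in> {0..1}" "x > 0" for t x
    using p' that by (auto simp: has_partials_def)
  have dec: "ux u t y < ux u t x" if t: "t \<in> {0..1}" and "0 < x" "x < y" for t x y
  proof -
    have "strictly_concave_on {0<..} (u t)" using assms t by (auto simp: U1_def)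
    \<comment> \<open>Adding the two strict tangent inequalities, at \<open>x\<close> and at
      \<open>y\<close>, cancels the values of \<open>u\<close>.\<close>
    then have "u t y < u t x + ux u t x * (y - x)" "u t x < u t y + ux u t y * (x - y)"
      using strictly_concave_tangent d[OF t] that by auto
    then have "(ux u t x - ux u t y) * (y - x) > 0" by (simp add: algebra_simps)
    then show ?thesis using that by (simp add: zero_less_mult_iff)
  qed
  \<comment> \<open>A decreasing function dominates its limit 0; comparing at \<open>x + 1\<close>
    first makes the final inequality strict.\<close>
  have pos: "ux u t x > 0" if t: "t \<in> {0..1}" and "x > 0" for t x
  proof -
    have "(ux u t \<longlongrightarrow> 0) at_top" using assms t by (auto simp: U1_def)
    moreover have "eventually (\<lambda>y. ux u t y \<le> ux u t (x + 1)) at_top"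
      using eventually_gt_at_top[of "x + 1"]
      by eventually_elim (use dec[OF t, of "x + 1"] that in \<open>force intro: less_imp_le\<close>)
    ultimately have "0 \<le> ux u t (x + 1)"
      by (intro tendsto_upperbound[of "ux u t"]) auto
    then show ?thesis using dec[OF t, of x "x + 1"] that by auto
  qed
  have "Inada (ux u)"
    using assms p' dec pos by (auto simp: U1_def Inada_def has_partials_def)
  with p' show ?thesis by (rule that)
qed

lemma U1I:
  assumes p: "has_partials u ut v" and v: "Inada v"
  shows "U1 u"
proof -
  have d: "(u t has_real_derivative v t x) (at x)" if "t \<in> {0..1}" "x > 0" for t x
    using p that by (auto simp: has_partials_def)
  have i: "Inada (ux u)" by (rule Inada_cong[OF v]) (auto simp: ux_eq_if_has_partials[OF p])
  have "strict_mono_on {0<..} (u t)" if t: "t \<in> {0..1}" for t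
  proof (rule strict_mono_onI)
    fix x y :: real assume "x \<in> {0<..}" "y \<in> {0<..}" "x < y"
    moreover have "\<exists>y. (u t has_real_derivative y) (at z) \<and> 0 < y" if "z > 0" for z
      using d[OF t that] v t that by (auto simp: Inada_def)
    ultimately show "u t x < u t y"
      by (intro DERIV_pos_imp_increasing[of x y "u t"]) auto
  qed
  moreover have "strictly_concave_on {0<..} (u t)" if t: "t \<in> {0..1}" for t
    using strictly_concave_if_deriv_decreasing[of "u t" "v t"] d[OF t] v t by (auto simp: Inada_def)
  ultimately show ?thesis
    using i C1_on_Dom_if_has_partials[OF p] by (auto simp: U1_def Inada_def)
qed

text \<open>Needed because the functions are total, while the formula for the
  \<open>sup\<close>-convolution as a conjugate holds on \<open>Dom\<close> only.\<close>

lemma U1_cong: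
  assumes "U1 u" and eq: "\<And>t x. t \<in> {0..1} \<Longrightarrow> x > 0 \<Longrightarrow> u' t x = u t x"
  shows "U1 u'" and "\<And>t x. t \<in> {0..1} \<Longrightarrow> x > 0 \<Longrightarrow> ux u' t x = ux u t x"
proof -
  obtain ut where p: "has_partials u ut (ux u)" "Inada (ux u)" using U1D[OF assms(1)] by blast
  then have p': "has_partials u' ut (ux u)" using has_partials_cong eq by metis
  show "U1 u'" by (rule U1I[OF p' p(2)])
  show "\<And>t x. t \<in> {0..1} \<Longrightarrow> x > 0 \<Longrightarrow> ux u' t x = ux u t x" by (rule ux_eq_if_has_partials[OF p'])
qed

section \<open>The inverse marginal utility\<close>

definition marginal_inverse :: "(real \<Rightarrow> real \<Rightarrow> real) \<Rightarrow> real \<Rightarrow> real \<Rightarrow> real" where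
  "marginal_inverse v t y = (THE x. 0 < x \<and> v t x = y)"

lemma InadaD:
  assumes "Inada v" "t \<in> {0..1}"
  shows "\<And>x. x > 0 \<Longrightarrow> v t x > 0" "\<And>x y. 0 < x \<Longrightarrow> x < y \<Longrightarrow> v t y < v t x"
    "filterlim (v t) at_top (at_right 0)" "(v t \<longlongrightarrow> 0) at_top"
    "continuous_on Dom (\<lambda>p. v (fst p) (snd p))" "continuous_on {0<..} (v t)"
proof -
  show 0: "continuous_on Dom (\<lambda>p. v (fst p) (snd p))" using assms by (auto simp: Inada_def)
  have "continuous_on {0<..} (\<lambda>x. (t, x))" by (intro continuous_intros)
  from continuous_on_compose2[OF 0 this]
  have "Pair t ` {0<..} \<subseteq> Dom \<Longrightarrow> continuous_on {0<..} (v t)" by simp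
  moreover have "Pair t ` {0<..} \<subseteq> Dom" using assms by auto
  ultimately show "continuous_on {0<..} (v t)" by blast
qed (use assms in \<open>auto simp: Inada_def\<close>)

lemma Inada_less_iff:
  assumes "Inada v" "t \<in> {0..1}" "0 < x" "0 < y"
  shows "v t x < v t y \<longleftrightarrow> y < x"
  using InadaD(2)[OF assms(1,2)] assms(3,4) by (metis less_asym linorder_neqE_linordered_idom)

lemma Inada_eq_iff:
  assumes "Inada v" "t \<in> {0..1}" "0 < x" "0 < y"
  shows "v t x = v t y \<longleftrightarrow> x = y"
  using Inada_less_iff[OF assms(1,2)] assms(3,4) by (metis less_irrefl linorder_neqE_linordered_idom)

lemma marginal_inverse:
  assumes v: "Inada v" "t \<in> {0..1}" and y: "y > 0"
  shows "marginal_inverse v t y > 0" "v t (marginal_inverse v t y) = y"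
proof -
  \<comment> \<open>The Inada limits at 0 and at infinity supply points with values above and below
    \<open>y\<close> for the intermediate value theorem.\<close>
  have "eventually (\<lambda>x. y < v t x \<and> 0 < x) (at_right 0)"
    using InadaD(3)[OF v] eventually_at_right_less[of "0::real"]
    by (auto simp: filterlim_at_top_dense eventually_conj_iff)
  then obtain a where a: "y < v t a" "0 < a"
    using eventually_happens[of _ "at_right (0::real)"] by (auto simp: trivial_limit_at_right_real)
  have "eventually (\<lambda>x. v t x < y \<and> a < x) at_top"
    using order_tendstoD(2)[OF InadaD(4)[OF v] y] eventually_gt_at_top[of a]
    by (simp add: eventually_conj_iff)
  then obtain b where b: "v t b < y" "a < b"
    using eventually_happens[of _ "at_top :: real filter"] by auto
  have "continuous_on {a..b} (v t)"
    by (rule continuous_on_subset[OF InadaD(6)[OF v]]) (use a in auto)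
  then obtain x where x: "a \<le> x" "x \<le> b" "v t x = y"
    using IVT2'[of "v t" b y a] a b by auto
  have "\<exists>!x. 0 < x \<and> v t x = y"
    using x a Inada_eq_iff[OF v] by (intro ex1I[of _ x]) auto
  from theI'[OF this] show "marginal_inverse v t y > 0" "v t (marginal_inverse v t y) = y"
    by (auto simp: marginal_inverse_def)
qed

lemma marginal_inverse_apply:
  assumes "Inada v" "t \<in> {0..1}" "x > 0"
  shows "marginal_inverse v t (v t x) = x"
  using assms marginal_inverse[OF assms(1,2)] InadaD(1)[OF assms] Inada_eq_iff[OF assms(1,2)] by blast

text \<open>As \<open>v t\<close> is decreasing, a comparison with the inverse becomes a comparison
  with \<open>v t\<close> at a fixed point. The continuity and limit statements about the inverse
  rest on these two equivalences.\<close>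

lemma less_marginal_inverse_iff:
  assumes "Inada v" "t \<in> {0..1}" "x > 0" "y > 0"
  shows "x < marginal_inverse v t y \<longleftrightarrow> y < v t x" "marginal_inverse v t y < x \<longleftrightarrow> v t x < y"
  using Inada_less_iff[OF assms(1,2), of x "marginal_inverse v t y"]
    Inada_less_iff[OF assms(1,2), of "marginal_inverse v t y" x] marginal_inverse[OF assms(1,2,4)] assms(3)
  by auto

text \<open>Joint continuity is checked in the order topology: for positive \<open>a\<close>, the
  inverse at \<open>(t, y)\<close> exceeds \<open>a\<close> exactly if \<open>y < v t a\<close>, and
  for fixed \<open>a\<close> this is an open condition in \<open>(t, y)\<close>.\<close>

lemma Inada_marginal_inverse:
  assumes v: "Inada v"
  shows "Inada (marginal_inverse v)"
  unfolding Inada_def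
proof (intro conjI ballI allI impI)
  show "continuous_on Dom (\<lambda>p. marginal_inverse v (fst p) (snd p))"
    unfolding continuous_on_def
  proof
    fix p assume p: "p \<in> Dom"
    obtain t y where ty: "p = (t, y)" "t \<in> {0..1}" "y > 0" using p by (cases p) auto
    have ev: "eventually (\<lambda>q. q \<in> Dom) (at p within Dom)" by (simp add: eventually_at_filter)
    have v_lim: "((\<lambda>q. v (fst q) x - snd q) \<longlongrightarrow> v t x - y) (at p within Dom)" if "x > 0" for x
    proof -
      have "continuous_on Dom (\<lambda>q. (fst q, x))" by (intro continuous_intros)
      from continuous_on_compose2[OF InadaD(5)[OF v ty(2)] this]
      have "(\<lambda>q. (fst q, x)) ` Dom \<subseteq> Dom \<Longrightarrow> continuous_on Dom (\<lambda>q. v (fst q) x)" by simp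
      moreover have "(\<lambda>q. (fst q, x)) ` Dom \<subseteq> Dom" using that by (auto simp: Dom_def)
      ultimately have "continuous_on Dom (\<lambda>q. v (fst q) x)" by blast
      then have "continuous_on Dom (\<lambda>q. v (fst q) x - snd q)" by (intro continuous_intros)
      then show ?thesis using p ty unfolding continuous_on_def by (metis fst_conv snd_conv)
    qed
    show "((\<lambda>p. marginal_inverse v (fst p) (snd p)) \<longlongrightarrow> marginal_inverse v (fst p) (snd p)) (at p within Dom)"
    proof (rule order_tendstoI)
      fix a assume a: "a < marginal_inverse v (fst p) (snd p)"
      show "\<forall>\<^sub>F q in at p within Dom. a < marginal_inverse v (fst q) (snd q)"
      proof (cases "a > 0")
        case True
        then have "v t a - y > 0" using a ty less_marginal_inverse_iff[OF v ty(2)] by auto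
        from order_tendstoD(1)[OF v_lim[OF True] this] ev show ?thesis
          by eventually_elim (use less_marginal_inverse_iff[OF v] True in \<open>auto simp: Dom_def\<close>)
      next
        case False
        from ev show ?thesis
          by eventually_elim (use marginal_inverse(1)[OF v] False in \<open>force simp: Dom_def\<close>)
      qed
    next
      fix a assume a: "a > marginal_inverse v (fst p) (snd p)"
      then have pos: "a > 0" using marginal_inverse(1)[OF v ty(2,3)] ty by auto
      then have "v t a - y < 0" using a ty less_marginal_inverse_iff[OF v ty(2)] by auto
      from order_tendstoD(2)[OF v_lim[OF pos] this] ev
      show "\<forall>\<^sub>F q in at p within Dom. marginal_inverse v (fst q) (snd q) < a"
        by eventually_elim (use less_marginal_inverse_iff[OF v] pos in \<open>auto simp: Dom_def\<close>)
    qed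
  qed
  fix t :: real assume t: "t \<in> {0..1}"
  show "marginal_inverse v t x > 0" if "x > 0" for x by (rule marginal_inverse[OF v t that])
  show "marginal_inverse v t y < marginal_inverse v t x" if "0 < x" "x < y" for x y
    using less_marginal_inverse_iff(2)[OF v t, of "marginal_inverse v t x" y] marginal_inverse[OF v t] that by auto
  show "filterlim (marginal_inverse v t) at_top (at_right 0)"
    unfolding filterlim_at_top_gt[of _ _ 0]
  proof (intro allI impI)
    fix Z :: real assume Z: "0 < Z"
    have "eventually (\<lambda>y. y \<in> {0<..<v t Z}) (at_right 0)"
      by (rule eventually_at_right_real) (rule InadaD(1)[OF v t Z])
    then show "\<forall>\<^sub>F x in at_right 0. Z \<le> marginal_inverse v t x"
      by eventually_elim (use less_marginal_inverse_iff[OF v t] Z in \<open>auto intro: less_imp_le\<close>)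
  qed
  show "(marginal_inverse v t \<longlongrightarrow> 0) at_top"
  proof (rule order_tendstoI)
    fix a :: real assume "a < 0"
    show "\<forall>\<^sub>F x in at_top. a < marginal_inverse v t x"
      using eventually_gt_at_top[of 0]
      by eventually_elim (use marginal_inverse(1)[OF v t] \<open>a < 0\<close> in force)
  next
    fix a :: real assume "0 < a"
    show "\<forall>\<^sub>F x in at_top. marginal_inverse v t x < a"
      using eventually_gt_at_top[of "v t a"] eventually_gt_at_top[of 0]
      by eventually_elim (use less_marginal_inverse_iff[OF v t] \<open>0 < a\<close> in auto)
  qed
qed

section \<open>Conjugates and the envelope theorem\<close>

lemma tangent_bound:
  assumes p: "has_partials u ut v" and v: "Inada v" and t: "t \<in> {0..1}" "x > 0" "y > 0"
  shows "u t y \<le> u t x + v t x * (y - x)"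
proof (cases "x = y")
  case False
  have "strictly_concave_on {0<..} (u t)" using U1I[OF p v] t by (auto simp: U1_def)
  moreover have "(u t has_real_derivative v t x) (at x)" using p t by (auto simp: has_partials_def)
  ultimately show ?thesis using strictly_concave_tangent[of "u t" "v t x" x y] t False by auto
qed auto

text \<open>At the inverse marginal utility the tangent of \<open>u t\<close> has slope
  \<open>y\<close>, and the tangent inequality makes this point a minimiser. So the infimum is an
  honest minimum and no default value of \<open>INF\<close> enters.\<close>

lemma conj_x_eq:
  assumes p: "has_partials u ut v" and v: "Inada v" and t: "t \<in> {0..1}" "y > 0"
  shows "conj_x u t y = y * marginal_inverse v t y - u t (marginal_inverse v t y)"
proof -
  note J = marginal_inverse[OF v t]
  have "y * marginal_inverse v t y - u t (marginal_inverse v t y) \<le> y * z - u t z" if "z > 0" for z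
    using tangent_bound[OF p v t(1) J(1) that] J(2) by (simp add: algebra_simps)
  then show ?thesis unfolding conj_x_def
    by (intro cInf_eq_minimum) (use J in auto)
qed

lemma conj_x_le:
  assumes p: "has_partials u ut v" and v: "Inada v" and t: "t \<in> {0..1}" "y > 0" "x > 0"
  shows "conj_x u t y \<le> y * x - u t x"
  using tangent_bound[OF p v t(1) marginal_inverse(1)[OF v t(1,2)] t(3)]
  by (simp add: conj_x_eq[OF p v t(1,2)] marginal_inverse[OF v t(1,2)] algebra_simps)

text \<open>The envelope theorem: the two difference quotients of the conjugate are squeezed between
  values of the derivatives of \<open>u\<close> at the old and at the new optimiser.\<close>

lemma has_partials_conj_x:
  assumes p: "has_partials u ut v" and v: "Inada v"
  shows "has_partials (conj_x u) (\<lambda>t y. - ut t (marginal_inverse v t y)) (marginal_inverse v)"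
proof -
  define J where "J = marginal_inverse v"
  have Jc: "continuous_on Dom (\<lambda>p. J (fst p) (snd p))"
    using Inada_marginal_inverse[OF v] by (auto simp: Inada_def J_def)
  have J: "J t y > 0" "v t (J t y) = y" if "t \<in> {0..1}" "y > 0" for t y
    using marginal_inverse[OF v that] by (auto simp: J_def)
  have utc: "continuous_on Dom (\<lambda>p. ut (fst p) (snd p))" using p by (auto simp: has_partials_def)
  have "continuous_on Dom (\<lambda>q. (fst q, J (fst q) (snd q)))" by (intro continuous_intros Jc)
  from continuous_on_compose2[OF utc this]
  have "(\<lambda>q. (fst q, J (fst q) (snd q))) ` Dom \<subseteq> Dom \<Longrightarrow>
      continuous_on Dom (\<lambda>q. ut (fst q) (J (fst q) (snd q)))" by simp
  moreover have "(\<lambda>q. (fst q, J (fst q) (snd q))) ` Dom \<subseteq> Dom" using J by (auto simp: Dom_def)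
  ultimately have uJ: "continuous_on Dom (\<lambda>q. ut (fst q) (J (fst q) (snd q)))" by blast
  \<comment> \<open>The old optimiser \<open>J t y\<close> is an admissible competitor for the new
    data \<open>(s, z)\<close>; exchanging the roles of \<open>(t, y)\<close> and
    \<open>(s, z)\<close> yields the opposite bound.\<close>
  have le: "conj_x u s z - conj_x u t y \<le> (z - y) * J t y - (u s (J t y) - u t (J t y))"
    if "t \<in> {0..1}" "y > 0" "s \<in> {0..1}" "z > 0" for s z t y
    using conj_x_le[OF p v, of s z "J t y"] conj_x_eq[OF p v, of t y] that J[of t y]
    by (simp add: algebra_simps J_def)
  have dt: "((\<lambda>s. conj_x u s y) has_real_derivative - ut t (J t y)) (at t within {0..1})"
    if t: "t \<in> {0..1}" and y: "y > 0" for t y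
    unfolding has_field_derivative_def has_derivative_within_alt2
  proof (intro conjI allI impI)
    fix e :: real assume e: "e > 0"
    have tJ: "(t, J t y) \<in> Dom" using t J(1)[OF t y] by simp
    from utc[unfolded continuous_on_iff, rule_format, OF tJ e] obtain d where d: "d > 0"
      "\<And>q. q \<in> Dom \<Longrightarrow> dist q (t, J t y) < d \<Longrightarrow> dist (ut (fst q) (snd q)) (ut t (J t y)) < e"
      by auto
    \<comment> \<open>The linearisation in time has to be uniform in \<open>x\<close> near
      \<open>J t y\<close>, because the reverse bound evaluates it at the moving optimiser
      \<open>J s y\<close>. Taking \<open>d / 2\<close> in each coordinate keeps the distance below
      \<open>d\<close>.\<close>
    have lin: "\<bar>u s x - u t x - ut t (J t y) * (s - t)\<bar> \<le> e * \<bar>s - t\<bar>"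
      if s: "s \<in> {0..1}" "\<bar>s - t\<bar> < d / 2" and x: "x > 0" "\<bar>x - J t y\<bar> < d / 2" for s x
    proof -
      define g where "g = (\<lambda>r. u r x - ut t (J t y) * r)"
      have "norm (g s - g t) \<le> e * norm (s - t)"
      proof (rule field_differentiable_bound[where S="closed_segment t s"])
        fix r assume r: "r \<in> closed_segment t s"
        have sub: "closed_segment t s \<subseteq> {0..1}" using s t by (auto simp: closed_segment_eq_real_ivl)
        have "((\<lambda>r. u r x) has_real_derivative ut r x) (at r within {0..1})"
          using p sub r x by (auto simp: has_partials_def)
        from DERIV_subset[OF this sub]
        show "(g has_field_derivative ut r x - ut t (J t y)) (at r within closed_segment t s)"
          unfolding g_def by (auto intro!: derivative_eq_intros)
        have "\<bar>r - t\<bar> \<le> \<bar>s - t\<bar>" using r by (auto simp: closed_segment_eq_real_ivl split: if_splits)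
        then have "dist (r, x) (t, J t y) < d"
          using s x real_sqrt_sum_squares_triangle_ineq[of "r - t" 0 0 "x - J t y"]
          by (auto simp: dist_Pair_Pair dist_real_def)
        with d(2)[of "(r, x)"] sub r x show "norm (ut r x - ut t (J t y)) \<le> e"
          by (force simp: dist_real_def)
      qed auto
      then show ?thesis by (simp add: g_def algebra_simps)
    qed
    have "continuous_on {0..1} (\<lambda>s. (s, y))" by (intro continuous_intros)
    from continuous_on_compose2[OF Jc this]
    have "(\<lambda>s. (s, y)) ` {0..1} \<subseteq> Dom \<Longrightarrow> continuous_on {0..1} (\<lambda>s. J s y)" by simp
    moreover have "(\<lambda>s. (s, y)) ` {0..1} \<subseteq> Dom" using y by auto
    ultimately have "continuous_on {0..1} (\<lambda>s. J s y)" by blast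
    then have "((\<lambda>s. J s y) \<longlongrightarrow> J t y) (at t within {0..1})" using t by (auto simp: continuous_on_def)
    from tendstoD[OF this, of "d/2"] d(1)
    have 1: "\<forall>\<^sub>F s in at t within {0..1}. \<bar>J s y - J t y\<bar> < d / 2" by (simp add: dist_real_def)
    have 2: "\<forall>\<^sub>F s in at t within {0..1}. s \<in> {0..1} \<and> \<bar>s - t\<bar> < d / 2"
      unfolding eventually_at using d(1) by (intro exI[of _ "d/2"]) (auto simp: dist_real_def)
    from 1 2 show "\<forall>\<^sub>F s in at t within {0..1}.
       norm (conj_x u s y - conj_x u t y - - ut t (J t y) * (s - t)) \<le> e * norm (s - t)"
    proof eventually_elim
      case (elim s)
      then have s: "s \<in> {0..1}" by simp
      show ?case
        using le[OF t y s y] le[OF s y t y] lin[of s "J t y"] lin[of s "J s y"] elim J[OF t y] J[OF s y] d(1)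
        by (auto simp: abs_le_iff)
    qed
  qed (auto intro: bounded_linear_mult_right)
  have dy: "(conj_x u t has_real_derivative J t y) (at y)"
    if t: "t \<in> {0..1}" and y: "y > 0" for t y
    unfolding has_field_derivative_def has_derivative_within_alt2
  proof (intro conjI allI impI)
    fix e :: real assume e: "e > 0"
    have "isCont (J t) y"
      using InadaD(6)[OF Inada_marginal_inverse[OF v] t] y
      by (auto simp: J_def continuous_on_eq_continuous_at)
    then have "(J t \<longlongrightarrow> J t y) (at y)" by (simp add: isCont_def)
    from tendstoD[OF this e] have 1: "\<forall>\<^sub>F z in at y. \<bar>J t z - J t y\<bar> < e" by (simp add: dist_real_def)
    have 2: "\<forall>\<^sub>F z in at y. z > 0"
      using y eventually_at_in_open'[of "{0<..}" y] by auto
    from 1 2 show "\<forall>\<^sub>F z in at y. norm (conj_x u t z - conj_x u t y - J t y * (z - y)) \<le> e * norm (z - y)"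
    proof eventually_elim
      case (elim z)
      \<comment> \<open>The two competitor bounds differ exactly by the product on the right, which
        is small compared with \<open>z - y\<close> by continuity of \<open>J t\<close>.\<close>
      have "\<bar>conj_x u t z - conj_x u t y - J t y * (z - y)\<bar> \<le> \<bar>(J t z - J t y) * (z - y)\<bar>"
        using le[OF t y t elim(2)] le[OF t elim(2) t y] by (auto simp: algebra_simps)
      also have "\<dots> \<le> e * \<bar>z - y\<bar>" unfolding abs_mult by (intro mult_right_mono) (use elim in auto)
      finally show ?case by simp
    qed
  qed (auto intro: bounded_linear_mult_right)
  show ?thesis unfolding has_partials_def
    using uJ Jc dt dy by (auto simp: J_def intro!: continuous_intros)
qed

lemma U1_conj_x:
  assumes "U1 u"
  shows "U1 (conj_x u)"
    and "\<And>t y. t \<in> {0..1} \<Longrightarrow> y > 0 \<Longrightarrow> ux (conj_x u) t y = marginal_inverse (ux u) t y"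
proof -
  obtain ut where p: "has_partials u ut (ux u)" "Inada (ux u)" using U1D[OF assms] by blast
  note c = has_partials_conj_x[OF p]
  show "U1 (conj_x u)" by (rule U1I[OF c Inada_marginal_inverse[OF p(2)]])
  show "\<And>t y. t \<in> {0..1} \<Longrightarrow> y > 0 \<Longrightarrow> ux (conj_x u) t y = marginal_inverse (ux u) t y"
    by (rule ux_eq_if_has_partials[OF c])
qed

section \<open>Closure of \<open>U1\<close>\<close>

lemma filterlim_at_top_cmult_pos:
  fixes f :: "'a \<Rightarrow> real"
  shows "filterlim f at_top F \<Longrightarrow> c > 0 \<Longrightarrow> filterlim (\<lambda>x. c * f x) at_top F"
  by (rule filterlim_tendsto_pos_mult_at_top[OF tendsto_const])

lemma U1_scale:
  assumes "U1 u" and c: "c > 0"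
  shows "U1 (\<lambda>t x. c * u t x)"
    and "\<And>t x. t \<in> {0..1} \<Longrightarrow> x > 0 \<Longrightarrow> ux (\<lambda>t x. c * u t x) t x = c * ux u t x"
proof -
  obtain ut where p: "has_partials u ut (ux u)" "Inada (ux u)" using U1D[OF assms(1)] by blast
  have c': "has_partials (\<lambda>t x. c * u t x) (\<lambda>t x. c * ut t x) (\<lambda>t x. c * ux u t x)"
    using p(1) unfolding has_partials_def
    by (auto intro!: continuous_intros DERIV_cmult)
  have "Inada (\<lambda>t x. c * ux u t x)"
    using p(2) c unfolding Inada_def
    by (auto intro!: continuous_intros filterlim_at_top_cmult_pos tendsto_mult_right_zero)
  with c' show "U1 (\<lambda>t x. c * u t x)" by (rule U1I)
  show "\<And>t x. t \<in> {0..1} \<Longrightarrow> x > 0 \<Longrightarrow> ux (\<lambda>t x. c * u t x) t x = c * ux u t x"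
    by (rule ux_eq_if_has_partials[OF c'])
qed

lemma U1_add:
  assumes "U1 u" "U1 w"
  shows "U1 (\<lambda>t x. u t x + w t x)"
    and "\<And>t x. t \<in> {0..1} \<Longrightarrow> x > 0 \<Longrightarrow> ux (\<lambda>t x. u t x + w t x) t x = ux u t x + ux w t x"
proof -
  obtain ut where p: "has_partials u ut (ux u)" "Inada (ux u)" using U1D[OF assms(1)] by blast
  obtain wt where q: "has_partials w wt (ux w)" "Inada (ux w)" using U1D[OF assms(2)] by blast
  have c': "has_partials (\<lambda>t x. u t x + w t x) (\<lambda>t x. ut t x + wt t x) (\<lambda>t x. ux u t x + ux w t x)"
    using p(1) q(1) unfolding has_partials_def
    by (auto intro!: continuous_intros DERIV_add)
  have "Inada (\<lambda>t x. ux u t x + ux w t x)"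
    using p(2) q(2) unfolding Inada_def
    by (auto intro!: continuous_intros filterlim_at_top_add_at_top tendsto_add_zero add_strict_mono add_pos_pos)
  with c' show "U1 (\<lambda>t x. u t x + w t x)" by (rule U1I)
  show "\<And>t x. t \<in> {0..1} \<Longrightarrow> x > 0 \<Longrightarrow> ux (\<lambda>t x. u t x + w t x) t x = ux u t x + ux w t x"
    by (rule ux_eq_if_has_partials[OF c'])
qed

text \<open>For the common marginal value \<open>y\<close> the optimal parts are \<open>a\<close>
  and \<open>b\<close>, and \<open>a + b = x\<close> by the choice of \<open>y\<close>. The
  conjugate equals \<open>u t a + w t b\<close>, and tangents of equal slope \<open>y\<close> show
  that no other split of \<open>x\<close> does better.\<close>

lemma supconv_eq_conj_x:
  assumes u: "U1 u" and w: "U1 w" and t: "t \<in> {0..1}" "x > 0"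
  shows "supconv u w t x = conj_x (\<lambda>t y. conj_x u t y + conj_x w t y) t x"
proof -
  obtain ut where p: "has_partials u ut (ux u)" "Inada (ux u)" using U1D[OF u] by blast
  obtain wt where q: "has_partials w wt (ux w)" "Inada (ux w)" using U1D[OF w] by blast
  define f where "f = (\<lambda>t y. conj_x u t y + conj_x w t y)"
  have f: "U1 f" "\<And>t y. t \<in> {0..1} \<Longrightarrow> y > 0 \<Longrightarrow>
      ux f t y = marginal_inverse (ux u) t y + marginal_inverse (ux w) t y"
    using U1_add[OF U1_conj_x(1)[OF u] U1_conj_x(1)[OF w]] U1_conj_x(2)[OF u] U1_conj_x(2)[OF w]
    by (auto simp: f_def)
  obtain ft where r: "has_partials f ft (ux f)" "Inada (ux f)" using U1D[OF f(1)] by blast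
  define y where "y = marginal_inverse (ux f) t x"
  have y: "y > 0" "ux f t y = x" using marginal_inverse[OF r(2) t] by (auto simp: y_def)
  define a b where "a = marginal_inverse (ux u) t y" and "b = marginal_inverse (ux w) t y"
  have ab: "a > 0" "b > 0" "ux u t a = y" "ux w t b = y"
    using marginal_inverse[OF p(2) t(1) y(1)] marginal_inverse[OF q(2) t(1) y(1)] by (auto simp: a_def b_def)
  have x: "x = a + b" using f(2)[OF t(1) y(1)] y(2) by (simp add: a_def b_def)
  have "conj_x f t x = x * y - (y * a - u t a) - (y * b - w t b)"
    using conj_x_eq[OF r t] conj_x_eq[OF p t(1) y(1)] conj_x_eq[OF q t(1) y(1)]
      fun_cong[OF fun_cong[OF f_def], of t y]
    by (simp add: y_def[symmetric] a_def[symmetric] b_def[symmetric])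
  then have e: "conj_x f t x = u t a + w t b" by (simp add: x algebra_simps)
  have "u t z + w t (x - z) \<le> u t a + w t b" if "z \<in> {0<..<x}" for z
    using tangent_bound[OF p t(1) ab(1), of z] tangent_bound[OF q t(1) ab(2), of "x - z"] that ab(3,4)
    by (simp add: x algebra_simps)
  then have "supconv u w t x = u t a + w t b"
    unfolding supconv_def
    by (intro cSup_eq_maximum) (use ab x in \<open>auto intro!: image_eqI[of _ _ a]\<close>)
  with e show ?thesis by (simp add: f_def)
qed

text \<open>Since the \<open>sup\<close>-convolution is the conjugate of a sum of conjugates, closure under it
  comes for free.\<close>

lemma closed_cone_familyI:
  assumes U1: "\<And>u. P u \<Longrightarrow> U1 u"
    and cong: "\<And>u u'. P u \<Longrightarrow> (\<And>t x. t \<in> {0..1} \<Longrightarrow> x > 0 \<Longrightarrow> u' t x = u t x) \<Longrightarrow> P u'"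
    and scale: "\<And>u c. P u \<Longrightarrow> c > 0 \<Longrightarrow> P (\<lambda>t x. c * u t x)"
    and add: "\<And>u w. P u \<Longrightarrow> P w \<Longrightarrow> P (\<lambda>t x. u t x + w t x)"
    and conj: "\<And>u. P u \<Longrightarrow> P (conj_x u)"
  shows "closed_cone_family P"
  unfolding closed_cone_family_def
proof (intro conjI allI impI)
  fix u w assume uw: "P u" "P w"
  have "P (conj_x (\<lambda>t y. conj_x u t y + conj_x w t y))" by (intro conj add uw)
  then show "P (supconv u w)"
    by (rule cong) (rule supconv_eq_conj_x[OF U1[OF uw(1)] U1[OF uw(2)]])
qed (auto intro: scale add conj)

lemma closed_cone_family_U1: "closed_cone_family U1"
  by (rule closed_cone_familyI) (auto intro: U1_cong(1) U1_scale(1) U1_add(1) U1_conj_x(1))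

section \<open>Weak derivatives of inverse functions\<close>

text \<open>Integrability provides Lebesgue measurable functions only, which are not stable under
  composition. A Borel version can be composed with the inverse marginal utility and used with image
  measures.\<close>

lemma borel_representative:
  fixes g :: "real \<Rightarrow> real"
  assumes "\<And>a b. 0 < a \<Longrightarrow> a \<le> b \<Longrightarrow> g absolutely_integrable_on {a..b}"
  obtains g' where "g' \<in> borel_measurable borel" "AE x in lborel. x > 0 \<longrightarrow> g' x = g x"
proof -
  \<comment> \<open>Compact intervals exhausting the half-line; the shift by 1 avoids division by
    zero at \<open>n = 0\<close>.\<close>
  define I where "I = (\<lambda>n::nat. {1 / (real n + 1)..real n + 1})"
  have "(\<lambda>x. indicator {0<..} x * g x) \<in> borel_measurable lebesgue"
  proof (rule borel_measurable_LIMSEQ_real)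
    fix n
    have "1 / (real n + 1) \<le> real n + 1" by (simp add: divide_le_eq algebra_simps)
    then have "g absolutely_integrable_on (I n)" unfolding I_def by (intro assms) auto
    then show "(\<lambda>x. indicator (I n) x * g x) \<in> borel_measurable lebesgue"
      by (auto simp: set_integrable_def dest: borel_measurable_integrable)
  next
    fix x :: real
    show "(\<lambda>n. indicator (I n) x * g x) \<longlonglongrightarrow> indicator {0<..} x * g x"
    proof (rule tendsto_eventually)
      show "\<forall>\<^sub>F n in sequentially. indicator (I n) x * g x = indicator {0<..} x * g x"
      proof (cases "x > 0")
        case True
        have "\<forall>\<^sub>F n in sequentially. real n > max x (1 / x)" by real_asymp
        then show ?thesis
        proof eventually_elim
          case (elim n)
          then have "1 < real n * x" using True by (simp add: pos_divide_less_eq)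
          then have "1 \<le> x * (real n + 1)" using True by (simp add: algebra_simps)
          then show ?case using elim True by (auto simp: I_def pos_divide_le_eq indicator_def)
        qed
      next
        case False
        then have "x \<notin> I n" for n by (auto simp: I_def not_le intro: le_less_trans[of x 0])
        then show ?thesis using False by auto
      qed
    qed
  qed
  from completion_ex_borel_measurable_real[OF this] obtain g' where
    g': "g' \<in> borel_measurable lborel" "AE x in lborel. indicator {0<..} x * g x = g' x" by blast
  show ?thesis
  proof
    show "g' \<in> borel_measurable borel" using g'(1) by simp
    show "AE x in lborel. x > 0 \<longrightarrow> g' x = g x" using g'(2) by (auto elim!: eventually_mono)
  qed
qed

text \<open>Under \<open>v\<close> the measure with density \<open>- g\<close> is pushed forward to Lebesgue measure, so
  \<open>1 / g (J y)\<close> is a weak derivative of the inverse \<open>J\<close> of \<open>v\<close> although \<open>v\<close> need not be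
  differentiable in the classical sense.\<close>

lemma weak_derivative_inverse:
  fixes v J g :: "real \<Rightarrow> real"
  assumes vc: "continuous_on {0<..} v" and Jc: "continuous_on {0<..} J"
    and vpos: "\<And>x. x > 0 \<Longrightarrow> v x > 0"
    and vdec: "\<And>x y. x > 0 \<Longrightarrow> y > 0 \<Longrightarrow> v x < v y \<longleftrightarrow> y < x"
    and J: "\<And>y. y > 0 \<Longrightarrow> J y > 0" "\<And>y. y > 0 \<Longrightarrow> v (J y) = y"
    and g: "g \<in> borel_measurable borel" "\<And>x. x > 0 \<Longrightarrow> g x < 0"
    and int: "\<And>a b. 0 < a \<Longrightarrow> a \<le> b \<Longrightarrow> (g has_integral v b - v a) {a..b}"
    and ab: "0 < a" "a \<le> b"
  shows "((\<lambda>y. 1 / g (J y)) has_integral J b - J a) {a..b}"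
proof -
  \<comment> \<open>Extension by zero makes both functions Borel on the whole line, as image
    measures require.\<close>
  define v' where "v' = (\<lambda>x. indicator {0<..} x *\<^sub>R v x)"
  define J' where "J' = (\<lambda>x. indicator {0<..} x *\<^sub>R J x)"
  have v'_m[measurable]: "v' \<in> borel_measurable borel" unfolding v'_def
    by (rule borel_measurable_continuous_on_indicator[OF _ vc]) simp
  have J'_m[measurable]: "J' \<in> borel_measurable borel" unfolding J'_def
    by (rule borel_measurable_continuous_on_indicator[OF _ Jc]) simp
  note [measurable] = g(1)
  have b: "b > 0" using ab by simp
  have Jv: "J (v x) = x" if "x > 0" for x
    using vdec[OF that J(1)[OF vpos[OF that]]] vdec[OF J(1)[OF vpos[OF that]] that] J(2)[OF vpos[OF that]] by auto
  have Jle: "J y \<le> J x" if "0 < x" "x \<le> y" for x y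
    using vdec[of "J y" "J x"] J[of x] J[of y] that by auto
  define A where "A = J b"
  define B where "B = J a"
  have AB: "0 < A" "A \<le> B" using J b Jle ab by (auto simp: A_def B_def)
  define M where "M = distr (density lborel (\<lambda>x. ennreal (indicator {A..B} x * - g x))) borel v'"
  define L where "L = density lborel (\<lambda>y. indicator {a..b} y :: ennreal)"
  have gpos: "0 \<le> - g x" if "x \<in> {A..B}" for x using g(2)[of x] AB that by auto
  have eqL: "emeasure L {c<..} = ennreal (b - min b (max a c))" for c
  proof -
    have "emeasure L {c<..} = (\<integral>\<^sup>+ y. indicator {a..b} y * indicator {c<..} y \<partial>lborel)"
      unfolding L_def by (subst emeasure_density) auto
    also have "\<dots> = (\<integral>\<^sup>+ y. indicator ({a..b} \<inter> {c<..}) y \<partial>lborel)"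
      by (intro nn_integral_cong) (auto simp: indicator_def)
    also have "\<dots> = emeasure lborel ({a..b} \<inter> {c<..})" by simp
    also have "\<dots> = ennreal (b - min b (max a c))"
    proof (cases "c < a")
      case True
      then have "{a..b} \<inter> {c<..} = {a..b}" by auto
      then show ?thesis using True ab by (simp add: min_def max_def)
    next
      case False
      then have "{a..b} \<inter> {c<..} = {c<..b}" by auto
      then show ?thesis using False ab by (auto simp: min_def max_def)
    qed
    finally show ?thesis .
  qed
  have eqM: "emeasure M {c<..} = ennreal (b - min b (max a c))" for c
  proof -
    \<comment> \<open>The image measure lives on \<open>[a, b]\<close>, so the threshold is clamped
      to that interval without changing the mass above it.\<close>
    define c' where "c' = min b (max a c)"
    have c': "a \<le> c'" "c' \<le> b" "c' > 0" using ab by (auto simp: c'_def)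
    define C where "C = J c'"
    have C: "A \<le> C" "C \<le> B" using c' Jle ab by (auto simp: A_def B_def C_def)
    \<comment> \<open>At \<open>C\<close> strict and weak inequality may disagree, but a single
      point is a null set.\<close>
    have iff: "x \<in> {A..B} \<and> c < v' x \<longleftrightarrow> x \<in> {A..C}" if "x \<noteq> C" for x
    proof (cases "x \<in> {A..B}")
      case True
      then have x: "x > 0" using AB by auto
      have vx: "a \<le> v x" "v x \<le> b"
        using True vdec[OF x, of B] vdec[of A x] AB x J b ab by (auto simp: A_def B_def not_less[symmetric])
      have "x < C \<longleftrightarrow> c' < v x" using vdec[of C x] x J c' by (auto simp: C_def)
      moreover have "x \<noteq> C \<Longrightarrow> v x \<noteq> c'" using Jv[OF x] by (auto simp: C_def)
      moreover have "c' < v x \<longleftrightarrow> c < v x" if "v x \<noteq> c'"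
        using vx that by (auto simp: c'_def min_def max_def split: if_splits)
      ultimately show ?thesis using True that x by (auto simp: v'_def)
    next
      case False then show ?thesis using C by auto
    qed
    have "emeasure M {c<..} = (\<integral>\<^sup>+ x. ennreal (indicator {A..B} x * - g x) * indicator (v' -` {c<..}) x \<partial>lborel)"
    proof -
      have "v' -` {c<..} \<in> sets lborel" using measurable_sets_borel[OF v'_m, of "{c<..}"] by simp
      then show ?thesis unfolding M_def by (subst emeasure_distr) (simp_all add: emeasure_density)
    qed
    also have "\<dots> = (\<integral>\<^sup>+ x. ennreal (indicator {A..C} x * - g x) \<partial>lborel)"
    proof (rule nn_integral_cong_AE)
      have "AE x in lborel. x \<noteq> C" by (rule AE_lborel_singleton)
      then show "AE x in lborel. ennreal (indicator {A..B} x * - g x) * indicator (v' -` {c<..}) x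
          = ennreal (indicator {A..C} x * - g x)"
        by (rule eventually_mono) (use iff in \<open>auto simp: indicator_def\<close>)
    qed
    also have "\<dots> = ennreal (v A - v C)"
    proof (rule nn_integral_has_integral_lebesgue)
      show "((\<lambda>x. - g x) has_integral v A - v C) {A..C}"
        using has_integral_neg[OF int[OF AB(1) C(1)]] by simp
    qed (use gpos C in auto)
    also have "v A - v C = b - c'" using J b c' by (auto simp: A_def C_def)
    finally show ?thesis by (simp add: c'_def)
  qed
  \<comment> \<open>Measures that give all open upper half-lines the same finite mass
    coincide.\<close>
  have M_eq_L: "M = L"
    by (rule measure_eqI_lessThan) (auto simp: eqM eqL, auto simp: M_def L_def)
  define h where "h = (\<lambda>y. ennreal (1 / - g (J' y)))"
  have h_m[measurable]: "h \<in> borel_measurable borel" unfolding h_def by measurable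
  have "(\<integral>\<^sup>+ y. ennreal (indicator {a..b} y * (1 / - g (J' y))) \<partial>lborel) = (\<integral>\<^sup>+ y. h y \<partial>L)"
    unfolding L_def h_def by (subst nn_integral_density) (auto intro!: nn_integral_cong simp: indicator_def)
  also have "\<dots> = (\<integral>\<^sup>+ y. h y \<partial>M)" by (simp add: M_eq_L)
  also have "\<dots> = (\<integral>\<^sup>+ x. ennreal (indicator {A..B} x * - g x) * h (v' x) \<partial>lborel)"
    unfolding M_def by (subst nn_integral_distr) (auto simp: nn_integral_density)
  \<comment> \<open>The density \<open>- g\<close> cancels against \<open>1 / - g\<close>, because
    \<open>J'\<close> inverts \<open>v'\<close> on \<open>[A, B]\<close>; what remains is the length
    \<open>B - A\<close>.\<close>
  also have "\<dots> = (\<integral>\<^sup>+ x. indicator {A..B} x \<partial>lborel)"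
  proof (intro nn_integral_cong)
    fix x :: real
    show "ennreal (indicator {A..B} x * - g x) * h (v' x) = indicator {A..B} x"
    proof (cases "x \<in> {A..B}")
      case True
      then have x: "x > 0" using AB by auto
      then have "J' (v' x) = x" using vpos Jv by (auto simp: J'_def v'_def)
      then show ?thesis using True g(2)[OF x] by (simp add: h_def ennreal_mult[symmetric] flip: ennreal_mult')
    qed auto
  qed
  also have "\<dots> = ennreal (B - A)" using AB by simp
  finally have "((\<lambda>y. indicator {a..b} y * (1 / - g (J' y))) has_integral B - A) UNIV"
  proof (intro nn_integral_has_integral)
    show "0 \<le> indicator {a..b} y * (1 / - g (J' y))" for y
      using ab g(2)[OF J(1), of y] by (auto simp: indicator_def J'_def divide_nonneg_neg)
  qed (use AB in auto)
  moreover have "(\<lambda>y. indicator {a..b} y * (1 / - g (J' y))) = (\<lambda>y. if y \<in> {a..b} then - (1 / g (J y)) else 0)"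
    using ab by (auto simp: indicator_def J'_def fun_eq_iff)
  ultimately have "((\<lambda>y. if y \<in> {a..b} then - (1 / g (J y)) else 0) has_integral B - A) UNIV" by simp
  then have "((\<lambda>y. - (1 / g (J y))) has_integral B - A) {a..b}" by (simp only: has_integral_restrict_UNIV)
  from has_integral_neg[OF this] show ?thesis by (simp add: A_def B_def)
qed

section \<open>Calculus of weak derivatives in \<open>x\<close>\<close>

lemma weak_deriv_x_cong:
  assumes "weak_deriv_x f g"
    and "\<And>t x. t \<in> {0..1} \<Longrightarrow> x > 0 \<Longrightarrow> f' t x = f t x"
  shows "weak_deriv_x f' g"
  using assms unfolding weak_deriv_x_def by auto

lemma weak_deriv_x_cmult:
  assumes "weak_deriv_x f g"
  shows "weak_deriv_x (\<lambda>t x. c * f t x) (\<lambda>t x. c * g t x)"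
  unfolding weak_deriv_x_def
proof (intro ballI allI impI)
  fix t a b :: real assume t: "t \<in> {0..1}" "0 < a" "a \<le> b"
  then have "g t absolutely_integrable_on {a..b}" "f t b - f t a = integral {a..b} (g t)"
    using assms unfolding weak_deriv_x_def by blast+
  then show "(\<lambda>x. c * g t x) absolutely_integrable_on {a..b} \<and>
      c * f t b - c * f t a = integral {a..b} (\<lambda>x. c * g t x)"
    by (simp add: right_diff_distrib[symmetric] set_integrable_mult_right)
qed

lemma weak_deriv_x_add:
  assumes "weak_deriv_x f1 g1" "weak_deriv_x f2 g2"
  shows "weak_deriv_x (\<lambda>t x. f1 t x + f2 t x) (\<lambda>t x. g1 t x + g2 t x)"
  unfolding weak_deriv_x_def
proof (intro ballI allI impI)
  fix t a b :: real assume t: "t \<in> {0..1}" "0 < a" "a \<le> b"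
  have 1: "g1 t absolutely_integrable_on {a..b}" "f1 t b - f1 t a = integral {a..b} (g1 t)"
    using assms(1) t unfolding weak_deriv_x_def by blast+
  have 2: "g2 t absolutely_integrable_on {a..b}" "f2 t b - f2 t a = integral {a..b} (g2 t)"
    using assms(2) t unfolding weak_deriv_x_def by blast+
  have "integral {a..b} (\<lambda>x. g1 t x + g2 t x) = integral {a..b} (g1 t) + integral {a..b} (g2 t)"
    by (intro integral_add set_lebesgue_integral_eq_integral(1) 1 2)
  then show "(\<lambda>x. g1 t x + g2 t x) absolutely_integrable_on {a..b} \<and>
      f1 t b + f2 t b - (f1 t a + f2 t a) = integral {a..b} (\<lambda>x. g1 t x + g2 t x)"
    using 1 2 by (auto intro: set_integral_add(1))
qed

lemma weak_deriv_x_integrable: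
  assumes "weak_deriv_x f g" "t \<in> {0..1}" "0 < a" "a \<le> b"
  shows "g t absolutely_integrable_on {a..b}" "g t integrable_on {a..b}"
    "f t b - f t a = integral {a..b} (g t)" "(g t has_integral f t b - f t a) {a..b}"
proof -
  show 1: "g t absolutely_integrable_on {a..b}" and 2: "f t b - f t a = integral {a..b} (g t)"
    using assms unfolding weak_deriv_x_def by blast+
  show 3: "g t integrable_on {a..b}" by (rule set_lebesgue_integral_eq_integral(1)[OF 1])
  show "(g t has_integral f t b - f t a) {a..b}" using 2 3 by (simp add: has_integral_integral)
qed

text \<open>An indefinite integral is continuous. For \<open>U3\<close> this applies to the second
  derivative, which has a weak derivative of its own.\<close>

lemma weak_deriv_x_continuous:
  assumes w: "weak_deriv_x f g" "t \<in> {0..1}"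
  shows "continuous_on {0<..} (f t)"
proof -
  have "isCont (f t) x" if x: "x > 0" for x
  proof -
    have "continuous_on {x/2..2*x} (\<lambda>y. f t (x/2) + integral {x/2..y} (g t))"
      by (intro continuous_intros indefinite_integral_continuous_1 weak_deriv_x_integrable[OF w]) (use x in auto)
    then have "continuous_on {x/2..2*x} (f t)"
      by (rule continuous_on_eq) (use weak_deriv_x_integrable(3)[OF w, of "x/2"] x in force)
    then show ?thesis by (rule continuous_on_interior) (use x in auto)
  qed
  then show ?thesis by (auto simp: continuous_on_eq_continuous_at)
qed

text \<open>The fundamental theorem of calculus. Together with the preceding fact it makes marginal
  utilities in \<open>U3\<close> differentiable in \<open>x\<close> at every point.\<close>

lemma weak_deriv_x_has_derivative:
  assumes w: "weak_deriv_x f g" "t \<in> {0..1}" and c: "continuous_on {0<..} (g t)" and x: "x > 0"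
  shows "(f t has_real_derivative g t x) (at x)"
proof -
  have "continuous_on {x/2..2*x} (g t)" by (rule continuous_on_subset[OF c]) (use x in auto)
  from integral_has_real_derivative[OF this, of x]
  have "((\<lambda>y. f t (x/2) + integral {x/2..y} (g t)) has_real_derivative g t x) (at x within {x/2..2*x})"
    using x by (auto intro!: derivative_eq_intros)
  then have "((\<lambda>y. f t (x/2) + integral {x/2..y} (g t)) has_real_derivative g t x) (at x)"
    using x by (simp add: at_within_Icc_at)
  then show ?thesis
    by (rule has_field_derivative_transform_within_open[where S="{x/2<..<2*x}"])
      (use weak_deriv_x_integrable(3)[OF w, of "x/2", symmetric] x in auto)
qed

lemma weak_deriv_xI:
  assumes d: "\<And>t x. t \<in> {0..1} \<Longrightarrow> x > 0 \<Longrightarrow> (f t has_real_derivative g t x) (at x)"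
    and c: "\<And>t. t \<in> {0..1} \<Longrightarrow> continuous_on {0<..} (g t)"
  shows "weak_deriv_x f g"
  unfolding weak_deriv_x_def
proof (intro ballI allI impI conjI)
  fix t a b :: real assume t: "t \<in> {0..1}" "0 < a" "a \<le> b"
  show "g t absolutely_integrable_on {a..b}"
    by (intro absolutely_integrable_continuous_real continuous_on_subset[OF c[OF t(1)]]) (use t in auto)
  have "(g t has_integral f t b - f t a) {a..b}"
    by (intro fundamental_theorem_of_calculus)
      (use d t in \<open>auto simp: has_real_derivative_iff_has_vector_derivative[symmetric] intro!: has_field_derivative_at_within[of _ _ _ "{a..b}"]\<close>)
  then show "f t b - f t a = integral {a..b} (g t)" by (simp add: integral_unique)
qed

section \<open>Bounded elasticity and the closure of \<open>U2\<close>\<close>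

lemma reciprocal_bounds:
  fixes z :: real
  assumes "N > 0" "1 / N \<le> z" "z \<le> N" "0 < z"
  shows "1 / N \<le> 1 / z" "1 / z \<le> N"
  using assms by (simp_all add: field_simps)

lemma mediant_bounds:
  fixes d1 d2 n1 n2 :: real
  assumes "d1 > 0" "d2 > 0" "lo \<le> n1 / d1" "n1 / d1 \<le> hi" "lo \<le> n2 / d2" "n2 / d2 \<le> hi"
  shows "lo \<le> (n1 + n2) / (d1 + d2)" "(n1 + n2) / (d1 + d2) \<le> hi"
  using assms by (simp_all add: field_simps)

text \<open>The second-order requirement of \<open>U2\<close>, detached from \<open>u\<close> so
  that closure can be proved for marginal utilities and their inverses.\<close>

definition elastic :: "(real \<Rightarrow> real \<Rightarrow> real) \<Rightarrow> bool" where
  "elastic v \<longleftrightarrow> (\<exists>g N. N > 0 \<and> weak_deriv_x v g \<and>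
     (\<forall>t\<in>{0..1}. \<forall>x>0. 1 / N \<le> - x * g t x / v t x \<and> - x * g t x / v t x \<le> N))"

lemma U2_iff: "U2 u \<longleftrightarrow> U1 u \<and> elastic (ux u)"
  by (auto simp: U2_def elastic_def)

lemma elastic_cong:
  assumes "elastic v" "\<And>t x. t \<in> {0..1} \<Longrightarrow> x > 0 \<Longrightarrow> v' t x = v t x"
  shows "elastic v'"
proof -
  obtain g N where "N > 0" "weak_deriv_x v g"
     "\<forall>t\<in>{0..1}. \<forall>x>0. 1 / N \<le> - x * g t x / v t x \<and> - x * g t x / v t x \<le> N"
    using assms(1) unfolding elastic_def by blast
  then show ?thesis unfolding elastic_def
    by (intro exI[of _ g] exI[of _ N]) (auto simp: assms(2) intro: weak_deriv_x_cong[OF _ assms(2)])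
qed

lemma elastic_scale:
  assumes "elastic v" "c > 0"
  shows "elastic (\<lambda>t x. c * v t x)"
proof -
  obtain g N where "N > 0" "weak_deriv_x v g"
     "\<forall>t\<in>{0..1}. \<forall>x>0. 1 / N \<le> - x * g t x / v t x \<and> - x * g t x / v t x \<le> N"
    using assms(1) unfolding elastic_def by blast
  then show ?thesis unfolding elastic_def
    by (intro exI[of _ "\<lambda>t x. c * g t x"] exI[of _ N])
      (use assms in \<open>auto simp: mult.left_commute intro: weak_deriv_x_cmult\<close>)
qed

lemma elastic_add:
  assumes "elastic v" "elastic w" and v: "Inada v" and w: "Inada w"
  shows "elastic (\<lambda>t x. v t x + w t x)"
proof -
  obtain g N where g: "N > 0" "weak_deriv_x v g"
     "\<forall>t\<in>{0..1}. \<forall>x>0. 1 / N \<le> - x * g t x / v t x \<and> - x * g t x / v t x \<le> N"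
    using assms(1) unfolding elastic_def by blast
  obtain h M where h: "M > 0" "weak_deriv_x w h"
     "\<forall>t\<in>{0..1}. \<forall>x>0. 1 / M \<le> - x * h t x / w t x \<and> - x * h t x / w t x \<le> M"
    using assms(2) unfolding elastic_def by blast
  define L where "L = max M N"
  have L: "L > 0" "1 / L \<le> 1 / N" "1 / L \<le> 1 / M" "N \<le> L" "M \<le> L"
    using g(1) h(1) by (auto simp: L_def intro!: divide_left_mono)
  show ?thesis unfolding elastic_def
  proof (intro exI conjI ballI allI impI)
    show "weak_deriv_x (\<lambda>t x. v t x + w t x) (\<lambda>t x. g t x + h t x)" by (rule weak_deriv_x_add[OF g(2) h(2)])
    fix t x :: real assume t: "t \<in> {0..1}" "x > 0"
    have b: "1 / L \<le> - x * g t x / v t x" "- x * g t x / v t x \<le> L"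
      "1 / L \<le> - x * h t x / w t x" "- x * h t x / w t x \<le> L"
      using g(3) h(3) t L by (meson order_trans)+
    from mediant_bounds[OF InadaD(1)[OF v t] InadaD(1)[OF w t] b]
    show "1 / L \<le> - x * (g t x + h t x) / (v t x + w t x)" "- x * (g t x + h t x) / (v t x + w t x) \<le> L"
      by (simp_all add: algebra_simps)
  qed (rule L)
qed

text \<open>The interval from \<open>1 / N\<close> to \<open>N\<close> is invariant under inversion.
  The work lies in the representative: the bounds must hold at every point, while a Borel version of
  \<open>g\<close> keeps them only almost everywhere.\<close>

lemma elastic_marginal_inverse:
  assumes e: "elastic v" and v: "Inada v"
  shows "elastic (marginal_inverse v)"
proof -
  define J where "J = marginal_inverse v"
  obtain g N where g: "N > 0" "weak_deriv_x v g"
     "\<forall>t\<in>{0..1}. \<forall>x>0. 1 / N \<le> - x * g t x / v t x \<and> - x * g t x / v t x \<le> N"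
    using e unfolding elastic_def by blast
  \<comment> \<open>The bounds at a single point already force \<open>1 / N \<le> N\<close>, so
    elasticity 1 is admissible for the correction below.\<close>
  have N: "1 / N \<le> 1" "1 \<le> N"
  proof -
    have "1 / N \<le> N" using g(3)[rule_format, of 0 1] by auto
    then have "1 \<le> N * N" using g(1) by (simp add: field_simps)
    then show "1 \<le> N" using g(1) mult_strict_mono[of N 1 N 1] by (cases "N < 1") auto
    then show "1 / N \<le> 1" by simp
  qed
  have "\<exists>G. (\<forall>a b. 0 < a \<longrightarrow> a \<le> b \<longrightarrow> G absolutely_integrable_on {a..b} \<and> J t b - J t a = integral {a..b} G) \<and>
      (\<forall>y>0. 1 / N \<le> - y * G y / J t y \<and> - y * G y / J t y \<le> N)" if t: "t \<in> {0..1}" for t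
  proof -
    note vt = InadaD[OF v t]
    have J: "J t y > 0" "v t (J t y) = y" if "y > 0" for y
      using marginal_inverse[OF v t that] by (auto simp: J_def)
    obtain g1 where g1: "g1 \<in> borel_measurable borel" "AE x in lborel. x > 0 \<longrightarrow> g1 x = g t x"
      using borel_representative[of "g t"] weak_deriv_x_integrable(1)[OF g(2) t] by blast
    define v1 where "v1 = (\<lambda>x. indicator {0<..} x *\<^sub>R v t x)"
    have v1[measurable]: "v1 \<in> borel_measurable borel" unfolding v1_def
      by (rule borel_measurable_continuous_on_indicator[OF _ vt(6)]) simp
    note [measurable] = g1(1)
    \<comment> \<open>Where the Borel version violates the bounds, which on the half-line happens on
      a null set only, it is replaced by \<open>- v / x\<close>, the choice with elasticity exactly
      1.\<close>
    define g2 where "g2 = (\<lambda>x. if 1 / N \<le> - x * g1 x / v1 x \<and> - x * g1 x / v1 x \<le> N then g1 x else - v1 x / x)"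
    have g2m: "g2 \<in> borel_measurable borel" unfolding g2_def by measurable
    have g2b: "1 / N \<le> - x * g2 x / v t x" "- x * g2 x / v t x \<le> N" if "x > 0" for x
      using that N vt(1)[OF that] by (auto simp: g2_def v1_def)
    have g2neg: "g2 x < 0" if "x > 0" for x
    proof -
      have "0 < - x * g2 x / v t x" using g2b(1)[OF that] g(1) by (meson less_le_trans zero_less_divide_1_iff)
      then show ?thesis using that vt(1)[OF that] by (simp add: divide_less_0_iff mult_less_0_iff)
    qed
    have ae: "AE x in lborel. x \<in> {a..b} \<longrightarrow> g t x = g2 x" if "0 < a" for a b
      using g1(2) by (rule eventually_mono) (use g(3) t that in \<open>auto simp: g2_def v1_def\<close>)
    have int: "(g2 has_integral v t b - v t a) {a..b}" if "0 < a" "a \<le> b" for a b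
      using weak_deriv_x_integrable(4)[OF g(2) t that] has_integral_AE[OF ae[OF that(1)]] by blast
    have Jc: "continuous_on {0<..} (J t)"
      unfolding J_def by (rule InadaD(6)[OF Inada_marginal_inverse[OF v] t])
    have H: "((\<lambda>y. 1 / g2 (J t y)) has_integral J t b - J t a) {a..b}" if "0 < a" "a \<le> b" for a b
      by (rule weak_derivative_inverse[where v="v t"])
        (use vt(6) Jc vt(1) Inada_less_iff[OF v t] J g2m g2neg int that in auto)
    show ?thesis
    proof (intro exI[of _ "\<lambda>y. 1 / g2 (J t y)"] conjI allI impI)
      fix a b :: real assume ab: "0 < a" "a \<le> b"
      show "J t b - J t a = integral {a..b} (\<lambda>y. 1 / g2 (J t y))" using H[OF ab] by (simp add: integral_unique)
      \<comment> \<open>Constant sign turns integrability into absolute integrability.\<close>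
      have "(\<lambda>y. - (1 / g2 (J t y))) absolutely_integrable_on {a..b}"
      proof (rule nonnegative_absolutely_integrable_1)
        show "(\<lambda>y. - (1 / g2 (J t y))) integrable_on {a..b}" using H[OF ab] by (intro integrable_neg) blast
        show "0 \<le> - (1 / g2 (J t y))" if "y \<in> {a..b}" for y
          using g2neg[OF J(1), of y] that ab by (simp add: divide_nonneg_neg less_imp_le)
      qed
      from set_integrable_mult_right[of "-1", OF this]
      show "(\<lambda>y. 1 / g2 (J t y)) absolutely_integrable_on {a..b}" by simp
    next
      fix y :: real assume y: "y > 0"
      have "1 / N \<le> - (J t y) * g2 (J t y) / y" "- (J t y) * g2 (J t y) / y \<le> N"
        using g2b[OF J(1)[OF y]] J(2)[OF y] by auto
      moreover have "0 < - (J t y) * g2 (J t y) / y"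
        using y J(1)[OF y] g2neg[OF J(1)[OF y]] by (simp add: divide_less_0_iff mult_less_0_iff)
      moreover have inv: "- y * (1 / g2 (J t y)) / J t y = 1 / (- (J t y) * g2 (J t y) / y)" by simp
      ultimately show "1 / N \<le> - y * (1 / g2 (J t y)) / J t y" "- y * (1 / g2 (J t y)) / J t y \<le> N"
        using reciprocal_bounds[OF g(1)] by (simp_all only: inv)
    qed
  qed
  \<comment> \<open>The construction is carried out for each \<open>t\<close> separately; choice
    assembles the family.\<close>
  then have "\<forall>t\<in>{0..1}. \<exists>G. (\<forall>a b. 0 < a \<longrightarrow> a \<le> b \<longrightarrow> G absolutely_integrable_on {a..b} \<and> J t b - J t a = integral {a..b} G) \<and>
      (\<forall>y>0. 1 / N \<le> - y * G y / J t y \<and> - y * G y / J t y \<le> N)" by blast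
  from bchoice[OF this] obtain G where G: "\<forall>t\<in>{0..1}. (\<forall>a b. 0 < a \<longrightarrow> a \<le> b \<longrightarrow> G t absolutely_integrable_on {a..b} \<and> J t b - J t a = integral {a..b} (G t)) \<and>
      (\<forall>y>0. 1 / N \<le> - y * G t y / J t y \<and> - y * G t y / J t y \<le> N)" by blast
  show ?thesis unfolding elastic_def J_def[symmetric] weak_deriv_x_def
    by (intro exI[of _ G] exI[of _ N]) (use G g(1) in auto)
qed

lemma closed_cone_family_U2: "closed_cone_family U2"
proof (rule closed_cone_familyI)
  fix u assume "U2 u"
  then have u: "U1 u" "elastic (ux u)" by (auto simp: U2_iff)
  then have p: "Inada (ux u)" using U1D by blast
  show "U1 u" by (rule u)
  show "U2 u'" if "\<And>t x. t \<in> {0..1} \<Longrightarrow> x > 0 \<Longrightarrow> u' t x = u t x" for u'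
    unfolding U2_iff using U1_cong[OF u(1) that] elastic_cong[OF u(2)] by blast
  show "U2 (\<lambda>t x. c * u t x)" if c: "c > 0" for c
    unfolding U2_iff using U1_scale[OF u(1) c] elastic_cong[OF elastic_scale[OF u(2) c]] by blast
  show "U2 (conj_x u)"
    unfolding U2_iff using U1_conj_x[OF u(1)] elastic_cong[OF elastic_marginal_inverse[OF u(2) p]] by blast
  fix w assume "U2 w"
  then have w: "U1 w" "elastic (ux w)" by (auto simp: U2_iff)
  then have q: "Inada (ux w)" using U1D by blast
  show "U2 (\<lambda>t x. u t x + w t x)"
    unfolding U2_iff using U1_add[OF u(1) w(1)] elastic_cong[OF elastic_add[OF u(2) w(2) p q]] by blast
qed

text \<open>The bounds refer to some representative \<open>g\<close>, which may differ from the
  derivative \<open>k\<close> on a null set. A difference quotient of \<open>v t\<close> is an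
  average of \<open>g t\<close>, so the bounds pass to the quotient and, in the limit, to
  \<open>k\<close>.\<close>

lemma elasticity_bounds_everywhere:
  assumes v: "Inada v" and N: "N > 0" and g: "weak_deriv_x v g"
     "\<forall>t\<in>{0..1}. \<forall>x>0. 1 / N \<le> - x * g t x / v t x \<and> - x * g t x / v t x \<le> N"
    and t: "t \<in> {0..1}" "x > 0" and d: "(v t has_real_derivative k) (at x)"
  shows "1 / N \<le> - x * k / v t x" "- x * k / v t x \<le> N"
proof -
  note vt = InadaD[OF v t(1)]
  have gb: "g t z \<le> - (v t z / (N * z))" "- (N * v t z / z) \<le> g t z" if "z > 0" for z
    using g(2)[rule_format, OF t(1) that] that N vt(1)[OF that] by (auto simp: field_simps)
  have q: "((\<lambda>h. (v t (x + h) - v t x) / h) \<longlongrightarrow> k) (at_right 0)"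
    using d[unfolded DERIV_def] by (rule filterlim_mono) (auto simp: at_le)
  have cv: "((\<lambda>h. v t (x + h)) \<longlongrightarrow> v t x) (at_right 0)"
  proof -
    have "((\<lambda>h. v t (x + h)) \<longlongrightarrow> v t x) (at 0)"
      using DERIV_isCont[OF d] by (simp add: isCont_iff)
    then show ?thesis by (rule filterlim_mono) (auto simp: at_le)
  qed
  have pos: "\<forall>\<^sub>F h in at_right 0. h > (0::real)" by (rule eventually_at_right_less)
  \<comment> \<open>As \<open>v t\<close> decreases, \<open>v t z / z\<close> is smallest at the
    right end and largest at the left end of \<open>[x, x + h]\<close>; this gives constants to
    integrate.\<close>
  have bd: "(v t (x + h) - v t x) / h \<le> - (v t (x + h) / (N * (x + h)))"
    "- (N * v t x / x) \<le> (v t (x + h) - v t x) / h" if h: "h > 0" for h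
  proof -
    have xh: "x \<le> x + h" using h by simp
    note I = weak_deriv_x_integrable(4)[OF g(1) t(1) t(2) xh]
    have mono: "v t (x + h) \<le> v t z" "v t z \<le> v t x" if "z \<in> {x..x+h}" for z
      using vt(2)[of z "x + h"] vt(2)[of x z] that t(2) by (cases "z = x + h"; cases "z = x"; force)+
    have c: "((\<lambda>z. c) has_integral h * c) {x..x+h}" for c :: real
      using has_integral_const_real[of c x "x + h"] h by simp
    have "v t (x + h) - v t x \<le> h * - (v t (x + h) / (N * (x + h)))"
    proof (rule has_integral_le[OF I c])
      fix z assume z: "z \<in> {x..x+h}"
      have "v t (x + h) / (N * (x + h)) \<le> v t z / (N * z)"
        using mono[OF z] vt(1)[of "x + h"] z t(2) N by (intro frac_le mult_left_mono) auto
      then show "g t z \<le> - (v t (x + h) / (N * (x + h)))" using gb(1)[of z] z t(2) by auto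
    qed
    then show "(v t (x + h) - v t x) / h \<le> - (v t (x + h) / (N * (x + h)))" using h by (simp add: pos_divide_le_eq mult.commute)
    have "h * - (N * v t x / x) \<le> v t (x + h) - v t x"
    proof (rule has_integral_le[OF c I])
      fix z assume z: "z \<in> {x..x+h}"
      have "N * v t z / z \<le> N * v t x / x"
        using mono[OF z] vt(1)[of x] z t(2) N by (intro frac_le mult_left_mono) auto
      then show "- (N * v t x / x) \<le> g t z" using gb(2)[of z] z t(2) by auto
    qed
    then show "- (N * v t x / x) \<le> (v t (x + h) - v t x) / h" using h by (simp add: pos_le_divide_eq mult.commute)
  qed
  have lim: "((\<lambda>h. - (v t (x + h) / (N * (x + h)))) \<longlongrightarrow> - (v t x / (N * (x + 0)))) (at_right 0)"
    by (intro tendsto_intros cv) (use N t in auto)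
  have "k \<le> - (v t x / (N * (x + 0)))"
    by (rule tendsto_le[OF _ lim q]) (use pos bd in \<open>auto elim: eventually_mono\<close>)
  then show "1 / N \<le> - x * k / v t x" using t(2) N vt(1)[OF t(2)] by (simp add: field_simps)
  have "- (N * v t x / x) \<le> k"
    by (rule tendsto_le[OF _ q tendsto_const]) (use pos bd in \<open>auto elim: eventually_mono\<close>)
  then show "- x * k / v t x \<le> N" using t(2) N vt(1)[OF t(2)] by (simp add: field_simps)
qed

text \<open>Applies the pointwise transfer to a continuous second derivative. Its sign, on which
  later quotients rely, follows from the lower bound \<open>1 / N\<close>.\<close>

lemma elastic_derivativeD:
  assumes v: "Inada v" "elastic v" and k: "weak_deriv_x v k" "\<And>t. t \<in> {0..1} \<Longrightarrow> continuous_on {0<..} (k t)"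
  obtains N where "N > 0"
    "\<And>t x. t \<in> {0..1} \<Longrightarrow> x > 0 \<Longrightarrow> 1 / N \<le> - x * k t x / v t x"
    "\<And>t x. t \<in> {0..1} \<Longrightarrow> x > 0 \<Longrightarrow> - x * k t x / v t x \<le> N"
    "\<And>t x. t \<in> {0..1} \<Longrightarrow> x > 0 \<Longrightarrow> k t x < 0"
proof -
  obtain g N where g: "N > 0" "weak_deriv_x v g"
     "\<forall>t\<in>{0..1}. \<forall>x>0. 1 / N \<le> - x * g t x / v t x \<and> - x * g t x / v t x \<le> N"
    using v(2) unfolding elastic_def by blast
  have b: "1 / N \<le> - x * k t x / v t x" "- x * k t x / v t x \<le> N" if "t \<in> {0..1}" "x > 0" for t x
    using elasticity_bounds_everywhere[OF v(1) g that weak_deriv_x_has_derivative[OF k(1) that(1) k(2)[OF that(1)] that(2)]]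
    by auto
  have "k t x < 0" if t: "t \<in> {0..1}" "x > 0" for t x
  proof -
    have "0 < 1 / N" using g(1) by simp
    then have "0 < - x * k t x / v t x" using b(1)[OF t] by linarith
    then show ?thesis using t InadaD(1)[OF v(1) t] by (simp add: divide_less_0_iff mult_less_0_iff)
  qed
  with g(1) b show ?thesis by (rule that)
qed

section \<open>Weak derivatives of reciprocals and second derivatives of inverses\<close>

lemma absolutely_integrable_continuous_mult:
  fixes f g :: "real \<Rightarrow> real"
  assumes "continuous_on {a..b} f" "g absolutely_integrable_on {a..b}"
  shows "(\<lambda>x. f x * g x) absolutely_integrable_on {a..b}"
proof (rule absolutely_integrable_bounded_measurable_product_real)
  show "f \<in> borel_measurable (lebesgue_on {a..b})"
    by (rule continuous_imp_measurable_on_sets_lebesgue[OF assms(1)]) simp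
  show "bounded (f ` {a..b})" by (intro compact_imp_bounded compact_continuous_image assms) auto
qed (use assms in auto)

lemma abs_integral_le:
  fixes f h :: "real \<Rightarrow> real"
  assumes "f integrable_on {x..y}" "(\<lambda>z. \<bar>h z\<bar>) integrable_on {x..y}"
    and "\<And>z. z \<in> {x..y} \<Longrightarrow> \<bar>f z\<bar> \<le> e * \<bar>h z\<bar>"
  shows "\<bar>integral {x..y} f\<bar> \<le> e * integral {x..y} (\<lambda>z. \<bar>h z\<bar>)"
proof -
  have "norm (integral {x..y} f) \<le> integral {x..y} (\<lambda>z. e * \<bar>h z\<bar>)"
    by (rule Henstock_Kurzweil_Integration.integral_norm_bound_integral)
      (use assms integrable_cmul[of "\<lambda>z. \<bar>h z\<bar>" "{x..y}" e] in auto)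
  then show ?thesis by simp
qed

text \<open>The chain rule for \<open>1 / k\<close>: on short intervals the defect of the identity is at most
  \<open>e\<close> times the integral of \<open>\<bar>h\<bar>\<close>, and both sides are additive.\<close>

lemma weak_derivative_reciprocal:
  fixes k h :: "real \<Rightarrow> real"
  assumes ab: "a \<le> b" and h: "h absolutely_integrable_on {a..b}"
    and k: "\<And>x y. a \<le> x \<Longrightarrow> x \<le> y \<Longrightarrow> y \<le> b \<Longrightarrow> k y - k x = integral {x..y} h"
    and kc: "continuous_on {a..b} k" and k0: "\<And>x. x \<in> {a..b} \<Longrightarrow> k x \<noteq> 0"
  shows "(\<lambda>x. - h x / (k x)\<^sup>2) absolutely_integrable_on {a..b}"
    and "1 / k b - 1 / k a = integral {a..b} (\<lambda>x. - h x / (k x)\<^sup>2)"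
proof -
  define \<phi> where "\<phi> = (\<lambda>x. - h x / (k x)\<^sup>2)"
  have "(\<lambda>x. - 1 / (k x)\<^sup>2 * h x) absolutely_integrable_on {a..b}"
    by (rule absolutely_integrable_continuous_mult[OF _ h]) (use k0 in \<open>auto intro!: continuous_intros kc\<close>)
  then show ai: "(\<lambda>x. - h x / (k x)\<^sup>2) absolutely_integrable_on {a..b}" by simp
  have \<phi>i: "\<phi> integrable_on {x..y}" if "a \<le> x" "y \<le> b" for x y
    using set_lebesgue_integral_eq_integral(1)[OF ai] that unfolding \<phi>_def
    by (auto intro: integrable_on_subinterval)
  have hi: "h integrable_on {x..y}" if "a \<le> x" "y \<le> b" for x y
    using set_lebesgue_integral_eq_integral(1)[OF h] that by (auto intro: integrable_on_subinterval)
  have hai: "(\<lambda>z. \<bar>h z\<bar>) integrable_on {x..y}" if "a \<le> x" "y \<le> b" for x y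
    using set_lebesgue_integral_eq_integral(1)[OF absolutely_integrable_norm[OF h]] that
    by (auto intro: integrable_on_subinterval simp: o_def)
  have est: "\<bar>1 / k b - 1 / k a - integral {a..b} \<phi>\<bar> \<le> e * integral {a..b} (\<lambda>z. \<bar>h z\<bar>)" if e: "e > 0" for e
  proof -
    \<comment> \<open>Both sides of the estimate are compatible with splitting an interval, so by
      bisection it suffices to treat short intervals around each point.\<close>
    define P where "P = (\<lambda>x y. a \<le> x \<and> x \<le> y \<and> y \<le> b \<longrightarrow>
      \<bar>1 / k y - 1 / k x - integral {x..y} \<phi>\<bar> \<le> e * integral {x..y} (\<lambda>z. \<bar>h z\<bar>))"
    have "P a b"
    proof (rule Bolzano[OF ab])
      fix x y z assume 1: "P x y" "P y z" "x \<le> y" "y \<le> z"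
      show "P x z" unfolding P_def
      proof
        assume 2: "a \<le> x \<and> x \<le> z \<and> z \<le> b"
        have "integral {x..z} \<phi> = integral {x..y} \<phi> + integral {y..z} \<phi>"
          by (rule Henstock_Kurzweil_Integration.integral_combine[symmetric]) (use 1 2 \<phi>i in auto)
        moreover have "integral {x..z} (\<lambda>z. \<bar>h z\<bar>) = integral {x..y} (\<lambda>z. \<bar>h z\<bar>) + integral {y..z} (\<lambda>z. \<bar>h z\<bar>)"
          by (rule Henstock_Kurzweil_Integration.integral_combine[symmetric]) (use 1 2 hai in auto)
        ultimately show "\<bar>1 / k z - 1 / k x - integral {x..z} \<phi>\<bar> \<le> e * integral {x..z} (\<lambda>z. \<bar>h z\<bar>)"
          using 1 2 unfolding P_def by (simp add: distrib_left)
      qed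
    next
      fix x0 assume x0: "a \<le> x0" "x0 \<le> b"
      define r where "r = (\<lambda>x. 1 / k x)"
      have rc: "continuous_on {a..b} r" unfolding r_def by (intro continuous_intros kc) (use k0 in auto)
      have "compact (r ` {a..b})" by (intro compact_continuous_image rc) auto
      then obtain R where R: "R > 0" "\<And>x. x \<in> {a..b} \<Longrightarrow> \<bar>r x\<bar> \<le> R"
        using compact_imp_bounded bounded_pos by (metis image_eqI real_norm_def)
      \<comment> \<open>The factor of \<open>h\<close> below is a sum of two products, each at most
        \<open>R * (2 * \<delta>)\<close>; this choice makes that bound
        \<open>e / 2\<close>.\<close>
      define \<delta> where "\<delta> = e / (4 * R)"
      have \<delta>: "\<delta> > 0" using e R by (simp add: \<delta>_def)
      then obtain d where d: "d > 0" "\<And>x. x \<in> {a..b} \<Longrightarrow> \<bar>x - x0\<bar> < d \<Longrightarrow> \<bar>r x - r x0\<bar> < \<delta>"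
        using rc[unfolded continuous_on_iff, rule_format, of x0 \<delta>] x0 by (auto simp: dist_real_def)
      show "\<exists>d>0. \<forall>x y. x \<le> x0 \<and> x0 \<le> y \<and> y - x < d \<longrightarrow> P x y"
      proof (intro exI[of _ d] conjI allI impI d(1))
        fix x y assume xy: "x \<le> x0 \<and> x0 \<le> y \<and> y - x < d"
        show "P x y" unfolding P_def
        proof
          assume s: "a \<le> x \<and> x \<le> y \<and> y \<le> b"
          have c: "1 / k y - 1 / k x - integral {x..y} \<phi> = integral {x..y} (\<lambda>z. ((r z)\<^sup>2 - r x * r y) * h z)"
          proof -
            \<comment> \<open>This identity is exact, so the defect is the integral of
              \<open>h\<close> against the difference of \<open>r z\<close> squared and
              \<open>r x * r y\<close>, which is small where \<open>r\<close> oscillates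
              little.\<close>
            have "1 / k y - 1 / k x = - (r x * r y) * (k y - k x)"
              using k0[of x] k0[of y] s by (simp add: r_def field_simps)
            also have "\<dots> = integral {x..y} (\<lambda>z. - (r x * r y) * h z)" using k[of x y] s by simp
            also have "\<dots> - integral {x..y} \<phi> = integral {x..y} (\<lambda>z. - (r x * r y) * h z - \<phi> z)"
              by (rule integral_diff[symmetric]) (use s \<phi>i integrable_cmul[OF hi, of x y "- (r x * r y)"] in auto)
            also have "\<dots> = integral {x..y} (\<lambda>z. ((r z)\<^sup>2 - r x * r y) * h z)"
              by (intro integral_cong) (auto simp: \<phi>_def r_def field_simps power2_eq_square)
            finally show ?thesis .
          qed
          have "(\<lambda>z. ((r z)\<^sup>2 - r x * r y) * h z) absolutely_integrable_on {a..b}"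
            by (rule absolutely_integrable_continuous_mult[OF _ h]) (auto intro!: continuous_intros rc)
          then have i: "(\<lambda>z. ((r z)\<^sup>2 - r x * r y) * h z) integrable_on {x..y}"
            by (intro integrable_on_subinterval[OF set_lebesgue_integral_eq_integral(1)]) (use s in auto)
          show "\<bar>1 / k y - 1 / k x - integral {x..y} \<phi>\<bar> \<le> e * integral {x..y} (\<lambda>z. \<bar>h z\<bar>)"
            unfolding c
          proof (rule abs_integral_le[OF i hai])
            fix z assume z: "z \<in> {x..y}"
            have in_ab: "x \<in> {a..b}" "y \<in> {a..b}" "z \<in> {a..b}" using z s by auto
            have "\<bar>r x - r x0\<bar> < \<delta>" "\<bar>r y - r x0\<bar> < \<delta>" "\<bar>r z - r x0\<bar> < \<delta>"
              using d(2)[OF in_ab(1)] d(2)[OF in_ab(2)] d(2)[OF in_ab(3)] xy z by auto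
            then have "\<bar>r z - r x\<bar> \<le> 2 * \<delta>" "\<bar>r z - r y\<bar> \<le> 2 * \<delta>" by auto
            then have "\<bar>r z * (r z - r x)\<bar> \<le> R * (2 * \<delta>)" "\<bar>r x * (r z - r y)\<bar> \<le> R * (2 * \<delta>)"
              unfolding abs_mult using R(2)[OF in_ab(1)] R(2)[OF in_ab(3)] by (auto intro!: mult_mono)
            moreover have "(r z)\<^sup>2 - r x * r y = r z * (r z - r x) + r x * (r z - r y)"
              by (simp add: algebra_simps power2_eq_square)
            moreover have "R * (2 * \<delta>) = e / 2" using R by (simp add: \<delta>_def)
            ultimately have "\<bar>(r z)\<^sup>2 - r x * r y\<bar> \<le> e" by linarith
            then show "\<bar>((r z)\<^sup>2 - r x * r y) * h z\<bar> \<le> e * \<bar>h z\<bar>"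
              unfolding abs_mult by (intro mult_right_mono) auto
          qed (use s in auto)
        qed
      qed
    qed
    then show ?thesis using ab by (simp add: P_def)
  qed
  define I where "I = integral {a..b} (\<lambda>z. \<bar>h z\<bar>)"
  have I0: "I \<ge> 0" unfolding I_def by (intro integral_nonneg hai) auto
  have "\<bar>1 / k b - 1 / k a - integral {a..b} \<phi>\<bar> \<le> 0 + e" if "e > 0" for e
  proof -
    \<comment> \<open>Dividing by \<open>I + 1\<close> instead of \<open>I\<close> covers a
      vanishing integral.\<close>
    have "\<bar>1 / k b - 1 / k a - integral {a..b} \<phi>\<bar> \<le> e / (I + 1) * I"
      using est[of "e / (I + 1)"] that I0 by (simp add: I_def)
    also have "\<dots> \<le> e" using I0 that by (simp add: field_simps)
    finally show ?thesis by simp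
  qed
  then have "\<bar>1 / k b - 1 / k a - integral {a..b} \<phi>\<bar> \<le> 0" by (rule field_le_epsilon)
  then show "1 / k b - 1 / k a = integral {a..b} (\<lambda>x. - h x / (k x)\<^sup>2)" by (simp add: \<phi>_def)
qed

lemma marginal_inverse_image:
  assumes v: "Inada v" "t \<in> {0..1}" and ab: "0 < a" "a \<le> b"
  shows "marginal_inverse v t ` {a..b} = {marginal_inverse v t b..marginal_inverse v t a}"
proof (intro equalityI subsetI)
  note J = Inada_marginal_inverse[OF v(1)]
  have b: "b > 0" using ab by simp
  fix x
  show "x \<in> {marginal_inverse v t b..marginal_inverse v t a}" if "x \<in> marginal_inverse v t ` {a..b}"
    using that Inada_less_iff[OF J v(2)] ab b by (force simp: not_less[symmetric])
  assume x: "x \<in> {marginal_inverse v t b..marginal_inverse v t a}"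
  then have x0: "x > 0" using marginal_inverse(1)[OF v b] by simp
  have "v t x \<in> {a..b}"
    using x less_marginal_inverse_iff[OF v x0 ab(1)] less_marginal_inverse_iff[OF v x0 b] by auto
  then show "x \<in> marginal_inverse v t ` {a..b}"
    using marginal_inverse_apply[OF v x0] by (metis image_eqI)
qed

text \<open>As a primitive of \<open>h\<close>, \<open>k\<close> is continuous, so the first formula
  is the classical inverse function rule. For the second, \<open>1 / k\<close> is differentiated
  weakly in \<open>x\<close>, and the substitution \<open>x = J t y\<close>, differentiable and
  injective, carries the integral over to \<open>y\<close>.\<close>

lemma weak_deriv_marginal_inverse:
  assumes v: "Inada v" and k: "weak_deriv_x v k" and h: "weak_deriv_x k h"
    and neg: "\<And>t x. t \<in> {0..1} \<Longrightarrow> x > 0 \<Longrightarrow> k t x < 0"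
  defines "J \<equiv> marginal_inverse v"
  shows "weak_deriv_x J (\<lambda>t y. 1 / k t (J t y))"
    and "weak_deriv_x (\<lambda>t y. 1 / k t (J t y)) (\<lambda>t y. - h t (J t y) / (k t (J t y)) ^ 3)"
proof -
  have J: "J t y > 0" "v t (J t y) = y" if "t \<in> {0..1}" "y > 0" for t y
    using marginal_inverse[OF v that] by (auto simp: J_def)
  have Jc: "continuous_on {0<..} (J t)" if "t \<in> {0..1}" for t
    unfolding J_def by (rule InadaD(6)[OF Inada_marginal_inverse[OF v] that])
  have kc: "continuous_on {0<..} (k t)" if "t \<in> {0..1}" for t by (rule weak_deriv_x_continuous[OF h that])
  have dJ: "(J t has_real_derivative 1 / k t (J t y)) (at y)" if t: "t \<in> {0..1}" and y: "y > 0" for t y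
  proof -
    have "(J t has_real_derivative inverse (k t (J t y))) (at y)"
    proof (rule DERIV_inverse_function[where a=0 and b="y+1"])
      show "(v t has_real_derivative k t (J t y)) (at (J t y))"
        by (rule weak_deriv_x_has_derivative[OF k t kc[OF t] J(1)[OF t y]])
      show "isCont (J t) y" using Jc[OF t] y by (auto simp: continuous_on_eq_continuous_at)
    qed (use neg[OF t J(1)[OF t y]] J(2)[OF t] y in auto)
    then show ?thesis by (simp add: inverse_eq_divide)
  qed
  have Kc: "continuous_on {0<..} (\<lambda>y. k t (J t y))" if t: "t \<in> {0..1}" for t
    by (rule continuous_on_compose2[OF kc[OF t] Jc[OF t]]) (use J[OF t] in auto)
  show "weak_deriv_x J (\<lambda>t y. 1 / k t (J t y))"
  proof (rule weak_deriv_xI[OF dJ])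
    show "continuous_on {0<..} (\<lambda>y. 1 / k t (J t y))" if t: "t \<in> {0..1}" for t
      using neg[OF t J(1)[OF t]] by (intro continuous_intros Kc[OF t]) (auto simp: less_imp_neq)
  qed
  show "weak_deriv_x (\<lambda>t y. 1 / k t (J t y)) (\<lambda>t y. - h t (J t y) / (k t (J t y)) ^ 3)"
    unfolding weak_deriv_x_def
  proof (intro ballI allI impI)
    fix t a b :: real assume t: "t \<in> {0..1}" and ab: "0 < a" "a \<le> b"
    have b: "b > 0" using ab by simp
    define A where "A = J t b"
    define B where "B = J t a"
    have im: "J t ` {a..b} = {A..B}" unfolding J_def A_def B_def by (rule marginal_inverse_image[OF v t ab])
    have A: "A > 0" using J(1)[OF t b] by (simp add: A_def)
    have "J t a \<in> J t ` {a..b}" using ab by simp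
    then have AB: "A \<le> B" unfolding im B_def by simp
    define \<phi> where "\<phi> = (\<lambda>x. - h t x / (k t x)\<^sup>2)"
    have kAB: "continuous_on {A..B} (k t)" by (rule continuous_on_subset[OF kc[OF t]]) (use A in auto)
    have k0: "k t x \<noteq> 0" if "x \<in> {A..B}" for x using neg[OF t, of x] A that by auto
    have kh: "k t y - k t x = integral {x..y} (h t)" if "A \<le> x" "x \<le> y" for x y
      using weak_deriv_x_integrable(3)[OF h t, of x y] A that by auto
    note \<phi> = weak_derivative_reciprocal[OF AB weak_deriv_x_integrable(1)[OF h t A AB] kh kAB k0, folded \<phi>_def]
    have inj: "inj_on (J t) {a..b}"
      using J(2)[OF t] ab by (intro inj_onI) (metis atLeastAtMost_iff less_le_trans)
    have "\<phi> absolutely_integrable_on (J t ` {a..b}) \<and> integral (J t ` {a..b}) \<phi> = 1 / k t B - 1 / k t A"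
      using \<phi> by (simp add: im)
    then have "(\<lambda>y. \<bar>1 / k t (J t y)\<bar> * \<phi> (J t y)) absolutely_integrable_on {a..b} \<and>
        integral {a..b} (\<lambda>y. \<bar>1 / k t (J t y)\<bar> * \<phi> (J t y)) = 1 / k t B - 1 / k t A"
      by (subst has_absolute_integral_change_of_variables_1')
        (use dJ[OF t] ab inj in \<open>auto intro: has_field_derivative_at_within\<close>)
    \<comment> \<open>\<open>J\<close> is decreasing: the endpoints are exchanged, and the absolute
      Jacobian is \<open>- 1 / k\<close>. The factor -1 accounts for both.\<close>
    then have *: "(\<lambda>y. (-1) * (\<bar>1 / k t (J t y)\<bar> * \<phi> (J t y))) absolutely_integrable_on {a..b}"
        "integral {a..b} (\<lambda>y. (-1) * (\<bar>1 / k t (J t y)\<bar> * \<phi> (J t y))) = 1 / k t A - 1 / k t B"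
      using set_integrable_mult_right[of "-1" lebesgue "{a..b}" "\<lambda>y. \<bar>1 / k t (J t y)\<bar> * \<phi> (J t y)"] by auto
    have eq: "(-1) * (\<bar>1 / k t (J t y)\<bar> * \<phi> (J t y)) = - h t (J t y) / (k t (J t y)) ^ 3"
      if "y \<in> {a..b}" for y
    proof -
      have "k t (J t y) < 0" using neg[OF t J(1)[OF t]] that ab by auto
      then show ?thesis by (simp add: \<phi>_def power2_eq_square power3_eq_cube abs_of_neg)
    qed
    show "(\<lambda>y. - h t (J t y) / (k t (J t y)) ^ 3) absolutely_integrable_on {a..b} \<and>
       1 / k t (J t b) - 1 / k t (J t a) = integral {a..b} (\<lambda>y. - h t (J t y) / (k t (J t y)) ^ 3)"
    proof
      show "(\<lambda>y. - h t (J t y) / (k t (J t y)) ^ 3) absolutely_integrable_on {a..b}"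
        by (rule absolutely_integrable_spike[OF *(1) negligible_empty]) (use eq in auto)
      show "1 / k t (J t b) - 1 / k t (J t a) = integral {a..b} (\<lambda>y. - h t (J t y) / (k t (J t y)) ^ 3)"
        unfolding A_def[symmetric] B_def[symmetric] *(2)[symmetric] by (rule integral_cong[OF eq])
    qed
  qed
qed

section \<open>Bounded prudence and the closure of \<open>U3\<close>\<close>

definition prudent :: "(real \<Rightarrow> real \<Rightarrow> real) \<Rightarrow> bool" where
  "prudent v \<longleftrightarrow> (\<exists>k h N. N > 0 \<and> weak_deriv_x v k \<and> weak_deriv_x k h \<and>
     (\<forall>t\<in>{0..1}. \<forall>x>0. - N \<le> - x * h t x / k t x \<and> - x * h t x / k t x \<le> N))"

lemma U3_iff: "U3 u \<longleftrightarrow> U1 u \<and> elastic (ux u) \<and> prudent (ux u)"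
  by (auto simp: U3_def U2_iff prudent_def)

lemma prudent_cong:
  assumes "prudent v" "\<And>t x. t \<in> {0..1} \<Longrightarrow> x > 0 \<Longrightarrow> v' t x = v t x"
  shows "prudent v'"
proof -
  obtain k h N where "N > 0" "weak_deriv_x v k" "weak_deriv_x k h"
     "\<forall>t\<in>{0..1}. \<forall>x>0. - N \<le> - x * h t x / k t x \<and> - x * h t x / k t x \<le> N"
    using assms(1) unfolding prudent_def by blast
  moreover from this(2) have "weak_deriv_x v' k" by (rule weak_deriv_x_cong) (rule assms(2))
  ultimately show ?thesis unfolding prudent_def by blast
qed

lemma prudent_scale:
  assumes "prudent v" "c > 0"
  shows "prudent (\<lambda>t x. c * v t x)"
proof -
  obtain k h N where "N > 0" "weak_deriv_x v k" "weak_deriv_x k h"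
     "\<forall>t\<in>{0..1}. \<forall>x>0. - N \<le> - x * h t x / k t x \<and> - x * h t x / k t x \<le> N"
    using assms(1) unfolding prudent_def by blast
  then show ?thesis unfolding prudent_def
    by (intro exI[of _ "\<lambda>t x. c * k t x"] exI[of _ "\<lambda>t x. c * h t x"] exI[of _ N])
      (use assms in \<open>auto simp: mult.left_commute intro: weak_deriv_x_cmult\<close>)
qed

text \<open>The weights \<open>k\<close> and \<open>l\<close> of the mean must have a common sign.
  It comes from \<open>elastic\<close>, transferred to the continuous second derivatives.\<close>

lemma prudent_add:
  assumes "prudent v" "prudent w" and v: "Inada v" "elastic v" and w: "Inada w" "elastic w"
  shows "prudent (\<lambda>t x. v t x + w t x)"
proof -
  obtain k h N where h: "N > 0" "weak_deriv_x v k" "weak_deriv_x k h"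
     "\<forall>t\<in>{0..1}. \<forall>x>0. - N \<le> - x * h t x / k t x \<and> - x * h t x / k t x \<le> N"
    using assms(1) unfolding prudent_def by blast
  obtain l m M where m: "M > 0" "weak_deriv_x w l" "weak_deriv_x l m"
     "\<forall>t\<in>{0..1}. \<forall>x>0. - M \<le> - x * m t x / l t x \<and> - x * m t x / l t x \<le> M"
    using assms(2) unfolding prudent_def by blast
  have kneg: "k t x < 0" if "t \<in> {0..1}" "x > 0" for t x
    using elastic_derivativeD[OF v h(2) weak_deriv_x_continuous[OF h(3)]] that by blast
  have lneg: "l t x < 0" if "t \<in> {0..1}" "x > 0" for t x
    using elastic_derivativeD[OF w m(2) weak_deriv_x_continuous[OF m(3)]] that by blast
  define L where "L = max M N"
  show ?thesis unfolding prudent_def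
  proof (intro exI conjI ballI allI impI)
    show "weak_deriv_x (\<lambda>t x. v t x + w t x) (\<lambda>t x. k t x + l t x)" by (rule weak_deriv_x_add[OF h(2) m(2)])
    show "weak_deriv_x (\<lambda>t x. k t x + l t x) (\<lambda>t x. h t x + m t x)" by (rule weak_deriv_x_add[OF h(3) m(3)])
    show "L > 0" using h(1) by (simp add: L_def)
    fix t x :: real assume t: "t \<in> {0..1}" "x > 0"
    have "- N \<le> - x * h t x / k t x" "- x * h t x / k t x \<le> N"
      "- M \<le> - x * m t x / l t x" "- x * m t x / l t x \<le> M"
      using h(4) m(4) t by blast+
    then have b: "- L \<le> x * h t x / - k t x" "x * h t x / - k t x \<le> L"
      "- L \<le> x * m t x / - l t x" "x * m t x / - l t x \<le> L"
      by (auto simp: L_def)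
    have "- k t x > 0" "- l t x > 0" using kneg[OF t] lneg[OF t] by auto
    from mediant_bounds[OF this b]
    have "- L \<le> x * (h t x + m t x) / - (k t x + l t x)" "x * (h t x + m t x) / - (k t x + l t x) \<le> L"
      by (simp_all add: distrib_left)
    moreover have "- x * (h t x + m t x) / (k t x + l t x) = x * (h t x + m t x) / - (k t x + l t x)"
      by (metis minus_divide_left minus_divide_right mult_minus_left)
    ultimately show "- L \<le> - x * (h t x + m t x) / (k t x + l t x)" "- x * (h t x + m t x) / (k t x + l t x) \<le> L"
      by (simp_all only:)
  qed
qed

text \<open>To be read with \<open>x = J t y\<close> and \<open>y = v t x\<close>: the ratios of the
  inverse in terms of those of \<open>v\<close> at the optimiser.\<close>

lemma conj_ratios:
  fixes x y k h :: real
  assumes "x > 0" "y > 0" "k < 0"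
  shows "- y * (1 / k) / x = 1 / (- x * k / y)"
    and "- y * (- h / k ^ 3) / (1 / k) = (- x * h / k) / (- x * k / y)"
  using assms by (simp_all add: field_simps power3_eq_cube)

lemma prudent_marginal_inverse:
  assumes "prudent v" and v: "Inada v" "elastic v"
  shows "prudent (marginal_inverse v)"
proof -
  define J where "J = marginal_inverse v"
  obtain k h N where h: "N > 0" "weak_deriv_x v k" "weak_deriv_x k h"
     "\<forall>t\<in>{0..1}. \<forall>x>0. - N \<le> - x * h t x / k t x \<and> - x * h t x / k t x \<le> N"
    using assms(1) unfolding prudent_def by blast
  obtain M where M: "M > 0"
    "\<And>t x. t \<in> {0..1} \<Longrightarrow> x > 0 \<Longrightarrow> 1 / M \<le> - x * k t x / v t x"
    "\<And>t x. t \<in> {0..1} \<Longrightarrow> x > 0 \<Longrightarrow> - x * k t x / v t x \<le> M"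
    "\<And>t x. t \<in> {0..1} \<Longrightarrow> x > 0 \<Longrightarrow> k t x < 0"
    using elastic_derivativeD[OF v h(2) weak_deriv_x_continuous[OF h(3)]] by blast
  note w = weak_deriv_marginal_inverse[OF v(1) h(2,3) M(4), folded J_def]
  show ?thesis unfolding prudent_def J_def[symmetric]
  proof (rule exI[of _ "\<lambda>t y. 1 / k t (J t y)"], rule exI[of _ "\<lambda>t y. - h t (J t y) / (k t (J t y)) ^ 3"],
      rule exI[of _ "N * M"], intro conjI ballI allI impI w)
    show "0 < N * M" using h(1) M(1) by simp
    fix t y :: real assume t: "t \<in> {0..1}" and y: "y > 0"
    have J: "J t y > 0" "v t (J t y) = y" using marginal_inverse[OF v(1) t y] by (auto simp: J_def)
    define p a where "p = - J t y * h t (J t y) / k t (J t y)" and "a = - J t y * k t (J t y) / y"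
    have e: "- y * (- h t (J t y) / (k t (J t y)) ^ 3) / (1 / k t (J t y)) = p / a"
      unfolding p_def a_def by (rule conj_ratios(2)[OF J(1) y M(4)[OF t J(1)]])
    have p: "\<bar>p\<bar> \<le> N" using h(4)[rule_format, OF t J(1)] by (auto simp: p_def)
    have a: "1 / M \<le> a" "a > 0"
    proof -
      show "1 / M \<le> a" using M(2)[OF t J(1)] J(2) by (simp add: a_def)
      moreover have "0 < 1 / M" using M(1) by simp
      ultimately show "a > 0" by linarith
    qed
    have "\<bar>p / a\<bar> = \<bar>p\<bar> * (1 / a)" using a by (simp add: abs_divide)
    also have "\<dots> \<le> N * M" using p a M(1) h(1) by (intro mult_mono) (auto simp: field_simps)
    finally have "\<bar>p / a\<bar> \<le> N * M" .
    then show "- (N * M) \<le> - y * (- h t (J t y) / (k t (J t y)) ^ 3) / (1 / k t (J t y))"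
      "- y * (- h t (J t y) / (k t (J t y)) ^ 3) / (1 / k t (J t y)) \<le> N * M"
      unfolding e by linarith+
  qed
qed

lemma closed_cone_family_U3: "closed_cone_family U3"
proof (rule closed_cone_familyI)
  fix u assume "U3 u"
  then have u: "U1 u" "elastic (ux u)" "prudent (ux u)" by (auto simp: U3_iff)
  then have p: "Inada (ux u)" using U1D by blast
  show "U1 u" by (rule u)
  show "U3 u'" if "\<And>t x. t \<in> {0..1} \<Longrightarrow> x > 0 \<Longrightarrow> u' t x = u t x" for u'
    unfolding U3_iff using U1_cong[OF u(1) that] elastic_cong[OF u(2)] prudent_cong[OF u(3)] by blast
  show "U3 (\<lambda>t x. c * u t x)" if c: "c > 0" for c
    unfolding U3_iff using U1_scale[OF u(1) c] elastic_cong[OF elastic_scale[OF u(2) c]]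
      prudent_cong[OF prudent_scale[OF u(3) c]] by blast
  show "U3 (conj_x u)"
    unfolding U3_iff using U1_conj_x[OF u(1)] elastic_cong[OF elastic_marginal_inverse[OF u(2) p]]
      prudent_cong[OF prudent_marginal_inverse[OF u(3) p u(2)]] by blast
  fix w assume "U3 w"
  then have w: "U1 w" "elastic (ux w)" "prudent (ux w)" by (auto simp: U3_iff)
  then have q: "Inada (ux w)" using U1D by blast
  show "U3 (\<lambda>t x. u t x + w t x)"
    unfolding U3_iff using U1_add[OF u(1) w(1)] elastic_cong[OF elastic_add[OF u(2) w(2) p q]]
      prudent_cong[OF prudent_add[OF u(3) w(3) p u(2) q w(2)]] by blast
qed

section \<open>Power series with coefficients in the bounded continuous functions\<close>

text \<open>\<open>pser e f M\<close> says that \<open>f \<tau> \<sigma> x\<close> is, for \<open>\<bar>\<tau>\<bar> \<le> e\<close> and \<open>\<bar>\<sigma>\<bar> \<le> e\<close>, a power series in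
  \<open>(\<tau>, \<sigma>)\<close> with coefficients in the bounded continuous functions of \<open>x > 0\<close> whose weighted
  norm (the sum of \<open>e ^ (m + n)\<close> times the norms of the coefficients) is at most \<open>M\<close>. Allowing
  arbitrary countable sums of monomials makes every operation on power series an induction.\<close>

inductive pser :: "real \<Rightarrow> (real \<Rightarrow> real \<Rightarrow> real \<Rightarrow> real) \<Rightarrow> real \<Rightarrow> bool" for e where
  monomial: "continuous_on {0<..} g \<Longrightarrow> (\<And>x. x > 0 \<Longrightarrow> \<bar>g x\<bar> \<le> B) \<Longrightarrow>
    (\<And>\<tau> \<sigma> x. \<bar>\<tau>\<bar> \<le> e \<Longrightarrow> \<bar>\<sigma>\<bar> \<le> e \<Longrightarrow> x > 0 \<Longrightarrow> f \<tau> \<sigma> x = g x * \<tau> ^ m * \<sigma> ^ n) \<Longrightarrow>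
    B * e ^ m * e ^ n \<le> M \<Longrightarrow> pser e f M"
| series: "(\<And>i::nat. pser e (F i) (L i)) \<Longrightarrow> L sums S \<Longrightarrow> S \<le> M \<Longrightarrow>
    (\<And>\<tau> \<sigma> x. \<bar>\<tau>\<bar> \<le> e \<Longrightarrow> \<bar>\<sigma>\<bar> \<le> e \<Longrightarrow> x > 0 \<Longrightarrow> (\<lambda>i. F i \<tau> \<sigma> x) sums f \<tau> \<sigma> x) \<Longrightarrow> pser e f M"

lemma monomial_bound_nonneg:
  fixes g :: "real \<Rightarrow> real"
  assumes "\<And>x. x > 0 \<Longrightarrow> \<bar>g x\<bar> \<le> B"
  shows "0 \<le> B"
  using assms[of 1] by simp

lemma abs_monomial_le:
  fixes a \<tau> \<sigma> :: real
  assumes "\<bar>a\<bar> \<le> B" "\<bar>\<tau>\<bar> \<le> e" "\<bar>\<sigma>\<bar> \<le> e"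
  shows "\<bar>a * \<tau> ^ m * \<sigma> ^ n\<bar> \<le> B * e ^ m * e ^ n"
  unfolding abs_mult power_abs using assms by (intro mult_mono power_mono) (auto intro: order_trans[OF abs_ge_zero])

lemma pser_bound:
  assumes "pser e f M"
  shows "\<bar>\<tau>\<bar> \<le> e \<Longrightarrow> \<bar>\<sigma>\<bar> \<le> e \<Longrightarrow> x > 0 \<Longrightarrow> \<bar>f \<tau> \<sigma> x\<bar> \<le> M"
  using assms
proof (induction arbitrary: \<tau> \<sigma> x)
  case (monomial g B f m n M)
  then show ?case using abs_monomial_le[of "g x" B \<tau> e \<sigma> m n] by simp
next
  case (series F L S M f)
  have b: "\<bar>F i \<tau> \<sigma> x\<bar> \<le> L i" for i using series by blast
  have "summable (\<lambda>i. \<bar>F i \<tau> \<sigma> x\<bar>)"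
    by (rule summable_comparison_test'[OF sums_summable[OF series(2)]]) (use b in auto)
  have "\<bar>f \<tau> \<sigma> x\<bar> = \<bar>\<Sum>i. F i \<tau> \<sigma> x\<bar>" using sums_unique[OF series(4)] series.prems by simp
  also have "\<dots> \<le> (\<Sum>i. \<bar>F i \<tau> \<sigma> x\<bar>)" by (rule summable_rabs) fact
  also have "\<dots> \<le> (\<Sum>i. L i)" by (rule suminf_le) (use b sums_summable[OF series(2)] \<open>summable _\<close> in auto)
  also have "\<dots> \<le> M" using sums_unique[OF series(2)] series(3) by simp
  finally show ?case .
qed

lemma pser_nonneg: "pser e f M \<Longrightarrow> 0 \<le> e \<Longrightarrow> 0 \<le> M"
  using pser_bound[of e f M 0 0 1] by simp

lemma pser_mono:
  assumes "pser e f M" "M \<le> M'"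
  shows "pser e f M'"
  using assms(1)
proof cases
  case (monomial g B m n)
  show ?thesis by (rule pser.monomial[of g B e f m n]) (use monomial assms in auto)
next
  case (series F L S)
  show ?thesis by (rule pser.series[of e F L S]) (use series assms in auto)
qed

lemma pser_cong:
  assumes "pser e f M" "\<And>\<tau> \<sigma> x. \<bar>\<tau>\<bar> \<le> e \<Longrightarrow> \<bar>\<sigma>\<bar> \<le> e \<Longrightarrow> x > 0 \<Longrightarrow> f' \<tau> \<sigma> x = f \<tau> \<sigma> x"
  shows "pser e f' M"
  using assms(1)
proof cases
  case (monomial g B m n)
  show ?thesis by (rule pser.monomial[of g B e f' m n]) (use monomial assms in auto)
next
  case (series F L S)
  show ?thesis by (rule pser.series[of e F L S]) (use series assms in auto)
qed

lemma pser_coeff: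
  assumes "continuous_on {0<..} g" "\<And>x. x > 0 \<Longrightarrow> \<bar>g x\<bar> \<le> B"
  shows "pser e (\<lambda>\<tau> \<sigma> x. g x) B"
  by (rule pser.monomial[of g B e _ 0 0]) (use assms in auto)

lemma pser_const: "pser e (\<lambda>\<tau> \<sigma> x. c) \<bar>c\<bar>"
  by (rule pser_coeff) auto

lemma pser_zero: "pser e (\<lambda>\<tau> \<sigma> x. 0) 0"
  using pser_const[of e 0] by simp

lemma pser_sigma: "pser e (\<lambda>\<tau> \<sigma> x. \<sigma>) e"
  by (rule pser.monomial[of "\<lambda>_. 1" 1 e _ 0 1]) auto

text \<open>Antiderivatives and substitution are formulated for the second variable; interchanging
  the variables makes them available for time.\<close>

lemma pser_swap:
  assumes "pser e f M"
  shows "pser e (\<lambda>\<tau> \<sigma> x. f \<sigma> \<tau> x) M"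
  using assms
proof induction
  case (monomial g B f m n M)
  show ?case by (rule pser.monomial[of g B e _ n m]) (use monomial in \<open>auto simp: mult_ac\<close>)
next
  case (series F L S M f)
  show ?case by (rule pser.series[of e "\<lambda>i \<tau> \<sigma> x. F i \<sigma> \<tau> x" L S]) (use series in auto)
qed

lemma pser_shrink:
  assumes "pser e f M" "0 \<le> e'" "e' \<le> e"
  shows "pser e' f M"
  using assms(1)
proof induction
  case (monomial g B f m n M)
  have "B * e' ^ m * e' ^ n \<le> B * e ^ m * e ^ n"
    by (intro mult_mono power_mono) (use assms monomial_bound_nonneg[OF monomial(2)] in auto)
  then show ?case by (intro pser.monomial[of g B e' _ m n]) (use monomial assms in auto)
next
  case (series F L S M f)
  show ?case by (rule pser.series[of e' F L S]) (use series assms in auto)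
qed

lemma pser_add:
  assumes "pser e f M" "pser e g L"
  shows "pser e (\<lambda>\<tau> \<sigma> x. f \<tau> \<sigma> x + g \<tau> \<sigma> x) (M + L)"
proof (rule pser.series[of e "\<lambda>i. if i = 0 then f else if i = 1 then g else (\<lambda>\<tau> \<sigma> x. 0)"
      "\<lambda>i. if i = 0 then M else if i = 1 then L else 0" "M + L"])
  fix i :: nat
  show "pser e (if i = 0 then f else if i = 1 then g else (\<lambda>\<tau> \<sigma> x. 0)) (if i = 0 then M else if i = 1 then L else 0)"
    using assms pser_zero by auto
next
  have s: "(\<lambda>i. if i = 0 then a else if i = 1 then b else 0) sums (a + b)" for a b :: real
    using sums_finite[of "{0, 1::nat}" "\<lambda>i. if i = 0 then a else if i = 1 then b else 0"] by simp
  show "(\<lambda>i. if i = 0 then M else if i = 1 then L else 0) sums (M + L)" by (rule s)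
  fix \<tau> \<sigma> x :: real
  have "(\<lambda>i::nat. (if i = 0 then f else if i = 1 then g else (\<lambda>\<tau> \<sigma> x. 0)) \<tau> \<sigma> x) =
    (\<lambda>i. if i = 0 then f \<tau> \<sigma> x else if i = 1 then g \<tau> \<sigma> x else 0)" by auto
  then show "(\<lambda>i. (if i = 0 then f else if i = 1 then g else (\<lambda>\<tau> \<sigma> x. 0)) \<tau> \<sigma> x) sums (f \<tau> \<sigma> x + g \<tau> \<sigma> x)"
    using s[of "f \<tau> \<sigma> x" "g \<tau> \<sigma> x"] by (simp only:)
qed simp

text \<open>The weighted norm is submultiplicative. The inner induction expands \<open>g\<close>
  against one monomial of \<open>f\<close>, keeping the exact norm of that monomial; the outer
  induction expands \<open>f\<close>.\<close>

lemma pser_mult: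
  assumes e: "0 \<le> e" and f: "pser e f M" and g: "pser e g L"
  shows "pser e (\<lambda>\<tau> \<sigma> x. f \<tau> \<sigma> x * g \<tau> \<sigma> x) (M * L)"
  using f
proof induction
  case (monomial a A f m n M)
  note fm = monomial
  have A: "0 \<le> A" by (rule monomial_bound_nonneg[OF fm(2)])
  have L0: "0 \<le> L" by (rule pser_nonneg[OF g e])
  have "pser e (\<lambda>\<tau> \<sigma> x. f \<tau> \<sigma> x * g \<tau> \<sigma> x) (A * e ^ m * e ^ n * L)"
    using g
  proof induction
    case (monomial b B g k l L)
    show ?case
    proof (rule pser.monomial[of "\<lambda>x. a x * b x" "A * B" e _ "m + k" "n + l"])
      show "continuous_on {0<..} (\<lambda>x. a x * b x)" by (intro continuous_intros fm monomial)
      show "\<bar>a x * b x\<bar> \<le> A * B" if "x > 0" for x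
        unfolding abs_mult by (rule mult_mono) (use fm(2) monomial(2) A that in auto)
      have "A * e ^ m * e ^ n * (B * e ^ k * e ^ l) \<le> A * e ^ m * e ^ n * L"
        by (rule mult_left_mono) (use monomial(4) A e in auto)
      then show "A * B * e ^ (m + k) * e ^ (n + l) \<le> A * e ^ m * e ^ n * L" by (simp add: power_add mult_ac)
    qed (use fm(3) monomial(3) in \<open>auto simp: power_add\<close>)
  next
    case (series F L S M g)
    show ?case
    proof (rule pser.series[of e "\<lambda>i \<tau> \<sigma> x. f \<tau> \<sigma> x * F i \<tau> \<sigma> x" "\<lambda>i. A * e ^ m * e ^ n * L i" "A * e ^ m * e ^ n * S"])
      show "(\<lambda>i. A * e ^ m * e ^ n * L i) sums (A * e ^ m * e ^ n * S)" by (rule sums_mult[OF series(2)])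
      show "A * e ^ m * e ^ n * S \<le> A * e ^ m * e ^ n * M"
        by (rule mult_left_mono) (use series A e in auto)
      show "(\<lambda>i. f \<tau> \<sigma> x * F i \<tau> \<sigma> x) sums (f \<tau> \<sigma> x * g \<tau> \<sigma> x)" if "\<bar>\<tau>\<bar> \<le> e" "\<bar>\<sigma>\<bar> \<le> e" "x > 0" for \<tau> \<sigma> x
        by (rule sums_mult[OF series(4)[OF that]])
    qed (rule series)
  qed
  then show ?case by (rule pser_mono) (use fm(4) L0 in \<open>auto intro: mult_right_mono\<close>)
next
  case (series F K S M f)
  have L0: "0 \<le> L" by (rule pser_nonneg[OF g e])
  show ?case
  proof (rule pser.series[of e "\<lambda>i \<tau> \<sigma> x. F i \<tau> \<sigma> x * g \<tau> \<sigma> x" "\<lambda>i. K i * L" "S * L"])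
    show "(\<lambda>i. K i * L) sums (S * L)" by (rule sums_mult2[OF series(2)])
    show "S * L \<le> M * L" by (rule mult_right_mono) (use series L0 in auto)
    show "(\<lambda>i. F i \<tau> \<sigma> x * g \<tau> \<sigma> x) sums (f \<tau> \<sigma> x * g \<tau> \<sigma> x)" if "\<bar>\<tau>\<bar> \<le> e" "\<bar>\<sigma>\<bar> \<le> e" "x > 0" for \<tau> \<sigma> x
      by (rule sums_mult2[OF series(4)[OF that]])
  qed (rule series)
qed

lemma pser_cmult:
  assumes e: "0 \<le> e" and f: "pser e f M"
  shows "pser e (\<lambda>\<tau> \<sigma> x. c * f \<tau> \<sigma> x) (\<bar>c\<bar> * M)"
  by (rule pser_mult[OF e pser_const f])

lemma pser_minus:
  assumes e: "0 \<le> e" and f: "pser e f M"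
  shows "pser e (\<lambda>\<tau> \<sigma> x. - f \<tau> \<sigma> x) M"
  using pser_cmult[OF assms, of "-1"] by simp

lemma pser_diff:
  assumes e: "0 \<le> e" and f: "pser e f M" and g: "pser e g L"
  shows "pser e (\<lambda>\<tau> \<sigma> x. f \<tau> \<sigma> x - g \<tau> \<sigma> x) (M + L)"
  using pser_add[OF f pser_minus[OF e g]] by simp

lemma pser_power:
  assumes e: "0 \<le> e" and f: "pser e f M"
  shows "pser e (\<lambda>\<tau> \<sigma> x. f \<tau> \<sigma> x ^ n) (M ^ n)"
proof (induction n)
  case 0 then show ?case using pser_const[of e 1] by simp
next
  case (Suc n) then show ?case using pser_mult[OF e f Suc] by simp
qed

lemma pser_exp:
  assumes e: "0 \<le> e" and f: "pser e f M"
  shows "pser e (\<lambda>\<tau> \<sigma> x. exp (f \<tau> \<sigma> x)) (exp M)"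
proof (rule pser.series[of e "\<lambda>i \<tau> \<sigma> x. (1 / fact i) * f \<tau> \<sigma> x ^ i" "\<lambda>i. (1 / fact i) * M ^ i" "exp M"])
  show "pser e (\<lambda>\<tau> \<sigma> x. 1 / fact i * f \<tau> \<sigma> x ^ i) (1 / fact i * M ^ i)" for i
    using pser_cmult[OF e pser_power[OF e f], of "1 / fact i" i] by simp
  have s: "(\<lambda>i. 1 / fact i * z ^ i) sums exp z" for z :: real
    using exp_converges[of z] by (simp add: scaleR_conv_of_real inverse_eq_divide)
  show "(\<lambda>i. 1 / fact i * M ^ i) sums exp M" by (rule s)
  show "(\<lambda>i. 1 / fact i * f \<tau> \<sigma> x ^ i) sums exp (f \<tau> \<sigma> x)" for \<tau> \<sigma> x by (rule s)
qed simp

lemma pser_geometric: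
  assumes e: "0 \<le> e" and f: "pser e f M" and M: "M < 1"
  shows "pser e (\<lambda>\<tau> \<sigma> x. 1 / (1 - f \<tau> \<sigma> x)) (1 / (1 - M))"
proof (rule pser.series[of e "\<lambda>i \<tau> \<sigma> x. f \<tau> \<sigma> x ^ i" "\<lambda>i. M ^ i" "1 / (1 - M)"])
  show "pser e (\<lambda>\<tau> \<sigma> x. f \<tau> \<sigma> x ^ i) (M ^ i)" for i by (rule pser_power[OF e f])
  show "(\<lambda>i. M ^ i) sums (1 / (1 - M))" by (rule geometric_sums) (use M pser_nonneg[OF f e] in auto)
  show "(\<lambda>i. f \<tau> \<sigma> x ^ i) sums (1 / (1 - f \<tau> \<sigma> x))" if "\<bar>\<tau>\<bar> \<le> e" "\<bar>\<sigma>\<bar> \<le> e" "x > 0" for \<tau> \<sigma> x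
    by (rule geometric_sums) (use M pser_bound[OF f that] in auto)
qed simp

text \<open>The power \<open>w ^ n\<close> has norm at most \<open>L ^ n \<le> e ^ n\<close>, so
  every monomial keeps its bound after the substitution and the series still converges.\<close>

lemma pser_compose:
  assumes f: "pser e f M" and w: "pser e' w L" and e: "0 \<le> e'" "e' \<le> e" "L \<le> e"
  shows "pser e' (\<lambda>\<tau> \<sigma> x. f \<tau> (w \<tau> \<sigma> x) x) M"
  using f
proof induction
  case (monomial g B f m n M)
  have B: "0 \<le> B" by (rule monomial_bound_nonneg[OF monomial(2)])
  have L0: "0 \<le> L" by (rule pser_nonneg[OF w e(1)])
  have wb: "\<bar>w \<tau> \<sigma> x\<bar> \<le> e" if "\<bar>\<tau>\<bar> \<le> e'" "\<bar>\<sigma>\<bar> \<le> e'" "x > 0" for \<tau> \<sigma> x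
    using pser_bound[OF w that] e by simp
  have "pser e' (\<lambda>\<tau> \<sigma> x. g x * \<tau> ^ m * \<sigma> ^ 0) (B * e' ^ m * e' ^ 0)"
    by (rule pser.monomial[of g B e' _ m 0]) (use monomial in auto)
  from pser_mult[OF e(1) this pser_power[OF e(1) w, of n]]
  have "pser e' (\<lambda>\<tau> \<sigma> x. g x * \<tau> ^ m * w \<tau> \<sigma> x ^ n) (B * e' ^ m * L ^ n)" by simp
  then have "pser e' (\<lambda>\<tau> \<sigma> x. g x * \<tau> ^ m * w \<tau> \<sigma> x ^ n) (B * e ^ m * e ^ n)"
    by (rule pser_mono) (intro mult_mono power_mono; use e L0 B in auto)
  then have "pser e' (\<lambda>\<tau> \<sigma> x. f \<tau> (w \<tau> \<sigma> x) x) (B * e ^ m * e ^ n)"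
    by (rule pser_cong) (use monomial(3) wb e in auto)
  then show ?case by (rule pser_mono) fact
next
  case (series F K S M f)
  show ?case
  proof (rule pser.series[of e' "\<lambda>i \<tau> \<sigma> x. F i \<tau> (w \<tau> \<sigma> x) x" K S])
    show "(\<lambda>i. F i \<tau> (w \<tau> \<sigma> x) x) sums f \<tau> (w \<tau> \<sigma> x) x" if "\<bar>\<tau>\<bar> \<le> e'" "\<bar>\<sigma>\<bar> \<le> e'" "x > 0" for \<tau> \<sigma> x
      by (rule series(4)) (use that pser_bound[OF w that] e in auto)
  qed (use series in auto)
qed

text \<open>Every monomial of positive degree gains a factor \<open>e' / e\<close> when the radius
  shrinks, and the constant term cancels. The smallness conditions of later arguments are met by
  this estimate.\<close>

lemma pser_diff_center:
  assumes f: "pser e f M" and e: "0 \<le> e'" "e' \<le> e" "0 < e"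
  shows "pser e' (\<lambda>\<tau> \<sigma> x. f \<tau> \<sigma> x - f 0 0 x) (e' / e * M)"
  using f
proof induction
  case (monomial g B f m n M)
  have B: "0 \<le> B" by (rule monomial_bound_nonneg[OF monomial(2)])
  show ?case
  proof (cases "m + n = 0")
    case True
    have "0 \<le> B * e ^ m * e ^ n" using B e by simp
    then have M: "0 \<le> e' / e * M" using monomial(4) e by simp
    have "pser e' (\<lambda>\<tau> \<sigma> x. f \<tau> \<sigma> x - f 0 0 x) 0"
      by (rule pser_cong[OF pser_zero]) (use True monomial(3) e in auto)
    then show ?thesis by (rule pser_mono) (rule M)
  next
    case False
    have "pser e' (\<lambda>\<tau> \<sigma> x. f \<tau> \<sigma> x - f 0 0 x) (B * e' ^ m * e' ^ n)"
      by (rule pser.monomial[of g B e' _ m n]) (use monomial e False in \<open>auto simp: power_0_left\<close>)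
    moreover have "B * e' ^ m * e' ^ n \<le> e' / e * M"
    proof -
      obtain k where k: "m + n = Suc k" using False by (cases "m + n") auto
      \<comment> \<open>The degree is at least one, and higher powers of a ratio below 1 are bounded
        by the first.\<close>
      have "(e' / e) ^ Suc k \<le> (e' / e) ^ 1" by (rule power_decreasing) (use e in auto)
      then have "B * (e ^ m * e ^ n) * (e' / e) ^ (m + n) \<le> B * (e ^ m * e ^ n) * (e' / e)"
        unfolding k by (intro mult_left_mono) (use B e in auto)
      also have "\<dots> \<le> M * (e' / e)" using monomial(4) e by (intro mult_right_mono) (auto simp: mult_ac)
      also have "B * (e ^ m * e ^ n) * (e' / e) ^ (m + n) = B * e' ^ m * e' ^ n"
        using e by (simp add: power_divide power_add)
      finally show ?thesis by (simp add: mult.commute)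
    qed
    ultimately show ?thesis by (rule pser_mono)
  qed
next
  case (series F L S M f)
  show ?case
  proof (rule pser.series[of e' "\<lambda>i \<tau> \<sigma> x. F i \<tau> \<sigma> x - F i 0 0 x" "\<lambda>i. e' / e * L i" "e' / e * S"])
    show "(\<lambda>i. e' / e * L i) sums (e' / e * S)" by (rule sums_mult[OF series(2)])
    show "e' / e * S \<le> e' / e * M" by (rule mult_left_mono) (use series e in auto)
    show "(\<lambda>i. F i \<tau> \<sigma> x - F i 0 0 x) sums (f \<tau> \<sigma> x - f 0 0 x)" if "\<bar>\<tau>\<bar> \<le> e'" "\<bar>\<sigma>\<bar> \<le> e'" "x > 0" for \<tau> \<sigma> x
      by (intro sums_diff series(4)) (use that e in auto)
  qed (rule series)
qed

text \<open>Telescoping of a difference of powers, in the norm. The factor \<open>Suc n\<close> is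
  what the integration of \<open>\<sigma> ^ n\<close> will cancel.\<close>

lemma pser_power_diff:
  assumes e: "0 \<le> e" and L: "0 \<le> L" and w: "pser e w L" "pser e w' L" "pser e (\<lambda>\<tau> \<sigma> x. w \<tau> \<sigma> x - w' \<tau> \<sigma> x) K"
  shows "pser e (\<lambda>\<tau> \<sigma> x. w \<tau> \<sigma> x ^ Suc n - w' \<tau> \<sigma> x ^ Suc n) (real (Suc n) * L ^ n * K)"
proof (induction n)
  case 0 then show ?case using w(3) by simp
next
  case (Suc n)
  have "pser e (\<lambda>\<tau> \<sigma> x. w \<tau> \<sigma> x * (w \<tau> \<sigma> x ^ Suc n - w' \<tau> \<sigma> x ^ Suc n)
      + (w \<tau> \<sigma> x - w' \<tau> \<sigma> x) * w' \<tau> \<sigma> x ^ Suc n) (L * (real (Suc n) * L ^ n * K) + K * L ^ Suc n)"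
    by (intro pser_add pser_mult[OF e] Suc w pser_power[OF e])
  moreover have "L * (real (Suc n) * L ^ n * K) + K * L ^ Suc n = real (Suc (Suc n)) * L ^ Suc n * K"
    by (simp add: algebra_simps)
  moreover have "(\<lambda>\<tau> \<sigma> x. w \<tau> \<sigma> x * (w \<tau> \<sigma> x ^ Suc n - w' \<tau> \<sigma> x ^ Suc n)
      + (w \<tau> \<sigma> x - w' \<tau> \<sigma> x) * w' \<tau> \<sigma> x ^ Suc n) = (\<lambda>\<tau> \<sigma> x. w \<tau> \<sigma> x ^ Suc (Suc n) - w' \<tau> \<sigma> x ^ Suc (Suc n))"
    by (simp add: fun_eq_iff algebra_simps)
  ultimately show ?case by simp
qed

lemma pser_center_continuous:
  assumes "pser e f M" "0 \<le> e"
  shows "continuous_on {0<..} (f 0 0)"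
  using assms(1)
proof induction
  case (monomial g B f m n M)
  have "continuous_on {0<..} (\<lambda>x. g x * 0 ^ m * 0 ^ n)" by (intro continuous_intros monomial)
  then show ?case by (rule continuous_on_eq) (use monomial(3) assms(2) in auto)
next
  case (series F L S M f)
  have "uniform_limit {0<..} (\<lambda>n x. \<Sum>i<n. F i 0 0 x) (\<lambda>x. \<Sum>i. F i 0 0 x) sequentially"
    by (rule Weierstrass_m_test[OF _ sums_summable[OF series(2)]])
      (use pser_bound[OF series(1)] assms(2) in auto)
  then have "continuous_on {0<..} (\<lambda>x. \<Sum>i. F i 0 0 x)"
    by (rule uniform_limit_theorem[rotated]) (auto intro!: always_eventually continuous_intros series)
  then show ?case
    by (rule continuous_on_eq) (use sums_unique[OF series(4)] assms(2) in auto)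
qed

text \<open>Substitution into \<open>F\<close> viewed as an operator on power series, Lipschitz on
  the ball of radius \<open>e\<close>. The polydisc radius \<open>e'\<close> may be smaller, since
  the fixed point is found on a smaller polydisc.\<close>

definition pser_lipschitz :: "real \<Rightarrow> (real \<Rightarrow> real \<Rightarrow> real \<Rightarrow> real) \<Rightarrow> real \<Rightarrow> bool" where
  "pser_lipschitz e F M \<longleftrightarrow> (\<forall>e' w w' K. 0 \<le> e' \<longrightarrow> e' \<le> e \<longrightarrow> pser e' w e \<longrightarrow> pser e' w' e \<longrightarrow>
     pser e' (\<lambda>\<tau> \<sigma> x. w \<tau> \<sigma> x - w' \<tau> \<sigma> x) K \<longrightarrow>
     pser e' (\<lambda>\<tau> \<sigma> x. F \<tau> (w \<tau> \<sigma> x) x - F \<tau> (w' \<tau> \<sigma> x) x) (M * K))"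

text \<open>For a monomial the factor \<open>1 / Suc n\<close> from integration meets the factor
  \<open>Suc n\<close> of a difference of powers, so the norm of the integrand is a Lipschitz
  constant of the primitive. Series are differentiated term by term, by uniform convergence.\<close>

lemma pser_antiderivative:
  assumes "pser e f M" and e: "0 < e"
  obtains F where
    "\<And>\<tau> \<sigma> x. \<bar>\<tau>\<bar> \<le> e \<Longrightarrow> \<bar>\<sigma>\<bar> \<le> e \<Longrightarrow> x > 0 \<Longrightarrow>
        ((\<lambda>s. F \<tau> s x) has_real_derivative f \<tau> \<sigma> x) (at \<sigma> within {-e..e})"
    "\<And>\<tau> x. \<bar>\<tau>\<bar> \<le> e \<Longrightarrow> x > 0 \<Longrightarrow> F \<tau> 0 x = 0"
    "pser_lipschitz e F M"
proof -
  have "\<exists>F. (\<forall>\<tau> \<sigma> x. \<bar>\<tau>\<bar> \<le> e \<longrightarrow> \<bar>\<sigma>\<bar> \<le> e \<longrightarrow> x > 0 \<longrightarrow>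
        ((\<lambda>s. F \<tau> s x) has_real_derivative f \<tau> \<sigma> x) (at \<sigma> within {-e..e})) \<and>
      (\<forall>\<tau> x. \<bar>\<tau>\<bar> \<le> e \<longrightarrow> x > 0 \<longrightarrow> F \<tau> 0 x = 0) \<and>
      (\<forall>e' w w' K. 0 \<le> e' \<longrightarrow> e' \<le> e \<longrightarrow> pser e' w e \<longrightarrow> pser e' w' e \<longrightarrow>
        pser e' (\<lambda>\<tau> \<sigma> x. w \<tau> \<sigma> x - w' \<tau> \<sigma> x) K \<longrightarrow>
        pser e' (\<lambda>\<tau> \<sigma> x. F \<tau> (w \<tau> \<sigma> x) x - F \<tau> (w' \<tau> \<sigma> x) x) (M * K))"
    using assms(1)
  proof induction
    case (monomial g B f m n M)
    have B: "0 \<le> B" by (rule monomial_bound_nonneg[OF monomial(2)])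
    define F where "F = (\<lambda>\<tau> \<sigma> x. g x * \<tau> ^ m * (\<sigma> ^ Suc n / real (Suc n)))"
    show ?case
    proof (rule exI[of _ F], intro conjI allI impI)
      fix \<tau> \<sigma> x :: real assume d: "\<bar>\<tau>\<bar> \<le> e" "\<bar>\<sigma>\<bar> \<le> e" "x > 0"
      have "((\<lambda>s. F \<tau> s x) has_real_derivative g x * \<tau> ^ m * (real (Suc n) * \<sigma> ^ n / real (Suc n))) (at \<sigma> within {-e..e})"
        unfolding F_def
        by (rule has_field_derivative_at_within) (intro DERIV_cmult DERIV_cdivide, use DERIV_pow[of "Suc n" \<sigma>] in simp)
      then show "((\<lambda>s. F \<tau> s x) has_real_derivative f \<tau> \<sigma> x) (at \<sigma> within {-e..e})"
        using monomial(3)[OF d] by simp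
    next
      fix e' w w' K
      assume e': "0 \<le> e'" "e' \<le> e" and w: "pser e' w e" "pser e' w' e"
        "pser e' (\<lambda>\<tau> \<sigma> x. w \<tau> \<sigma> x - w' \<tau> \<sigma> x) K"
      have K: "0 \<le> K" by (rule pser_nonneg[OF w(3) e'(1)])
      have "pser e' (\<lambda>\<tau> \<sigma> x. g x * \<tau> ^ m * \<sigma> ^ 0) (B * e ^ m)"
        by (rule pser.monomial[of g B e' _ m 0])
          (use monomial B e' in \<open>auto intro!: mult_left_mono power_mono\<close>)
      note * = pser_mult[OF e'(1) this pser_cmult[OF e'(1) pser_power_diff[OF e'(1) less_imp_le[OF e] w, of n], of "1 / real (Suc n)"]]
      have "pser e' (\<lambda>\<tau> \<sigma> x. F \<tau> (w \<tau> \<sigma> x) x - F \<tau> (w' \<tau> \<sigma> x) x)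
          (B * e ^ m * (\<bar>1 / real (Suc n)\<bar> * (real (Suc n) * e ^ n * K)))"
        by (rule pser_cong[OF *]) (simp add: F_def right_diff_distrib diff_divide_distrib del: of_nat_Suc power_Suc)
      then have "pser e' (\<lambda>\<tau> \<sigma> x. F \<tau> (w \<tau> \<sigma> x) x - F \<tau> (w' \<tau> \<sigma> x) x)
          (B * e ^ m * (1 / real (Suc n) * (real (Suc n) * e ^ n * K)))"
        by (simp only: abs_of_nonneg divide_nonneg_nonneg zero_le_one of_nat_0_le_iff)
      then show "pser e' (\<lambda>\<tau> \<sigma> x. F \<tau> (w \<tau> \<sigma> x) x - F \<tau> (w' \<tau> \<sigma> x) x) (M * K)"
      proof (rule pser_mono)
        have "B * e ^ m * (1 / real (Suc n) * (real (Suc n) * e ^ n * K)) = B * e ^ m * e ^ n * K" by simp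
        also have "\<dots> \<le> M * K" by (rule mult_right_mono[OF monomial(4) K])
        finally show "B * e ^ m * (1 / real (Suc n) * (real (Suc n) * e ^ n * K)) \<le> M * K" .
      qed
    qed (auto simp: F_def)
  next
    case (series F L S M f)
    define Q where "Q = (\<lambda>i G. (\<forall>\<tau> \<sigma> x. \<bar>\<tau>\<bar> \<le> e \<longrightarrow> \<bar>\<sigma>\<bar> \<le> e \<longrightarrow> x > 0 \<longrightarrow>
        ((\<lambda>s. G \<tau> s x) has_real_derivative F i \<tau> \<sigma> x) (at \<sigma> within {-e..e})) \<and>
      (\<forall>\<tau> x. \<bar>\<tau>\<bar> \<le> e \<longrightarrow> x > 0 \<longrightarrow> G \<tau> 0 x = 0) \<and>
      (\<forall>e' w w' K. 0 \<le> e' \<longrightarrow> e' \<le> e \<longrightarrow> pser e' w e \<longrightarrow> pser e' w' e \<longrightarrow>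
        pser e' (\<lambda>\<tau> \<sigma> x. w \<tau> \<sigma> x - w' \<tau> \<sigma> x) K \<longrightarrow>
        pser e' (\<lambda>\<tau> \<sigma> x. G \<tau> (w \<tau> \<sigma> x) x - G \<tau> (w' \<tau> \<sigma> x) x) (L i * K)))"
    have "\<forall>i. \<exists>G. Q i G" unfolding Q_def by (rule allI) (rule series.IH)
    from choice[OF this] obtain G where q: "\<And>i. Q i (G i)" by auto
    note G = q[unfolded Q_def, THEN conjunct1, rule_format]
      q[unfolded Q_def, THEN conjunct2, THEN conjunct1, rule_format]
      q[unfolded Q_def, THEN conjunct2, THEN conjunct2, rule_format]
    define H where "H = (\<lambda>\<tau> \<sigma> x. \<Sum>i. G i \<tau> \<sigma> x)"
    have H: "(\<lambda>i. G i \<tau> \<sigma> x) sums H \<tau> \<sigma> x \<and> ((\<lambda>s. H \<tau> s x) has_real_derivative f \<tau> \<sigma> x) (at \<sigma> within {-e..e})"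
      if d: "\<bar>\<tau>\<bar> \<le> e" "\<bar>\<sigma>\<bar> \<le> e" "x > 0" for \<tau> \<sigma> x
    proof -
      have in_D: "\<bar>s\<bar> \<le> e" if "s \<in> {-e..e}" for s using that by auto
      have "uniform_limit {-e..e} (\<lambda>n s. \<Sum>i<n. F i \<tau> s x) (\<lambda>s. \<Sum>i. F i \<tau> s x) sequentially"
        by (rule Weierstrass_m_test[OF _ sums_summable[OF series.hyps(2)]])
          (use pser_bound[OF series.hyps(1) d(1) in_D d(3)] in simp)
      from has_field_derivative_series[OF _ G(1)[OF d(1) in_D d(3)] this, of 0]
      have "\<exists>g. \<forall>s\<in>{-e..e}. (\<lambda>i. G i \<tau> s x) sums g s \<and>
          (g has_real_derivative (\<Sum>i. F i \<tau> s x)) (at s within {-e..e})"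
        using e G(2)[OF d(1,3)] by auto
      then obtain g where g: "\<And>s. s \<in> {-e..e} \<Longrightarrow> (\<lambda>i. G i \<tau> s x) sums g s"
        "\<And>s. s \<in> {-e..e} \<Longrightarrow> (g has_real_derivative (\<Sum>i. F i \<tau> s x)) (at s within {-e..e})"
        by (elim exE) (rule that, auto)
      have Hg: "H \<tau> s x = g s" if "s \<in> {-e..e}" for s using sums_unique[OF g(1)[OF that]] by (simp add: H_def)
      have s: "\<sigma> \<in> {-e..e}" using d by auto
      have "(g has_real_derivative f \<tau> \<sigma> x) (at \<sigma> within {-e..e})"
        using g(2)[OF s] sums_unique[OF series.hyps(4)[OF d]] by simp
      then have "((\<lambda>s. H \<tau> s x) has_real_derivative f \<tau> \<sigma> x) (at \<sigma> within {-e..e})"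
        by (rule has_field_derivative_transform_within[OF _ zero_less_one s]) (use Hg in auto)
      then show ?thesis using g(1)[OF s] Hg[OF s] by simp
    qed
    show ?case
    proof (rule exI[of _ H], intro conjI allI impI)
      show "((\<lambda>s. H \<tau> s x) has_real_derivative f \<tau> \<sigma> x) (at \<sigma> within {-e..e})"
        if "\<bar>\<tau>\<bar> \<le> e" "\<bar>\<sigma>\<bar> \<le> e" "x > 0" for \<tau> \<sigma> x
        by (rule H[OF that, THEN conjunct2])
      show "H \<tau> 0 x = 0" if "\<bar>\<tau>\<bar> \<le> e" "x > 0" for \<tau> x using G(2)[OF that] by (simp add: H_def)
      fix e' w w' K
      assume e': "0 \<le> e'" "e' \<le> e" and w: "pser e' w e" "pser e' w' e"
        "pser e' (\<lambda>\<tau> \<sigma> x. w \<tau> \<sigma> x - w' \<tau> \<sigma> x) K"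
      have K: "0 \<le> K" by (rule pser_nonneg[OF w(3) e'(1)])
      show "pser e' (\<lambda>\<tau> \<sigma> x. H \<tau> (w \<tau> \<sigma> x) x - H \<tau> (w' \<tau> \<sigma> x) x) (M * K)"
      proof (rule pser.series)
        show "pser e' (\<lambda>\<tau> \<sigma> x. G i \<tau> (w \<tau> \<sigma> x) x - G i \<tau> (w' \<tau> \<sigma> x) x) (L i * K)" for i
          by (rule G(3)[OF e' w])
        show "(\<lambda>i. L i * K) sums (S * K)" by (rule sums_mult2[OF series.hyps(2)])
        show "S * K \<le> M * K" by (rule mult_right_mono[OF series.hyps(3) K])
        show "(\<lambda>i. G i \<tau> (w \<tau> \<sigma> x) x - G i \<tau> (w' \<tau> \<sigma> x) x) sums (H \<tau> (w \<tau> \<sigma> x) x - H \<tau> (w' \<tau> \<sigma> x) x)"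
          if "\<bar>\<tau>\<bar> \<le> e'" "\<bar>\<sigma>\<bar> \<le> e'" "x > 0" for \<tau> \<sigma> x
          by (intro sums_diff H[THEN conjunct1] order_trans[OF _ e'(2)] pser_bound[OF w(1)] pser_bound[OF w(2)] that)
      qed
    qed
  qed
  then show ?thesis
  proof (elim exE conjE)
    fix F
    assume 1: "\<forall>\<tau> \<sigma> x. \<bar>\<tau>\<bar> \<le> e \<longrightarrow> \<bar>\<sigma>\<bar> \<le> e \<longrightarrow> x > 0 \<longrightarrow>
        ((\<lambda>s. F \<tau> s x) has_real_derivative f \<tau> \<sigma> x) (at \<sigma> within {-e..e})"
      and 2: "\<forall>\<tau> x. \<bar>\<tau>\<bar> \<le> e \<longrightarrow> x > 0 \<longrightarrow> F \<tau> 0 x = 0"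
      and 3: "\<forall>e' w w' K. 0 \<le> e' \<longrightarrow> e' \<le> e \<longrightarrow> pser e' w e \<longrightarrow> pser e' w' e \<longrightarrow>
        pser e' (\<lambda>\<tau> \<sigma> x. w \<tau> \<sigma> x - w' \<tau> \<sigma> x) K \<longrightarrow>
        pser e' (\<lambda>\<tau> \<sigma> x. F \<tau> (w \<tau> \<sigma> x) x - F \<tau> (w' \<tau> \<sigma> x) x) (M * K)"
    show thesis by (rule that[OF 1[rule_format] 2[rule_format] 3[folded pser_lipschitz_def]])
  qed
qed

text \<open>Fubini for summable double series, in the form that regroups a sum of power series by
  exponents.\<close>

lemma has_sum_double_swap:
  fixes t :: "'a \<Rightarrow> 'b \<Rightarrow> real"
  assumes a: "(\<lambda>(i, p). t i p) summable_on UNIV \<times> UNIV"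
    and r: "\<And>i. (t i has_sum r i) UNIV" and c: "\<And>p. ((\<lambda>i. t i p) has_sum c p) UNIV"
    and R: "(r has_sum R) UNIV"
  shows "(c has_sum R) UNIV"
proof -
  obtain X where X: "((\<lambda>(i, p). t i p) has_sum X) (UNIV \<times> UNIV)" using a by (auto simp: summable_on_def)
  have "(r has_sum X) UNIV" by (rule has_sum_SigmaD[OF X]) (use r in auto)
  then have XR: "X = R" using R by (rule has_sum_unique)
  have "((\<lambda>(p, i). t i p) has_sum X) (UNIV \<times> UNIV)"
    using X has_sum_swap[where f = "\<lambda>(i, p). t i p" and S = X and A = UNIV and B = UNIV] by simp
  then have "(c has_sum X) UNIV" by (rule has_sum_SigmaD) (use c in auto)
  then show ?thesis by (simp add: XR)
qed

lemma nonneg_summable_on_Times: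
  fixes b :: "nat \<Rightarrow> 'b \<Rightarrow> real"
  assumes "\<And>i p. 0 \<le> b i p" and s: "\<And>i. (b i has_sum S i) UNIV" and "summable S"
  shows "(\<lambda>(i, p). b i p) summable_on UNIV \<times> UNIV"
proof -
  have S: "0 \<le> S i" for i using has_sum_nonneg[OF s] assms(1) by auto
  have "S summable_on UNIV" using assms(3) S by (intro norm_summable_imp_summable_on) simp
  moreover have "(\<Sum>\<^sub>\<infinity>p. b i p) = S i" for i by (rule infsumI[OF s])
  ultimately have "(\<lambda>z. norm (case z of (i, p) \<Rightarrow> b i p)) summable_on UNIV \<times> UNIV"
    unfolding Infinite_Sum.abs_summable_on_Sigma_iff using assms(1) S has_sum_imp_summable[OF s] by auto
  then show ?thesis by (rule Infinite_Sum.abs_summable_summable)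
qed

text \<open>In \<open>pser\<close> the same exponents may occur in infinitely many terms. Collecting
  them gives one coefficient per exponent pair, as \<open>analytic_C\<close> demands; the
  rearrangement is made once for the norms and once for the values.\<close>

lemma pser_coefficients:
  assumes "pser e f M" and e: "0 < e"
  obtains c :: "nat \<times> nat \<Rightarrow> real \<Rightarrow> real" and B S where
    "\<And>p. continuous_on {0<..} (c p)" "\<And>p x. x > 0 \<Longrightarrow> \<bar>c p x\<bar> \<le> B p"
    "((\<lambda>p. B p * e ^ fst p * e ^ snd p) has_sum S) UNIV"
    "\<And>\<tau> \<sigma> x. \<bar>\<tau>\<bar> \<le> e \<Longrightarrow> \<bar>\<sigma>\<bar> \<le> e \<Longrightarrow> x > 0 \<Longrightarrow>
       ((\<lambda>p. c p x * \<tau> ^ fst p * \<sigma> ^ snd p) has_sum f \<tau> \<sigma> x) UNIV"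
proof -
  \<comment> \<open>The clause \<open>S \<le> M\<close> strengthens the induction: in the series
    case it makes the norms of the summands summable.\<close>
  have "\<exists>(c :: nat \<times> nat \<Rightarrow> real \<Rightarrow> real) B S. (\<forall>p. continuous_on {0<..} (c p)) \<and> (\<forall>p x. x > 0 \<longrightarrow> \<bar>c p x\<bar> \<le> B p) \<and>
    ((\<lambda>p. B p * e ^ fst p * e ^ snd p) has_sum S) UNIV \<and> S \<le> M \<and>
    (\<forall>\<tau> \<sigma> x. \<bar>\<tau>\<bar> \<le> e \<longrightarrow> \<bar>\<sigma>\<bar> \<le> e \<longrightarrow> x > 0 \<longrightarrow>
       ((\<lambda>p. c p x * \<tau> ^ fst p * \<sigma> ^ snd p) has_sum f \<tau> \<sigma> x) UNIV)"
    using assms(1)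
  proof induction
    case (monomial g B f m n M)
    have hs: "(h has_sum h (m, n)) UNIV" if "\<And>p. p \<noteq> (m, n) \<Longrightarrow> h p = 0" for h :: "nat \<times> nat \<Rightarrow> real"
    proof -
      have "(h has_sum h (m, n)) {(m, n)}" using has_sum_finite[of "{(m, n)}" h] by simp
      then show ?thesis by (subst has_sum_cong_neutral[of "{(m, n)}" UNIV h h]) (use that in auto)
    qed
    show ?case
    proof (intro exI conjI allI impI)
      define c where "c = (\<lambda>p x. if p = (m, n) then g x else 0)"
      define b where "b = (\<lambda>p. if p = (m, n) then B else 0)"
      show "continuous_on {0<..} (c p)" for p using monomial by (cases "p = (m, n)") (auto simp: c_def)
      show "\<bar>c p x\<bar> \<le> b p" if "x > 0" for p x using monomial(2)[OF that] by (auto simp: c_def b_def)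
      show "((\<lambda>p. b p * e ^ fst p * e ^ snd p) has_sum B * e ^ m * e ^ n) UNIV"
        using hs[of "\<lambda>p. b p * e ^ fst p * e ^ snd p"] by (simp add: b_def)
      show "B * e ^ m * e ^ n \<le> M" by fact
      show "((\<lambda>p. c p x * \<tau> ^ fst p * \<sigma> ^ snd p) has_sum f \<tau> \<sigma> x) UNIV"
        if "\<bar>\<tau>\<bar> \<le> e" "\<bar>\<sigma>\<bar> \<le> e" "x > 0" for \<tau> \<sigma> x
        using hs[of "\<lambda>p. c p x * \<tau> ^ fst p * \<sigma> ^ snd p"] monomial(3)[OF that] by (simp add: c_def)
    qed
  next
    case (series F L S M f)
    define Q where "Q = (\<lambda>i (c :: nat \<times> nat \<Rightarrow> real \<Rightarrow> real) B S. (\<forall>p. continuous_on {0<..} (c p)) \<and> (\<forall>p x. x > 0 \<longrightarrow> \<bar>c p x\<bar> \<le> B p) \<and>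
      ((\<lambda>p. B p * e ^ fst p * e ^ snd p) has_sum S) UNIV \<and> S \<le> L i \<and>
      (\<forall>\<tau> \<sigma> x. \<bar>\<tau>\<bar> \<le> e \<longrightarrow> \<bar>\<sigma>\<bar> \<le> e \<longrightarrow> x > 0 \<longrightarrow>
         ((\<lambda>p. c p x * \<tau> ^ fst p * \<sigma> ^ snd p) has_sum F i \<tau> \<sigma> x) UNIV))"
    have "\<forall>i. \<exists>c B S. Q i c B S" unfolding Q_def using series.IH by blast
    then obtain c B T where "\<And>i. Q i (c i) (B i) (T i)" by metis
    then have c: "\<And>i p. continuous_on {0<..} (c i p)" "\<And>i p x. x > 0 \<Longrightarrow> \<bar>c i p x\<bar> \<le> B i p"
      and T: "\<And>i. ((\<lambda>p. B i p * e ^ fst p * e ^ snd p) has_sum T i) UNIV" "\<And>i. T i \<le> L i"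
      and F: "\<And>i \<tau> \<sigma> x. \<bar>\<tau>\<bar> \<le> e \<Longrightarrow> \<bar>\<sigma>\<bar> \<le> e \<Longrightarrow> x > 0 \<Longrightarrow>
       ((\<lambda>p. c i p x * \<tau> ^ fst p * \<sigma> ^ snd p) has_sum F i \<tau> \<sigma> x) UNIV"
      unfolding Q_def by blast+
    have B0: "0 \<le> B i p" for i p using monomial_bound_nonneg[OF c(2)] .
    have b0: "0 \<le> B i p * e ^ fst p * e ^ snd p" for i p using B0 e by simp
    have T0: "0 \<le> T i" for i using has_sum_nonneg[OF T(1)] b0 by auto
    have sT: "summable T" by (rule summable_comparison_test'[OF sums_summable[OF series.hyps(2)]]) (use T(2) T0 in auto)
    have bT: "B i p * e ^ fst p * e ^ snd p \<le> T i" for i p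
      using finite_sum_le_has_sum[OF T(1)[of i], of "{p}"] b0 by auto
    \<comment> \<open>A single coefficient is bounded by the norm of its series divided by the
      positive weight of its exponent; hence the coefficients of each exponent can be summed over
      \<open>i\<close>.\<close>
    have BT: "B i p \<le> T i / (e ^ fst p * e ^ snd p)" for i p
      using bT[of i p] e by (simp add: pos_le_divide_eq mult.assoc)
    have sB: "summable (\<lambda>i. B i p)" for p
      by (rule summable_comparison_test'[OF summable_divide[OF sT, of "e ^ fst p * e ^ snd p"]]) (use BT B0 in auto)
    have sums_b: "(\<lambda>(i, p). B i p * e ^ fst p * e ^ snd p) summable_on UNIV \<times> UNIV"
      by (rule nonneg_summable_on_Times[OF b0 T(1) sT])
    have c_sum: "((\<lambda>i. c i p x) has_sum (\<Sum>i. c i p x)) UNIV" if "x > 0" for p x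
    proof (rule norm_summable_imp_has_sum)
      show n: "summable (\<lambda>i. norm (c i p x))"
        by (rule summable_comparison_test'[OF sB[of p]]) (use c(2)[OF that] in auto)
      show "(\<lambda>i. c i p x) sums (\<Sum>i. c i p x)" by (rule summable_sums[OF summable_norm_cancel[OF n]])
    qed
    have B_sum: "((\<lambda>i. B i p) has_sum (\<Sum>i. B i p)) UNIV" for p
      by (rule norm_summable_imp_has_sum) (use sB[of p] B0 in \<open>auto intro: summable_sums\<close>)
    show ?case
    proof (intro exI conjI allI impI)
      show "continuous_on {0<..} (\<lambda>x. \<Sum>i. c i p x)" for p
      proof -
        have "uniform_limit {0<..} (\<lambda>n x. \<Sum>i<n. c i p x) (\<lambda>x. \<Sum>i. c i p x) sequentially"
          by (rule Weierstrass_m_test[OF _ sB[of p]]) (use c(2) in auto)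
        then show ?thesis
          by (rule uniform_limit_theorem[rotated]) (auto intro!: always_eventually continuous_intros c)
      qed
      show "\<bar>\<Sum>i. c i p x\<bar> \<le> (\<Sum>i. B i p)" if "x > 0" for p x
      proof -
        have n: "summable (\<lambda>i. norm (c i p x))"
          by (rule summable_comparison_test'[OF sB[of p]]) (use c(2)[OF that] in auto)
        from n have "norm (\<Sum>i. c i p x) \<le> (\<Sum>i. norm (c i p x))" by (rule summable_norm)
        also have "\<dots> \<le> (\<Sum>i. B i p)" by (rule suminf_le) (use c(2)[OF that] sB n in auto)
        finally show ?thesis by simp
      qed
      show "((\<lambda>p. (\<Sum>i. B i p) * e ^ fst p * e ^ snd p) has_sum (\<Sum>i. T i)) UNIV"
      proof (rule has_sum_double_swap[OF sums_b T(1)])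
        show "((\<lambda>i. B i p * e ^ fst p * e ^ snd p) has_sum (\<Sum>i. B i p) * e ^ fst p * e ^ snd p) UNIV" for p
          by (intro has_sum_cmult_left B_sum)
        show "(T has_sum (\<Sum>i. T i)) UNIV"
          by (rule norm_summable_imp_has_sum) (use sT T0 in \<open>auto intro: summable_sums\<close>)
      qed
      have "(\<Sum>i. T i) \<le> S"
        using suminf_le[OF T(2) sT sums_summable[OF series.hyps(2)]] sums_unique[OF series.hyps(2)] by simp
      then show "(\<Sum>i. T i) \<le> M" using series.hyps(3) by simp
      fix \<tau> \<sigma> x :: real assume d: "\<bar>\<tau>\<bar> \<le> e" "\<bar>\<sigma>\<bar> \<le> e" "x > 0"
      have le: "\<bar>c i p x * \<tau> ^ fst p * \<sigma> ^ snd p\<bar> \<le> B i p * e ^ fst p * e ^ snd p" for i p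
        by (rule abs_monomial_le[OF c(2)[OF d(3)] d(1,2)])
      show "((\<lambda>p. (\<Sum>i. c i p x) * \<tau> ^ fst p * \<sigma> ^ snd p) has_sum f \<tau> \<sigma> x) UNIV"
      proof (rule has_sum_double_swap[OF _ F[OF d]])
        have "(\<lambda>z. norm (c (fst z) (snd z) x * \<tau> ^ fst (snd z) * \<sigma> ^ snd (snd z))) summable_on UNIV \<times> UNIV"
          by (rule Infinite_Sum.abs_summable_on_comparison_test'[OF sums_b[unfolded split_beta']]) (use le in auto)
        from Infinite_Sum.abs_summable_summable[OF this]
        show "(\<lambda>(i, p). c i p x * \<tau> ^ fst p * \<sigma> ^ snd p) summable_on UNIV \<times> UNIV"
          by (simp add: split_beta')
        show "((\<lambda>i. c i p x * \<tau> ^ fst p * \<sigma> ^ snd p) has_sum (\<Sum>i. c i p x) * \<tau> ^ fst p * \<sigma> ^ snd p) UNIV" for p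
          by (intro has_sum_cmult_left c_sum d)
        have "summable (\<lambda>i. norm (F i \<tau> \<sigma> x))"
          by (rule summable_comparison_test'[OF sums_summable[OF series.hyps(2)]])
            (use pser_bound[OF series.hyps(1) d] in auto)
        then show "((\<lambda>i. F i \<tau> \<sigma> x) has_sum f \<tau> \<sigma> x) UNIV"
          by (rule norm_summable_imp_has_sum) (rule series.hyps(4)[OF d])
      qed
    qed
  qed
  then show ?thesis using that by (elim exE conjE) blast
qed

section \<open>Analytic maps as local power series\<close>

lemma bcontD: "bcont g \<Longrightarrow> x > 0 \<Longrightarrow> \<bar>g x\<bar> \<le> supnorm g"
  unfolding supnorm_def bcont_def bounded_iff
  by (intro cSUP_upper) (auto intro: bdd_aboveI2)

lemma supnorm_nonneg: "bcont g \<Longrightarrow> 0 \<le> supnorm g"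
  using bcontD[of g 1] by simp

lemma supnorm_le: "(\<And>x. x > 0 \<Longrightarrow> \<bar>g x\<bar> \<le> B) \<Longrightarrow> supnorm g \<le> B"
  unfolding supnorm_def by (rule cSUP_least) (auto intro: exI[of _ 1])

text \<open>Here \<open>\<sigma>\<close> is a relative displacement, so one expansion serves all
  \<open>x > 0\<close> uniformly, and \<open>e < 1\<close> keeps \<open>1 + \<sigma>\<close>
  positive. The series lives on a full polydisc, also where \<open>t0 + \<tau>\<close> leaves the
  unit interval.\<close>

definition local_series :: "real \<Rightarrow> (real \<Rightarrow> real \<Rightarrow> real) \<Rightarrow> bool" where
  "local_series t0 F \<longleftrightarrow> (\<exists>e f M. 0 < e \<and> e < 1 \<and> pser e f M \<and>
     (\<forall>t\<in>{0..1}. \<forall>\<sigma> x. \<bar>t - t0\<bar> \<le> e \<longrightarrow> \<bar>\<sigma>\<bar> \<le> e \<longrightarrow> x > 0 \<longrightarrow>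
        F t ((1 + \<sigma>) * x) = f (t - t0) \<sigma> x))"

lemma local_seriesI:
  assumes "0 < e" "e < 1" "pser e f M"
    "\<And>t \<sigma> x. t \<in> {0..1} \<Longrightarrow> \<bar>t - t0\<bar> \<le> e \<Longrightarrow> \<bar>\<sigma>\<bar> \<le> e \<Longrightarrow> x > 0 \<Longrightarrow> F t ((1 + \<sigma>) * x) = f (t - t0) \<sigma> x"
  shows "local_series t0 F"
  using assms unfolding local_series_def by blast

text \<open>The free bound \<open>e0\<close> permits shrinking one expansion to the radius of
  another.\<close>

lemma local_seriesE:
  assumes "local_series t0 F" "0 < e0"
  obtains e f M where "0 < e" "e < 1" "e \<le> e0" "pser e f M"
    "\<And>t \<sigma> x. t \<in> {0..1} \<Longrightarrow> \<bar>t - t0\<bar> \<le> e \<Longrightarrow> \<bar>\<sigma>\<bar> \<le> e \<Longrightarrow> x > 0 \<Longrightarrow> F t ((1 + \<sigma>) * x) = f (t - t0) \<sigma> x"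
proof -
  from assms(1) obtain e f M where e: "0 < e" "e < 1" "pser e f M"
    "\<And>t \<sigma> x. t \<in> {0..1} \<Longrightarrow> \<bar>t - t0\<bar> \<le> e \<Longrightarrow> \<bar>\<sigma>\<bar> \<le> e \<Longrightarrow> x > 0 \<Longrightarrow> F t ((1 + \<sigma>) * x) = f (t - t0) \<sigma> x"
    unfolding local_series_def by blast
  show ?thesis
    by (rule that[of "min e e0" f M]) (use e assms(2) in \<open>auto intro: pser_shrink\<close>)
qed

lemma local_series_cong:
  assumes "local_series t0 F" "\<And>t x. t \<in> {0..1} \<Longrightarrow> x > 0 \<Longrightarrow> F' t x = F t x"
  shows "local_series t0 F'"
proof -
  obtain e f M where e: "0 < e" "e < 1" "pser e f M"
    "\<And>t \<sigma> x. t \<in> {0..1} \<Longrightarrow> \<bar>t - t0\<bar> \<le> e \<Longrightarrow> \<bar>\<sigma>\<bar> \<le> e \<Longrightarrow> x > 0 \<Longrightarrow> F t ((1 + \<sigma>) * x) = f (t - t0) \<sigma> x"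
    using local_seriesE[OF assms(1) zero_less_one] by metis
  show ?thesis by (rule local_seriesI[OF e(1-3)]) (use e assms(2) in auto)
qed

lemma local_series_add:
  assumes "local_series t0 F" "local_series t0 G"
  shows "local_series t0 (\<lambda>t x. F t x + G t x)"
proof -
  obtain e1 f1 M1 where 1: "0 < e1" "e1 < 1" "pser e1 f1 M1"
    "\<And>t \<sigma> x. t \<in> {0..1} \<Longrightarrow> \<bar>t - t0\<bar> \<le> e1 \<Longrightarrow> \<bar>\<sigma>\<bar> \<le> e1 \<Longrightarrow> x > 0 \<Longrightarrow> F t ((1 + \<sigma>) * x) = f1 (t - t0) \<sigma> x"
    using local_seriesE[OF assms(1) zero_less_one] by metis
  obtain e f M where 2: "0 < e" "e < 1" "e \<le> e1" "pser e f M"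
    "\<And>t \<sigma> x. t \<in> {0..1} \<Longrightarrow> \<bar>t - t0\<bar> \<le> e \<Longrightarrow> \<bar>\<sigma>\<bar> \<le> e \<Longrightarrow> x > 0 \<Longrightarrow> G t ((1 + \<sigma>) * x) = f (t - t0) \<sigma> x"
    using local_seriesE[OF assms(2) 1(1)] by metis
  show ?thesis
    by (rule local_seriesI[OF 2(1,2) pser_add[OF pser_shrink[OF 1(3) _ 2(3)] 2(4)]])
      (use 1 2 in auto)
qed

lemma local_series_mult:
  assumes "local_series t0 F" "local_series t0 G"
  shows "local_series t0 (\<lambda>t x. F t x * G t x)"
proof -
  obtain e1 f1 M1 where 1: "0 < e1" "e1 < 1" "pser e1 f1 M1"
    "\<And>t \<sigma> x. t \<in> {0..1} \<Longrightarrow> \<bar>t - t0\<bar> \<le> e1 \<Longrightarrow> \<bar>\<sigma>\<bar> \<le> e1 \<Longrightarrow> x > 0 \<Longrightarrow> F t ((1 + \<sigma>) * x) = f1 (t - t0) \<sigma> x"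
    using local_seriesE[OF assms(1) zero_less_one] by metis
  obtain e f M where 2: "0 < e" "e < 1" "e \<le> e1" "pser e f M"
    "\<And>t \<sigma> x. t \<in> {0..1} \<Longrightarrow> \<bar>t - t0\<bar> \<le> e \<Longrightarrow> \<bar>\<sigma>\<bar> \<le> e \<Longrightarrow> x > 0 \<Longrightarrow> G t ((1 + \<sigma>) * x) = f (t - t0) \<sigma> x"
    using local_seriesE[OF assms(2) 1(1)] by metis
  show ?thesis
    by (rule local_seriesI[OF 2(1,2) pser_mult[OF _ pser_shrink[OF 1(3) _ 2(3)] 2(4)]])
      (use 1 2 in auto)
qed

text \<open>Writing \<open>f = f0 * (1 - \<phi>)\<close>, where \<open>f0\<close> is the value at
  the centre, the reciprocal is \<open>1 / f0\<close> times a geometric series in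
  \<open>\<phi>\<close>.\<close>

lemma pser_inverse:
  assumes f: "pser e f M" and e: "0 < e" and \<delta>: "\<delta> > 0" "\<And>x. x > 0 \<Longrightarrow> \<delta> \<le> f 0 0 x"
  obtains e' M' where "0 < e'" "e' \<le> e" "pser e' (\<lambda>\<tau> \<sigma> x. 1 / f \<tau> \<sigma> x) M'"
    "\<And>\<tau> \<sigma> x. \<bar>\<tau>\<bar> \<le> e' \<Longrightarrow> \<bar>\<sigma>\<bar> \<le> e' \<Longrightarrow> x > 0 \<Longrightarrow> f \<tau> \<sigma> x > 0"
proof -
  have M0: "0 \<le> M" by (rule pser_nonneg[OF f less_imp_le[OF e]])
  \<comment> \<open>Makes the norm \<open>1 / \<delta> * (e' / e * M)\<close> of
    \<open>\<phi>\<close> at most 1/2; \<open>M + 1\<close> guards against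
    \<open>M = 0\<close>.\<close>
  define e' where "e' = min e (e * \<delta> / (2 * (M + 1)))"
  have e': "0 < e'" "e' \<le> e" using e \<delta> M0 by (auto simp: e'_def)
  have "e' \<le> e * \<delta> / (2 * (M + 1))" by (simp add: e'_def)
  then have "e' * (2 * (M + 1)) \<le> e * \<delta>" using M0 by (simp add: pos_le_divide_eq)
  then have small: "1 / \<delta> * (e' / e * M) \<le> 1 / 2"
    using e \<delta> e' M0 by (simp add: field_simps)
  have e0: "0 \<le> e'" using e' by simp
  have f0: "continuous_on {0<..} (f 0 0)" by (rule pser_center_continuous[OF f less_imp_le[OF e]])
  have f0pos: "f 0 0 x > 0" if "x > 0" for x using \<delta>(2)[OF that] \<delta>(1) by simp
  have inv: "pser e' (\<lambda>\<tau> \<sigma> x. 1 / f 0 0 x) (1 / \<delta>)"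
  proof (rule pser_coeff)
    show "continuous_on {0<..} (\<lambda>x. 1 / f 0 0 x)" by (intro continuous_intros f0) (use f0pos in force)
    show "\<bar>1 / f 0 0 x\<bar> \<le> 1 / \<delta>" if "x > 0" for x
      using \<delta>(2)[OF that] \<delta>(1) by (simp add: frac_le)
  qed
  have "pser e' (\<lambda>\<tau> \<sigma> x. 1 / f 0 0 x * (f \<tau> \<sigma> x - f 0 0 x)) (1 / \<delta> * (e' / e * M))"
    by (rule pser_mult[OF e0 inv pser_diff_center[OF f e0 e'(2) e]])
  then have \<phi>: "pser e' (\<lambda>\<tau> \<sigma> x. - (1 / f 0 0 x * (f \<tau> \<sigma> x - f 0 0 x))) (1 / 2)"
    by (intro pser_minus e0) (rule pser_mono[OF _ small])
  have eq: "1 / f \<tau> \<sigma> x = 1 / f 0 0 x * (1 / (1 - - (1 / f 0 0 x * (f \<tau> \<sigma> x - f 0 0 x))))" if "x > 0" for \<tau> \<sigma> x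
    using f0pos[OF that] by (simp add: field_simps)
  have pos: "f \<tau> \<sigma> x > 0" if d: "\<bar>\<tau>\<bar> \<le> e'" "\<bar>\<sigma>\<bar> \<le> e'" "x > 0" for \<tau> \<sigma> x
  proof -
    have "f \<tau> \<sigma> x = f 0 0 x * (1 - - (1 / f 0 0 x * (f \<tau> \<sigma> x - f 0 0 x)))"
      using f0pos[OF d(3)] by (simp add: field_simps)
    moreover have "0 < 1 - - (1 / f 0 0 x * (f \<tau> \<sigma> x - f 0 0 x))" using pser_bound[OF \<phi> d] by linarith
    ultimately show ?thesis using f0pos[OF d(3)] by (metis mult_pos_pos)
  qed
  have "pser e' (\<lambda>\<tau> \<sigma> x. 1 / f \<tau> \<sigma> x) (1 / \<delta> * (1 / (1 - 1 / 2)))"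
    by (rule pser_cong[OF pser_mult[OF e0 inv pser_geometric[OF e0 \<phi>]]]) (simp, rule eq)
  with e' show ?thesis using that pos by blast
qed

lemma local_series_inverse:
  assumes "local_series t0 F" "t0 \<in> {0..1}" "\<delta> > 0" "\<And>x. x > 0 \<Longrightarrow> \<delta> \<le> F t0 x"
  shows "local_series t0 (\<lambda>t x. 1 / F t x)"
proof -
  obtain e f M where 1: "0 < e" "e < 1" "pser e f M"
    "\<And>t \<sigma> x. t \<in> {0..1} \<Longrightarrow> \<bar>t - t0\<bar> \<le> e \<Longrightarrow> \<bar>\<sigma>\<bar> \<le> e \<Longrightarrow> x > 0 \<Longrightarrow> F t ((1 + \<sigma>) * x) = f (t - t0) \<sigma> x"
    using local_seriesE[OF assms(1) zero_less_one] by metis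
  have "\<delta> \<le> f 0 0 x" if "x > 0" for x using 1(4)[of t0 0 x] assms(2) assms(4)[OF that] that 1(1) by simp
  then obtain e' M' where "0 < e'" "e' \<le> e" "pser e' (\<lambda>\<tau> \<sigma> x. 1 / f \<tau> \<sigma> x) M'"
    using pser_inverse[OF 1(3,1) assms(3)] by metis
  then show ?thesis by (intro local_seriesI[of e' _ M']) (use 1 in auto)
qed

lemma local_series_center:
  assumes "local_series t0 F" "t0 \<in> {0..1}"
  shows "continuous_on {0<..} (F t0)" "\<exists>M. \<forall>x>0. \<bar>F t0 x\<bar> \<le> M"
proof -
  obtain e f M where 1: "0 < e" "e < 1" "pser e f M"
    "\<And>t \<sigma> x. t \<in> {0..1} \<Longrightarrow> \<bar>t - t0\<bar> \<le> e \<Longrightarrow> \<bar>\<sigma>\<bar> \<le> e \<Longrightarrow> x > 0 \<Longrightarrow> F t ((1 + \<sigma>) * x) = f (t - t0) \<sigma> x"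
    using local_seriesE[OF assms(1) zero_less_one] by metis
  have eq: "F t0 x = f 0 0 x" if "x > 0" for x using 1(4)[of t0 0 x] assms(2) that 1(1) by simp
  show "continuous_on {0<..} (F t0)"
    by (rule continuous_on_eq[OF pser_center_continuous[OF 1(3)]]) (use eq 1(1) in auto)
  show "\<exists>M. \<forall>x>0. \<bar>F t0 x\<bar> \<le> M" using pser_bound[OF 1(3), of 0 0] 1(1) eq by (intro exI[of _ M]) auto
qed

text \<open>Every factor \<open>s0\<close> can be moved into \<open>x\<close>, so it suffices to expand at \<open>s0 = 1\<close>.\<close>

lemma analytic_C_if_local_series:
  assumes ls: "\<And>t. t \<in> {0..1} \<Longrightarrow> local_series t F"
  shows "analytic_C F"
  unfolding analytic_C_def
proof (intro conjI ballI allI impI)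
  fix t s :: real assume t: "t \<in> {0..1}" and s: "s > 0"
  note c = local_series_center[OF ls[OF t] t]
  obtain M where M: "\<forall>x>0. \<bar>F t x\<bar> \<le> M" using c(2) by blast
  show "bcont (\<lambda>x. F t (s * x))" unfolding bcont_def
  proof
    show "continuous_on {0<..} (\<lambda>x. F t (s * x))"
      by (rule continuous_on_compose2[OF c(1)]) (use s in \<open>auto intro!: continuous_intros\<close>)
    show "bounded ((\<lambda>x. F t (s * x)) ` {0<..})" unfolding bounded_iff
      by (rule exI[of _ M]) (use M s in auto)
  qed
next
  fix t0 s0 :: real assume t0: "t0 \<in> {0..1}" and s0: "s0 > 0"
  obtain e f M where 1: "0 < e" "e < 1" "pser e f M"
    "\<And>t \<sigma> x. t \<in> {0..1} \<Longrightarrow> \<bar>t - t0\<bar> \<le> e \<Longrightarrow> \<bar>\<sigma>\<bar> \<le> e \<Longrightarrow> x > 0 \<Longrightarrow> F t ((1 + \<sigma>) * x) = f (t - t0) \<sigma> x"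
    using local_seriesE[OF ls[OF t0] zero_less_one] by metis
  obtain c :: "nat \<times> nat \<Rightarrow> real \<Rightarrow> real" and B S where
    c: "\<And>p. continuous_on {0<..} (c p)" "\<And>p x. x > 0 \<Longrightarrow> \<bar>c p x\<bar> \<le> B p"
    "((\<lambda>p. B p * e ^ fst p * e ^ snd p) has_sum S) UNIV"
    "\<And>\<tau> \<sigma> x. \<bar>\<tau>\<bar> \<le> e \<Longrightarrow> \<bar>\<sigma>\<bar> \<le> e \<Longrightarrow> x > 0 \<Longrightarrow>
       ((\<lambda>p. c p x * \<tau> ^ fst p * \<sigma> ^ snd p) has_sum f \<tau> \<sigma> x) UNIV"
    by (rule pser_coefficients[OF 1(3,1)]) (rule that)
  have B0: "0 \<le> B p" for p by (rule monomial_bound_nonneg[OF c(2)])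
  \<comment> \<open>With \<open>s = s0 * (1 + \<sigma>)\<close> the point \<open>s * x\<close> is
    \<open>(1 + \<sigma>) * (s0 * x)\<close>, and \<open>\<sigma> = (s - s0) / s0\<close>. So the
    coefficients are evaluated at \<open>s0 * x\<close> and divided by
    \<open>s0 ^ n\<close>.\<close>
  define c' where "c' = (\<lambda>m n x. c (m, n) (s0 * x) / s0 ^ n)"
  have c'b: "\<bar>c' m n x\<bar> \<le> B (m, n) / s0 ^ n" if "x > 0" for m n x
    using c(2)[of "s0 * x" "(m, n)"] s0 that by (simp add: c'_def divide_right_mono)
  have bc: "bcont (c' m n)" for m n unfolding bcont_def
  proof
    have "continuous_on {0<..} (\<lambda>x. c (m, n) (s0 * x))"
      by (rule continuous_on_compose2[OF c(1)]) (use s0 in \<open>auto intro!: continuous_intros\<close>)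
    then show "continuous_on {0<..} (c' m n)"
      unfolding c'_def by (intro continuous_intros) (use s0 in auto)
    show "bounded (c' m n ` {0<..})" unfolding bounded_iff
      by (rule exI[of _ "B (m, n) / s0 ^ n"]) (use c'b in auto)
  qed
  \<comment> \<open>The second bound ensures that \<open>\<sigma>\<close> stays within radius
    \<open>e\<close>.\<close>
  define \<epsilon> where "\<epsilon> = min e (e * s0)"
  show "\<exists>c. \<exists>\<epsilon>>0. (\<forall>m n. bcont (c m n)) \<and>
        (\<forall>t s. t \<in> {0..1} \<longrightarrow> s > 0 \<longrightarrow> \<bar>t - t0\<bar> < \<epsilon> \<longrightarrow> \<bar>s - s0\<bar> < \<epsilon> \<longrightarrow>
           (\<lambda>(m, n). supnorm (c m n) * \<bar>t - t0\<bar> ^ m * \<bar>s - s0\<bar> ^ n) summable_on UNIV \<and>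
           (\<forall>x>0. ((\<lambda>(m, n). c m n x * (t - t0) ^ m * (s - s0) ^ n) has_sum F t (s * x)) UNIV))"
  proof (rule exI[of _ c'], rule exI[of _ \<epsilon>], intro conjI allI impI bc)
    show "\<epsilon> > 0" using 1(1) s0 by (simp add: \<epsilon>_def)
    fix t s :: real assume t: "t \<in> {0..1}" "s > 0" "\<bar>t - t0\<bar> < \<epsilon>" "\<bar>s - s0\<bar> < \<epsilon>"
    define \<sigma> where "\<sigma> = (s - s0) / s0"
    have \<sigma>: "\<bar>\<sigma>\<bar> \<le> e" "s - s0 = \<sigma> * s0" using t(4) s0 by (auto simp: \<sigma>_def \<epsilon>_def abs_divide pos_divide_le_eq)
    have \<tau>: "\<bar>t - t0\<bar> \<le> e" using t(3) by (simp add: \<epsilon>_def)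
    show "(\<lambda>(m, n). supnorm (c' m n) * \<bar>t - t0\<bar> ^ m * \<bar>s - s0\<bar> ^ n) summable_on UNIV"
    proof (rule summable_on_comparison_test[OF has_sum_imp_summable[OF c(3)]])
      fix p :: "nat \<times> nat"
      obtain m n where p: "p = (m, n)" by (cases p)
      have "supnorm (c' m n) * \<bar>t - t0\<bar> ^ m * \<bar>s - s0\<bar> ^ n \<le> B (m, n) / s0 ^ n * e ^ m * (e * s0) ^ n"
        unfolding \<sigma>(2) abs_mult
        by (intro mult_mono power_mono supnorm_le c'b) (use B0 s0 1(1) \<tau> \<sigma>(1) supnorm_nonneg[OF bc] in auto)
      also have "\<dots> = B p * e ^ fst p * e ^ snd p" using s0 by (simp add: p power_mult_distrib)
      finally show "(case p of (m, n) \<Rightarrow> supnorm (c' m n) * \<bar>t - t0\<bar> ^ m * \<bar>s - s0\<bar> ^ n) \<le> B p * e ^ fst p * e ^ snd p"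
        by (simp add: p)
      show "0 \<le> (case p of (m, n) \<Rightarrow> supnorm (c' m n) * \<bar>t - t0\<bar> ^ m * \<bar>s - s0\<bar> ^ n)"
        using supnorm_nonneg[OF bc] by (simp add: p)
    qed
    fix x :: real assume x: "x > 0"
    have "(\<lambda>p. c p (s0 * x) * (t - t0) ^ fst p * \<sigma> ^ snd p) = (\<lambda>(m, n). c' m n x * (t - t0) ^ m * (s - s0) ^ n)"
      using s0 by (auto simp: fun_eq_iff c'_def \<sigma>(2) power_mult_distrib)
    moreover have "F t (s * x) = f (t - t0) \<sigma> (s0 * x)"
    proof -
      have eq: "(1 + \<sigma>) * (s0 * x) = s * x" using s0 by (simp add: \<sigma>_def field_simps)
      have "s0 * x > 0" using s0 x by simp
      from 1(4)[OF t(1) \<tau> \<sigma>(1) this] show ?thesis unfolding eq .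
    qed
    ultimately show "((\<lambda>(m, n). c' m n x * (t - t0) ^ m * (s - s0) ^ n) has_sum F t (s * x)) UNIV"
      using c(4)[OF \<tau> \<sigma>(1), of "s0 * x"] s0 x by simp
  qed
qed

text \<open>Summability at one point with both displacements of size \<open>e\<close> bounds the
  weighted norm, hence gives convergence on a whole polydisc by comparison.\<close>

lemma local_series_if_analytic_C:
  assumes F: "analytic_C F" and t0: "t0 \<in> {0..1}"
  shows "local_series t0 F"
proof -
  have "\<exists>c. \<exists>\<epsilon>>0. (\<forall>m n. bcont (c m n)) \<and>
        (\<forall>t s. t \<in> {0..1} \<longrightarrow> s > 0 \<longrightarrow> \<bar>t - t0\<bar> < \<epsilon> \<longrightarrow> \<bar>s - 1\<bar> < \<epsilon> \<longrightarrow>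
           (\<lambda>(m, n). supnorm (c m n) * \<bar>t - t0\<bar> ^ m * \<bar>s - 1\<bar> ^ n) summable_on UNIV \<and>
           (\<forall>x>0. ((\<lambda>(m, n). c m n x * (t - t0) ^ m * (s - 1) ^ n) has_sum F t (s * x)) UNIV))"
    by (rule F[unfolded analytic_C_def, THEN conjunct2, rule_format, OF t0 zero_less_one])
  then obtain c :: "nat \<Rightarrow> nat \<Rightarrow> real \<Rightarrow> real" and \<epsilon> where \<epsilon>: "\<epsilon> > 0" and bc0: "\<forall>m n. bcont (c m n)"
    and all: "\<forall>t s. t \<in> {0..1} \<longrightarrow> s > 0 \<longrightarrow> \<bar>t - t0\<bar> < \<epsilon> \<longrightarrow> \<bar>s - 1\<bar> < \<epsilon> \<longrightarrow>
           (\<lambda>(m, n). supnorm (c m n) * \<bar>t - t0\<bar> ^ m * \<bar>s - 1\<bar> ^ n) summable_on UNIV \<and>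
           (\<forall>x>0. ((\<lambda>(m, n). c m n x * (t - t0) ^ m * (s - 1) ^ n) has_sum F t (s * x)) UNIV)"
    by (elim exE conjE) (rule that)
  note bc = bc0[rule_format]
  have su: "\<And>t s. t \<in> {0..1} \<Longrightarrow> s > 0 \<Longrightarrow> \<bar>t - t0\<bar> < \<epsilon> \<Longrightarrow> \<bar>s - 1\<bar> < \<epsilon> \<Longrightarrow>
           (\<lambda>(m, n). supnorm (c m n) * \<bar>t - t0\<bar> ^ m * \<bar>s - 1\<bar> ^ n) summable_on UNIV"
    and hs: "\<And>t s x. t \<in> {0..1} \<Longrightarrow> s > 0 \<Longrightarrow> \<bar>t - t0\<bar> < \<epsilon> \<Longrightarrow> \<bar>s - 1\<bar> < \<epsilon> \<Longrightarrow> x > 0 \<Longrightarrow>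
           ((\<lambda>(m, n). c m n x * (t - t0) ^ m * (s - 1) ^ n) has_sum F t (s * x)) UNIV"
    by (rule all[rule_format, THEN conjunct1]; assumption) (rule all[rule_format, THEN conjunct2, rule_format]; assumption)
  define e where "e = min (\<epsilon> / 2) (1 / 2)"
  have e: "0 < e" "e < 1" "e < \<epsilon>" "e \<le> 1 / 2" using \<epsilon> by (auto simp: e_def)
  \<comment> \<open>A time in the unit interval at distance exactly \<open>e\<close> from
    \<open>t0\<close>, on the side with room; \<open>e \<le> 1 / 2\<close> guarantees one. Together
    with the scale \<open>1 + e\<close> it yields the norm of radius \<open>e\<close>.\<close>
  define t1 where "t1 = (if t0 \<le> 1 / 2 then t0 + e else t0 - e)"
  have t1: "t1 \<in> {0..1}" "\<bar>t1 - t0\<bar> = e" using t0 e by (auto simp: t1_def)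
  define h where "h = (\<lambda>p. supnorm (c (fst p) (snd p)) * e ^ fst p * e ^ snd p)"
  have h_sum: "h summable_on UNIV"
    using su[of t1 "1 + e"] t1 e by (simp add: h_def split_beta')
  have bd: "\<bar>c (fst p) (snd p) x * \<tau> ^ fst p * \<sigma> ^ snd p\<bar> \<le> h p" if "\<bar>\<tau>\<bar> \<le> e" "\<bar>\<sigma>\<bar> \<le> e" "x > 0" for \<tau> \<sigma> x p
    unfolding h_def by (rule abs_monomial_le[OF bcontD[OF bc that(3)] that(1,2)])
  define f where "f = (\<lambda>\<tau> \<sigma> x. \<Sum>\<^sub>\<infinity>p. c (fst p) (snd p) x * \<tau> ^ fst p * \<sigma> ^ snd p)"
  have f_sum: "((\<lambda>p. c (fst p) (snd p) x * \<tau> ^ fst p * \<sigma> ^ snd p) has_sum f \<tau> \<sigma> x) UNIV"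
    if d: "\<bar>\<tau>\<bar> \<le> e" "\<bar>\<sigma>\<bar> \<le> e" "x > 0" for \<tau> \<sigma> x
  proof -
    have "(\<lambda>p. norm (c (fst p) (snd p) x * \<tau> ^ fst p * \<sigma> ^ snd p)) summable_on UNIV"
      by (rule Infinite_Sum.abs_summable_on_comparison_test'[OF h_sum]) (use bd[OF d] in simp)
    from Infinite_Sum.abs_summable_summable[OF this] show ?thesis unfolding f_def by (rule has_sum_infsum)
  qed
  \<comment> \<open>\<open>pser\<close> sums over one index, so exponent pairs are
    enumerated.\<close>
  have dec: "((\<lambda>i. g (prod_decode i)) has_sum s) UNIV" if "(g has_sum s) UNIV" for g :: "nat \<times> nat \<Rightarrow> real" and s
    using has_sum_reindex_bij_betw[OF bij_prod_decode, of g s] that by simp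
  have "pser e f (infsum h UNIV)"
  proof (rule pser.series[where F = "\<lambda>i \<tau> \<sigma> x. c (fst (prod_decode i)) (snd (prod_decode i)) x * \<tau> ^ fst (prod_decode i) * \<sigma> ^ snd (prod_decode i)"
        and L = "\<lambda>i. h (prod_decode i)" and S = "infsum h UNIV"])
    fix i
    show "pser e (\<lambda>\<tau> \<sigma> x. c (fst (prod_decode i)) (snd (prod_decode i)) x * \<tau> ^ fst (prod_decode i) * \<sigma> ^ snd (prod_decode i)) (h (prod_decode i))"
      by (rule pser.monomial[OF _ bcontD[OF bc]]) (use bc in \<open>auto simp: h_def bcont_def\<close>)
  next
    show "(\<lambda>i. h (prod_decode i)) sums infsum h UNIV"
      by (rule has_sum_imp_sums[OF dec[OF has_sum_infsum[OF h_sum]]])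
    show "(\<lambda>i. c (fst (prod_decode i)) (snd (prod_decode i)) x * \<tau> ^ fst (prod_decode i) * \<sigma> ^ snd (prod_decode i)) sums f \<tau> \<sigma> x"
      if d: "\<bar>\<tau>\<bar> \<le> e" "\<bar>\<sigma>\<bar> \<le> e" "x > 0" for \<tau> \<sigma> x
      by (rule has_sum_imp_sums[OF dec[OF f_sum[OF d]]])
  qed simp
  then show ?thesis
  proof (rule local_seriesI[OF e(1,2)])
    fix t \<sigma> x :: real assume d: "t \<in> {0..1}" "\<bar>t - t0\<bar> \<le> e" "\<bar>\<sigma>\<bar> \<le> e" "x > 0"
    have "((\<lambda>(m, n). c m n x * (t - t0) ^ m * \<sigma> ^ n) has_sum F t ((1 + \<sigma>) * x)) UNIV"
      using hs[of t "1 + \<sigma>" x] d e by auto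
    moreover have "((\<lambda>(m, n). c m n x * (t - t0) ^ m * \<sigma> ^ n) has_sum f (t - t0) \<sigma> x) UNIV"
      using f_sum[OF d(2-4)] by (simp add: split_beta')
    ultimately show "F t ((1 + \<sigma>) * x) = f (t - t0) \<sigma> x" by (rule has_sum_unique)
  qed
qed

section \<open>The logarithm of the marginal utility\<close>

text \<open>A change of the variable \<open>x\<close> affects the coefficients only, and their
  bounds persist. It carries expansions from \<open>x\<close> to the dual variable
  \<open>y\<close>.\<close>

lemma pser_reparametrize:
  assumes "pser e f M" and J: "continuous_on {0<..} J" "\<And>y. y > 0 \<Longrightarrow> J y > 0"
  shows "pser e (\<lambda>\<tau> \<sigma> y. f \<tau> \<sigma> (J y)) M"
  using assms(1)
proof induction
  case (monomial g B f m n M)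
  have "continuous_on {0<..} (\<lambda>y. g (J y))"
    by (rule continuous_on_compose2[OF monomial(1) J(1)]) (use J(2) in auto)
  then show ?case by (rule pser.monomial[of _ B e _ m n]) (use monomial J(2) in auto)
next
  case (series F L S M f)
  show ?case by (rule pser.series[of e "\<lambda>i \<tau> \<sigma> y. F i \<tau> \<sigma> (J y)" L S]) (use series J(2) in auto)
qed

lemma antiderivative_unique:
  fixes f g :: "real \<Rightarrow> real"
  assumes "convex S" "\<And>s. s \<in> S \<Longrightarrow> (f has_real_derivative d s) (at s within S)"
    "\<And>s. s \<in> S \<Longrightarrow> (g has_real_derivative d s) (at s within S)"
    and "a \<in> S" "b \<in> S"
  shows "f b - g b = f a - g a"
proof -
  have "\<exists>c. \<forall>s\<in>S. f s - g s = c"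
  proof (rule has_field_derivative_zero_constant[OF assms(1)])
    show "((\<lambda>s. f s - g s) has_field_derivative 0) (at s within S)" if "s \<in> S" for s
      using DERIV_diff[OF assms(2,3)[OF that]] by simp
  qed
  then show ?thesis using assms(4,5) by auto
qed

lemma pser_one_plus_inverse:
  assumes "0 \<le> e" "e < 1"
  shows "pser e (\<lambda>\<tau> \<sigma> x. 1 / (1 + \<sigma>)) (1 / (1 - e))"
  using pser_geometric[OF assms(1) pser_minus[OF assms(1) pser_sigma] assms(2)] by simp

text \<open>The Lipschitz property is applied to the substitutions \<open>\<sigma>\<close> and
  0.\<close>

lemma pser_antiderivative_bound:
  assumes e: "0 < e" and zero: "\<And>\<tau> x. \<bar>\<tau>\<bar> \<le> e \<Longrightarrow> x > 0 \<Longrightarrow> F \<tau> 0 x = 0"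
    and lip: "pser_lipschitz e F M"
  shows "pser e F (M * e)"
proof -
  have "pser e (\<lambda>\<tau> \<sigma> x. \<sigma> - 0) e" using pser_sigma by simp
  from lip[unfolded pser_lipschitz_def, rule_format, OF _ order_refl pser_sigma pser_mono[OF pser_zero] this]
  have "pser e (\<lambda>\<tau> \<sigma> x. F \<tau> \<sigma> x - F \<tau> 0 x) (M * e)" using e by simp
  then show ?thesis by (rule pser_cong) (use zero in auto)
qed

lemma pser_ln:
  assumes e: "0 < e" "e < 1"
  obtains L where "pser e (\<lambda>\<tau> \<sigma> x. ln (1 + \<sigma>)) L"
proof -
  obtain F where F: "\<And>\<tau> \<sigma> x. \<bar>\<tau>\<bar> \<le> e \<Longrightarrow> \<bar>\<sigma>\<bar> \<le> e \<Longrightarrow> x > 0 \<Longrightarrow>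
        ((\<lambda>s. F \<tau> s x) has_real_derivative 1 / (1 + \<sigma>)) (at \<sigma> within {-e..e})"
    "\<And>\<tau> x. \<bar>\<tau>\<bar> \<le> e \<Longrightarrow> x > 0 \<Longrightarrow> F \<tau> 0 x = 0"
    "pser_lipschitz e F (1 / (1 - e))"
    by (rule pser_antiderivative[OF pser_one_plus_inverse[OF less_imp_le[OF e(1)] e(2)] e(1)]) (rule that)
  have "pser e F (1 / (1 - e) * e)" by (rule pser_antiderivative_bound[where F = F and M = "1 / (1 - e)", OF e(1) F(2,3)])
  then have "pser e (\<lambda>\<tau> \<sigma> x. ln (1 + \<sigma>)) (1 / (1 - e) * e)"
  proof (rule pser_cong)
    fix \<tau> \<sigma> x :: real assume d: "\<bar>\<tau>\<bar> \<le> e" "\<bar>\<sigma>\<bar> \<le> e" "x > 0"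
    have "F \<tau> \<sigma> x - ln (1 + \<sigma>) = F \<tau> 0 x - ln (1 + 0)"
    proof (rule antiderivative_unique[where S = "{-e..e}" and d = "\<lambda>s. 1 / (1 + s)"])
      show "((\<lambda>s. F \<tau> s x) has_real_derivative 1 / (1 + s)) (at s within {-e..e})" if "s \<in> {-e..e}" for s
        using F(1)[OF d(1) _ d(3)] that by auto
      show "((\<lambda>s. ln (1 + s)) has_real_derivative 1 / (1 + s)) (at s within {-e..e})" if "s \<in> {-e..e}" for s
        using that e by (auto intro!: derivative_eq_intros)
    qed (use d e in auto)
    then show "ln (1 + \<sigma>) = F \<tau> \<sigma> x" using F(2)[OF d(1,3)] by simp
  qed
  then show ?thesis by (rule that)
qed

text \<open>The logarithm of \<open>v\<close> is integrated from \<open>(t0, x)\<close>, first in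
  time, which gives \<open>Q\<close>, then in scale, which gives the term with \<open>a0\<close>.
  Factoring out the central elasticity \<open>a0\<close> leaves \<open>\<Phi>\<close> as a
  perturbation of the identity; the constant 1/4 is what the fixed point argument uses.\<close>

definition log_expansion :: "(real \<Rightarrow> real \<Rightarrow> real) \<Rightarrow> (real \<Rightarrow> real) \<Rightarrow> real \<Rightarrow> real \<Rightarrow>
    (real \<Rightarrow> real \<Rightarrow> real) \<Rightarrow> (real \<Rightarrow> real \<Rightarrow> real \<Rightarrow> real) \<Rightarrow> bool" where
  "log_expansion v a0 t0 e Q \<Phi> \<longleftrightarrow> 0 < e \<and> e < 1 \<and>
     (\<exists>M. pser e (\<lambda>\<tau> \<sigma> x. Q \<tau> x) M) \<and> (\<forall>x>0. Q 0 x = 0) \<and>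
     (\<forall>\<tau> x. \<bar>\<tau>\<bar> \<le> e \<longrightarrow> x > 0 \<longrightarrow> continuous_on {-e..e} (\<lambda>s. \<Phi> \<tau> s x) \<and> \<Phi> \<tau> 0 x = 0) \<and>
     pser_lipschitz e \<Phi> (1 / 4) \<and>
     (\<forall>t\<in>{0..1}. \<forall>\<sigma> x. \<bar>t - t0\<bar> \<le> e \<longrightarrow> \<bar>\<sigma>\<bar> \<le> e \<longrightarrow> x > 0 \<longrightarrow>
        ln (v t ((1 + \<sigma>) * x)) = ln (v t0 x) - Q (t - t0) x - a0 x * (\<sigma> + \<Phi> (t - t0) \<sigma> x))"

lemma log_expansionD:
  assumes "log_expansion v a0 t0 e Q \<Phi>"
  shows "0 < e" "e < 1" "\<exists>M. pser e (\<lambda>\<tau> \<sigma> x. Q \<tau> x) M" "\<And>x. x > 0 \<Longrightarrow> Q 0 x = 0"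
    "\<And>\<tau> x. \<bar>\<tau>\<bar> \<le> e \<Longrightarrow> x > 0 \<Longrightarrow> continuous_on {-e..e} (\<lambda>s. \<Phi> \<tau> s x)"
    "\<And>\<tau> x. \<bar>\<tau>\<bar> \<le> e \<Longrightarrow> x > 0 \<Longrightarrow> \<Phi> \<tau> 0 x = 0" "pser_lipschitz e \<Phi> (1 / 4)"
    "\<And>t \<sigma> x. t \<in> {0..1} \<Longrightarrow> \<bar>t - t0\<bar> \<le> e \<Longrightarrow> \<bar>\<sigma>\<bar> \<le> e \<Longrightarrow> x > 0 \<Longrightarrow>
        ln (v t ((1 + \<sigma>) * x)) = ln (v t0 x) - Q (t - t0) x - a0 x * (\<sigma> + \<Phi> (t - t0) \<sigma> x)"
  using assms unfolding log_expansion_def by simp_all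

text \<open>With \<open>b = a / (1 + \<sigma>)\<close>, the derivative of the logarithm in
  \<open>\<sigma>\<close> is \<open>- b\<close>. The relative deviation
  \<open>\<beta> = (b - a0) / a0\<close> vanishes at the centre, so its norm is small on a small
  polydisc; \<open>\<Phi>\<close> is its primitive.\<close>

lemma log_marginal_series:
  assumes v: "Inada v"
    and dk: "\<And>t x. t \<in> {0..1} \<Longrightarrow> x > 0 \<Longrightarrow> (v t has_real_derivative k t x) (at x)"
    and dt: "\<And>t x. t \<in> {0..1} \<Longrightarrow> x > 0 \<Longrightarrow> ((\<lambda>s. v s x) has_real_derivative vt t x) (at t within {0..1})"
    and a: "local_series t0 (\<lambda>t x. - x * k t x / v t x)" and q: "local_series t0 (\<lambda>t x. - vt t x / v t x)"
    and t0: "t0 \<in> {0..1}" and N: "N > 0" "\<And>x. x > 0 \<Longrightarrow> 1 / N \<le> - x * k t0 x / v t0 x" and e0: "e0 > 0"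
  shows "\<exists>e\<le>e0. \<exists>Q \<Phi>. log_expansion v (\<lambda>x. - x * k t0 x / v t0 x) t0 e Q \<Phi>"
proof -
  define a0 where "a0 = (\<lambda>x. - x * k t0 x / v t0 x)"
  obtain e1 q' Mq where q': "0 < e1" "e1 < 1" "e1 \<le> e0" "pser e1 q' Mq"
    "\<And>t \<sigma> x. t \<in> {0..1} \<Longrightarrow> \<bar>t - t0\<bar> \<le> e1 \<Longrightarrow> \<bar>\<sigma>\<bar> \<le> e1 \<Longrightarrow> x > 0 \<Longrightarrow>
       - vt t ((1 + \<sigma>) * x) / v t ((1 + \<sigma>) * x) = q' (t - t0) \<sigma> x"
    using local_seriesE[OF q e0] by metis
  obtain e2 a' Ma where a': "0 < e2" "e2 < 1" "e2 \<le> e1" "pser e2 a' Ma"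
    "\<And>t \<sigma> x. t \<in> {0..1} \<Longrightarrow> \<bar>t - t0\<bar> \<le> e2 \<Longrightarrow> \<bar>\<sigma>\<bar> \<le> e2 \<Longrightarrow> x > 0 \<Longrightarrow>
       - ((1 + \<sigma>) * x) * k t ((1 + \<sigma>) * x) / v t ((1 + \<sigma>) * x) = a' (t - t0) \<sigma> x"
    using local_seriesE[OF a q'(1)] by metis
  define b where "b = (\<lambda>\<tau> \<sigma> x. a' \<tau> \<sigma> x * (1 / (1 + \<sigma>)))"
  define Mb where "Mb = Ma * (1 / (1 - e2))"
  have b: "pser e2 b Mb" unfolding b_def Mb_def
    by (rule pser_mult[OF _ a'(4) pser_one_plus_inverse]) (use a' in auto)
  have Mb: "0 \<le> Mb" by (rule pser_nonneg[OF b]) (use a' in simp)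
  have b0: "b 0 0 x = a0 x" if "x > 0" for x
    using a'(5)[of t0 0 x] t0 a'(1) that by (simp add: b_def a0_def)
  have a0: "1 / N \<le> a0 x" "a0 x > 0" if "x > 0" for x
  proof -
    show "1 / N \<le> a0 x" using N(2)[OF that] by (simp add: a0_def)
    moreover have "0 < 1 / N" using N(1) by simp
    ultimately show "a0 x > 0" by linarith
  qed
  have a0c: "continuous_on {0<..} a0" unfolding a0_def by (rule local_series_center(1)[OF a t0])
  \<comment> \<open>Brings the norm \<open>N * (e / e2 * Mb)\<close> of \<open>\<beta>\<close> below
    1/4.\<close>
  define e where "e = min e2 (e2 / (4 * N * (Mb + 1)))"
  have e: "0 < e" "e \<le> e2" using a' N(1) Mb by (auto simp: e_def)
  then have e': "e < 1" "e \<le> e1" "e \<le> e0" "0 \<le> e" using a' q' by auto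
  have "e \<le> e2 / (4 * N * (Mb + 1))" by (simp add: e_def)
  then have "e * (4 * N * (Mb + 1)) \<le> e2" using N(1) Mb by (simp add: pos_le_divide_eq)
  moreover have "e * (4 * N * Mb) \<le> e * (4 * N * (Mb + 1))" by (intro mult_left_mono) (use e N(1) in auto)
  ultimately have "e * (4 * N * Mb) \<le> e2" by linarith
  then have small: "N * (e / e2 * Mb) \<le> 1 / 4" using a'(1) by (simp add: field_simps)
  have inv: "pser e (\<lambda>\<tau> \<sigma> x. 1 / a0 x) N"
  proof (rule pser_coeff)
    show "continuous_on {0<..} (\<lambda>x. 1 / a0 x)" by (intro continuous_intros a0c) (use a0 in force)
    show "\<bar>1 / a0 x\<bar> \<le> N" if "x > 0" for x
      using a0[OF that] N(1) by (simp add: pos_divide_le_eq mult.commute)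
  qed
  define \<beta> where "\<beta> = (\<lambda>\<tau> \<sigma> x. 1 / a0 x * (b \<tau> \<sigma> x - b 0 0 x))"
  have \<beta>: "pser e \<beta> (1 / 4)" unfolding \<beta>_def
    by (rule pser_mono[OF pser_mult[OF e'(4) inv pser_diff_center[OF b e'(4) e(2) a'(1)]] small])
  obtain \<Phi> where \<Phi>: "\<And>\<tau> \<sigma> x. \<bar>\<tau>\<bar> \<le> e \<Longrightarrow> \<bar>\<sigma>\<bar> \<le> e \<Longrightarrow> x > 0 \<Longrightarrow>
        ((\<lambda>s. \<Phi> \<tau> s x) has_real_derivative \<beta> \<tau> \<sigma> x) (at \<sigma> within {-e..e})"
    "\<And>\<tau> x. \<bar>\<tau>\<bar> \<le> e \<Longrightarrow> x > 0 \<Longrightarrow> \<Phi> \<tau> 0 x = 0"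
    "pser_lipschitz e \<Phi> (1 / 4)"
    by (rule pser_antiderivative[OF \<beta> e(1)]) (rule that)
  \<comment> \<open>Substituting the zero series freezes \<open>\<sigma>\<close> at 0; the swap then
    puts time into the variable that can be integrated.\<close>
  have z: "pser e (\<lambda>\<tau> \<sigma> x. 0) e" by (rule pser_mono[OF pser_zero e'(4)])
  have qs: "pser e (\<lambda>\<tau> \<sigma> x. q' \<sigma> 0 x) Mq"
    using pser_swap[OF pser_compose[OF pser_shrink[OF q'(4) e'(4,2)] z e'(4) order_refl order_refl]] by simp
  obtain Q' where Q': "\<And>\<tau> \<sigma> x. \<bar>\<tau>\<bar> \<le> e \<Longrightarrow> \<bar>\<sigma>\<bar> \<le> e \<Longrightarrow> x > 0 \<Longrightarrow>
        ((\<lambda>s. Q' \<tau> s x) has_real_derivative q' \<sigma> 0 x) (at \<sigma> within {-e..e})"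
    "\<And>\<tau> x. \<bar>\<tau>\<bar> \<le> e \<Longrightarrow> x > 0 \<Longrightarrow> Q' \<tau> 0 x = 0"
    "pser_lipschitz e Q' Mq"
    by (rule pser_antiderivative[OF qs e(1)]) (rule that)
  define Q where "Q = (\<lambda>\<tau> x. Q' 0 \<tau> x)"
  have "pser e Q' (Mq * e)" by (rule pser_antiderivative_bound[where F = Q' and M = Mq, OF e(1) Q'(2,3)])
  from pser_compose[OF pser_swap[OF this] z e'(4) order_refl order_refl]
  have Q: "pser e (\<lambda>\<tau> \<sigma> x. Q \<tau> x) (Mq * e)" by (simp add: Q_def)
  have vpos: "v t x > 0" if "t \<in> {0..1}" "x > 0" for t x by (rule InadaD(1)[OF v that])
  \<comment> \<open>Both sides have the time derivative \<open>- q\<close>; working within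
    \<open>S\<close> covers the one-sided derivatives at 0 and 1.\<close>
  have id_t: "ln (v t x) = ln (v t0 x) - Q (t - t0) x" if t: "t \<in> {0..1}" "\<bar>t - t0\<bar> \<le> e" and x: "x > 0" for t x
  proof -
    define S where "S = {0..1} \<inter> {t0 - e..t0 + e}"
    have "ln (v t x) - - Q (t - t0) x = ln (v t0 x) - - Q (t0 - t0) x"
    proof (rule antiderivative_unique[where S = S and d = "\<lambda>s. vt s x / v s x"])
      show "convex S" unfolding S_def by (intro convex_Int convex_real_interval)
      fix s assume s: "s \<in> S"
      then have s': "s \<in> {0..1}" "\<bar>s - t0\<bar> \<le> e" by (auto simp: S_def)
      have "((\<lambda>s. v s x) has_real_derivative vt s x) (at s within S)"
        by (rule DERIV_subset[OF dt[OF s'(1) x]]) (auto simp: S_def)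
      then show "((\<lambda>s. ln (v s x)) has_real_derivative vt s x / v s x) (at s within S)"
        using vpos[OF s'(1) x] by (auto intro!: derivative_eq_intros)
      have "((\<lambda>r. Q' 0 r x) has_real_derivative q' (s - t0) 0 x) (at (s - t0) within (\<lambda>r. r - t0) ` S)"
        by (rule DERIV_subset[OF Q'(1)]) (use s' x e in \<open>auto simp: S_def\<close>)
      moreover have "((\<lambda>r. r - t0) has_real_derivative 1) (at s within S)" by (auto intro!: derivative_eq_intros)
      ultimately have "((\<lambda>r. Q' 0 r x) \<circ> (\<lambda>r. r - t0) has_real_derivative q' (s - t0) 0 x * 1) (at s within S)"
        by (rule DERIV_image_chain)
      then have "((\<lambda>r. Q (r - t0) x) has_real_derivative q' (s - t0) 0 x) (at s within S)"
        by (simp add: Q_def o_def)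
      from DERIV_minus[OF this]
      have "((\<lambda>r. - Q (r - t0) x) has_real_derivative - q' (s - t0) 0 x) (at s within S)" .
      moreover have "- q' (s - t0) 0 x = vt s x / v s x"
        using q'(5)[of s 0 x, symmetric] s' x e' q'(1) by simp
      ultimately show "((\<lambda>r. - Q (r - t0) x) has_real_derivative vt s x / v s x) (at s within S)"
        by (simp only:)
    qed (use t t0 e in \<open>auto simp: S_def\<close>)
    then show ?thesis using Q'(2)[of 0 x] x e'(4) by (simp add: Q_def)
  qed
  have id_s: "ln (v t ((1 + \<sigma>) * x)) = ln (v t x) - a0 x * (\<sigma> + \<Phi> (t - t0) \<sigma> x)"
    if t: "t \<in> {0..1}" "\<bar>t - t0\<bar> \<le> e" and \<sigma>: "\<bar>\<sigma>\<bar> \<le> e" and x: "x > 0" for t \<sigma> x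
  proof -
    have "ln (v t ((1 + \<sigma>) * x)) - - (a0 x * (\<sigma> + \<Phi> (t - t0) \<sigma> x)) =
        ln (v t ((1 + 0) * x)) - - (a0 x * (0 + \<Phi> (t - t0) 0 x))"
    proof (rule antiderivative_unique[where S = "{-e..e}" and d = "\<lambda>s. - b (t - t0) s x"])
      fix s assume s: "s \<in> {-e..e}"
      then have s': "\<bar>s\<bar> \<le> e" "1 + s > 0" using e' by auto
      have pos: "(1 + s) * x > 0" using s' x by simp
      have "((\<lambda>s. v t ((1 + s) * x)) has_real_derivative k t ((1 + s) * x) * x) (at s)"
        by (rule DERIV_chain2[where f = "v t" and g = "\<lambda>s. (1 + s) * x", OF dk[OF t(1) pos]])
          (auto intro!: derivative_eq_intros)
      then have "((\<lambda>s. ln (v t ((1 + s) * x))) has_real_derivative k t ((1 + s) * x) * x / v t ((1 + s) * x)) (at s)"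
        using vpos[OF t(1) pos] by (auto intro!: derivative_eq_intros)
      moreover have "- b (t - t0) s x = k t ((1 + s) * x) * x / v t ((1 + s) * x)"
        using a'(5)[of t s x, symmetric] t s' x e vpos[OF t(1) pos] by (simp add: b_def field_simps)
      ultimately show "((\<lambda>s. ln (v t ((1 + s) * x))) has_real_derivative - b (t - t0) s x) (at s within {-e..e})"
        using has_field_derivative_at_within by metis
      have "((\<lambda>s. - (a0 x * (s + \<Phi> (t - t0) s x))) has_real_derivative - (a0 x * (1 + \<beta> (t - t0) s x))) (at s within {-e..e})"
        by (intro DERIV_minus DERIV_cmult DERIV_add DERIV_ident \<Phi>(1)) (use t s' x in auto)
      moreover have "a0 x * (1 + \<beta> (t - t0) s x) = b (t - t0) s x"
        using a0(2)[OF x] b0[OF x] by (simp add: \<beta>_def field_simps)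
      ultimately show "((\<lambda>s. - (a0 x * (s + \<Phi> (t - t0) s x))) has_real_derivative - b (t - t0) s x) (at s within {-e..e})"
        by simp
    qed (use \<sigma> e in auto)
    then show ?thesis using \<Phi>(2)[OF t(2) x] by simp
  qed
  have \<Phi>c: "continuous_on {-e..e} (\<lambda>s. \<Phi> \<tau> s x)" if "\<bar>\<tau>\<bar> \<le> e" "x > 0" for \<tau> x
    by (rule DERIV_continuous_on[where D = "\<lambda>s. \<beta> \<tau> s x"]) (use \<Phi>(1)[OF that(1) _ that(2)] in auto)
  have Q0: "Q 0 x = 0" if "x > 0" for x using Q'(2)[of 0 x] that e'(4) by (simp add: Q_def)
  have id: "ln (v t ((1 + \<sigma>) * x)) = ln (v t0 x) - Q (t - t0) x - a0 x * (\<sigma> + \<Phi> (t - t0) \<sigma> x)"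
    if "t \<in> {0..1}" "\<bar>t - t0\<bar> \<le> e" "\<bar>\<sigma>\<bar> \<le> e" "x > 0" for t \<sigma> x
    using id_s[OF that] id_t[OF that(1,2,4)] by simp
  have "log_expansion v a0 t0 e Q \<Phi>"
    unfolding log_expansion_def
  proof (intro conjI ballI allI impI)
    show "\<exists>M. pser e (\<lambda>\<tau> \<sigma> x. Q \<tau> x) M" using Q by blast
  qed (use e(1) e'(1) Q0 \<Phi>c \<Phi>(2,3) id in simp_all)
  then show ?thesis using e'(3) unfolding a0_def by blast
qed

text \<open>Picard iteration for \<open>w = R - \<Phi> w\<close> in the weighted norm.\<close>

lemma pser_fixpoint:
  assumes e: "0 < e" "0 \<le> e'" "e' \<le> e" and R: "pser e' R (e / 2)"
    and cont: "\<And>\<tau> x. \<bar>\<tau>\<bar> \<le> e \<Longrightarrow> x > 0 \<Longrightarrow> continuous_on {-e..e} (\<lambda>s. \<Phi> \<tau> s x)"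
    and zero: "\<And>\<tau> x. \<bar>\<tau>\<bar> \<le> e \<Longrightarrow> x > 0 \<Longrightarrow> \<Phi> \<tau> 0 x = 0"
    and lip: "pser_lipschitz e \<Phi> (1 / 4)"
  obtains w where "pser e' w e"
    "\<And>\<tau> \<sigma> x. \<bar>\<tau>\<bar> \<le> e' \<Longrightarrow> \<bar>\<sigma>\<bar> \<le> e' \<Longrightarrow> x > 0 \<Longrightarrow> w \<tau> \<sigma> x = R \<tau> \<sigma> x - \<Phi> \<tau> (w \<tau> \<sigma> x) x"
proof -
  define W where "W = rec_nat (\<lambda>\<tau> \<sigma> x. 0) (\<lambda>_ w \<tau> \<sigma> x. R \<tau> \<sigma> x - \<Phi> \<tau> (w \<tau> \<sigma> x) x)"
  have W0: "W 0 = (\<lambda>\<tau> \<sigma> x. 0)" by (simp add: W_def)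
  have WS: "W (Suc n) = (\<lambda>\<tau> \<sigma> x. R \<tau> \<sigma> x - \<Phi> \<tau> (W n \<tau> \<sigma> x) x)" for n by (simp add: W_def)
  have z: "pser e' (\<lambda>\<tau> \<sigma> x. 0) e" by (rule pser_mono[OF pser_zero]) (use e in simp)
  have We: "pser e' (W n) e" for n
  proof (induction n)
    case 0 then show ?case using z by (simp add: W0)
  next
    case (Suc n)
    have "pser e' (\<lambda>\<tau> \<sigma> x. W n \<tau> \<sigma> x - 0) e" using Suc by simp
    \<comment> \<open>The contributions \<open>e / 2\<close> of \<open>R\<close> and
      \<open>e / 4\<close> of \<open>\<Phi>\<close> keep the iterate in the ball of radius
      \<open>e\<close>.\<close>
    from pser_diff[OF e(2) R lip[unfolded pser_lipschitz_def, rule_format, OF e(2,3) Suc z this]]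
    have "pser e' (\<lambda>\<tau> \<sigma> x. R \<tau> \<sigma> x - (\<Phi> \<tau> (W n \<tau> \<sigma> x) x - \<Phi> \<tau> 0 x)) (e / 2 + 1 / 4 * e)" .
    then have "pser e' (\<lambda>\<tau> \<sigma> x. R \<tau> \<sigma> x - (\<Phi> \<tau> (W n \<tau> \<sigma> x) x - \<Phi> \<tau> 0 x)) e"
      by (rule pser_mono) (use e in simp)
    then show ?case unfolding WS by (rule pser_cong) (use zero e in auto)
  qed
  have D: "pser e' (\<lambda>\<tau> \<sigma> x. W (Suc n) \<tau> \<sigma> x - W n \<tau> \<sigma> x) ((1 / 4) ^ n * (e / 2))" for n
  proof (induction n)
    case 0
    show ?case by (rule pser_cong[OF pser_mono[OF R]]) (use zero e in \<open>auto simp: WS W0\<close>)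
  next
    case (Suc n)
    from pser_minus[OF e(2) lip[unfolded pser_lipschitz_def, rule_format, OF e(2,3) We We Suc]]
    have "pser e' (\<lambda>\<tau> \<sigma> x. - (\<Phi> \<tau> (W (Suc n) \<tau> \<sigma> x) x - \<Phi> \<tau> (W n \<tau> \<sigma> x) x)) (1 / 4 * ((1 / 4) ^ n * (e / 2)))" .
    then have "pser e' (\<lambda>\<tau> \<sigma> x. - (\<Phi> \<tau> (W (Suc n) \<tau> \<sigma> x) x - \<Phi> \<tau> (W n \<tau> \<sigma> x) x)) ((1 / 4) ^ Suc n * (e / 2))"
      by (rule pser_mono) simp
    then show ?case by (rule pser_cong) (simp add: WS[of "Suc n"] WS[of n])
  qed
  \<comment> \<open>The telescoping series of the iterates; its geometric bound sums to two thirds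
    of \<open>e\<close>.\<close>
  define w where "w = (\<lambda>\<tau> \<sigma> x. \<Sum>n. W (Suc n) \<tau> \<sigma> x - W n \<tau> \<sigma> x)"
  have geo: "(\<lambda>n. (1 / 4) ^ n * (e / 2)) sums (1 / (1 - 1 / 4) * (e / 2))"
    by (rule sums_mult2[OF geometric_sums]) simp
  have sm: "summable (\<lambda>n. W (Suc n) \<tau> \<sigma> x - W n \<tau> \<sigma> x)" if "\<bar>\<tau>\<bar> \<le> e'" "\<bar>\<sigma>\<bar> \<le> e'" "x > 0" for \<tau> \<sigma> x
    by (rule summable_comparison_test'[OF sums_summable[OF geo]]) (use pser_bound[OF D that] in auto)
  have w: "pser e' w e"
  proof (rule pser.series[OF D geo])
    show "1 / (1 - 1 / 4) * (e / 2) \<le> e" using e by simp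
    show "(\<lambda>n. W (Suc n) \<tau> \<sigma> x - W n \<tau> \<sigma> x) sums w \<tau> \<sigma> x" if "\<bar>\<tau>\<bar> \<le> e'" "\<bar>\<sigma>\<bar> \<le> e'" "x > 0" for \<tau> \<sigma> x
      unfolding w_def by (rule summable_sums[OF sm[OF that]])
  qed
  show ?thesis
  proof (rule that[OF w])
    fix \<tau> \<sigma> x :: real assume d: "\<bar>\<tau>\<bar> \<le> e'" "\<bar>\<sigma>\<bar> \<le> e'" "x > 0"
    have "(\<lambda>n. \<Sum>i<n. W (Suc i) \<tau> \<sigma> x - W i \<tau> \<sigma> x) \<longlonglongrightarrow> w \<tau> \<sigma> x"
      using summable_LIMSEQ[OF sm[OF d]] by (simp add: w_def)
    moreover have "(\<Sum>i<n. W (Suc i) \<tau> \<sigma> x - W i \<tau> \<sigma> x) = W n \<tau> \<sigma> x" for n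
      using sum_lessThan_telescope[of "\<lambda>i. W i \<tau> \<sigma> x" n] by (simp add: W0)
    ultimately have lim: "(\<lambda>n. W n \<tau> \<sigma> x) \<longlonglongrightarrow> w \<tau> \<sigma> x" by simp
    \<comment> \<open>Pointwise continuity of \<open>\<Phi>\<close> in its second argument passes
      the recursion to the limit.\<close>
    have c: "continuous_on {-e..e} (\<lambda>s. \<Phi> \<tau> s x)" by (rule cont) (use d e in auto)
    have "W n \<tau> \<sigma> x \<in> {-e..e}" for n using pser_bound[OF We d, of n] by auto
    moreover have "w \<tau> \<sigma> x \<in> {-e..e}" using pser_bound[OF w d] by auto
    ultimately have "(\<lambda>n. \<Phi> \<tau> (W n \<tau> \<sigma> x) x) \<longlonglongrightarrow> \<Phi> \<tau> (w \<tau> \<sigma> x) x"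
      by (intro continuous_on_tendsto_compose[OF c lim] always_eventually allI)
    then have "(\<lambda>n. W (Suc n) \<tau> \<sigma> x) \<longlonglongrightarrow> R \<tau> \<sigma> x - \<Phi> \<tau> (w \<tau> \<sigma> x) x"
      unfolding WS by (intro tendsto_intros)
    with LIMSEQ_Suc[OF lim] show "w \<tau> \<sigma> x = R \<tau> \<sigma> x - \<Phi> \<tau> (w \<tau> \<sigma> x) x" by (rule LIMSEQ_unique)
  qed
qed

text \<open>Points near \<open>(t0, x0)\<close> have small \<open>t - t0\<close> and small relative
  displacement from \<open>x0\<close>, and there the series differs little from its constant term.
  This recovers joint continuity of \<open>u_xx\<close> and \<open>u_xt\<close> from the analytic
  ratios.\<close>

lemma local_series_continuous:
  assumes "\<And>t. t \<in> {0..1} \<Longrightarrow> local_series t F"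
  shows "continuous_on Dom (\<lambda>p. F (fst p) (snd p))"
  unfolding continuous_on_iff
proof (intro ballI allI impI)
  fix p and \<epsilon> :: real assume p: "p \<in> Dom" and \<epsilon>: "0 < \<epsilon>"
  obtain t0 x0 where p0: "p = (t0, x0)" "t0 \<in> {0..1}" "x0 > 0" using p by (cases p) auto
  obtain e f M where 1: "0 < e" "e < 1" "pser e f M"
    "\<And>t \<sigma> x. t \<in> {0..1} \<Longrightarrow> \<bar>t - t0\<bar> \<le> e \<Longrightarrow> \<bar>\<sigma>\<bar> \<le> e \<Longrightarrow> x > 0 \<Longrightarrow> F t ((1 + \<sigma>) * x) = f (t - t0) \<sigma> x"
    using local_seriesE[OF assms[OF p0(2)] zero_less_one] by metis
  have M: "0 \<le> M" by (rule pser_nonneg[OF 1(3)]) (use 1 in simp)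
  define e' where "e' = min e (e * \<epsilon> / (2 * (M + 1)))"
  have e': "0 < e'" "e' \<le> e" using 1(1) \<epsilon> M by (auto simp: e'_def)
  have "e' \<le> e * \<epsilon> / (2 * (M + 1))" by (simp add: e'_def)
  then have "e' * (2 * (M + 1)) \<le> e * \<epsilon>" using M by (simp add: pos_le_divide_eq)
  moreover have "e' * M \<le> e' * (M + 1)" using e' by simp
  ultimately have "e' * M < e * \<epsilon>" using mult_pos_pos[OF 1(1) \<epsilon>] by linarith
  then have small: "e' / e * M < \<epsilon>" using 1(1) by (simp add: divide_less_eq mult.commute)
  define d where "d = min e' (e' * x0)"
  show "\<exists>d>0. \<forall>q\<in>Dom. dist q p < d \<longrightarrow> dist (F (fst q) (snd q)) (F (fst p) (snd p)) < \<epsilon>"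
  proof (intro exI[of _ d] conjI ballI impI)
    show "0 < d" using e' p0 by (simp add: d_def)
    fix q assume q: "q \<in> Dom" "dist q p < d"
    obtain t x where tx: "q = (t, x)" "t \<in> {0..1}" "x > 0" using q by (cases q) auto
    have "\<bar>t - t0\<bar> < d" "\<bar>x - x0\<bar> < d"
      using q(2) dist_fst_le[of q p] dist_snd_le[of q p] by (auto simp: tx p0 dist_real_def)
    then have \<tau>: "\<bar>t - t0\<bar> \<le> e'" and x: "\<bar>x - x0\<bar> \<le> e' * x0" by (auto simp: d_def)
    define \<sigma> where "\<sigma> = (x - x0) / x0"
    have \<sigma>: "\<bar>\<sigma>\<bar> \<le> e'" "(1 + \<sigma>) * x0 = x"
      using x p0(3) by (auto simp: \<sigma>_def abs_divide pos_divide_le_eq field_simps)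
    have "F t x = f (t - t0) \<sigma> x0" using 1(4)[of t \<sigma> x0] tx \<tau> \<sigma> e' p0 by auto
    moreover have "F t0 x0 = f 0 0 x0" using 1(4)[of t0 0 x0] p0 1(1) by simp
    moreover have "\<bar>f (t - t0) \<sigma> x0 - f 0 0 x0\<bar> \<le> e' / e * M"
      by (rule pser_bound[OF pser_diff_center[OF 1(3) less_imp_le[OF e'(1)] e'(2) 1(1)] \<tau> \<sigma>(1) p0(3)])
    ultimately show "dist (F (fst q) (snd q)) (F (fst p) (snd p)) < \<epsilon>"
      using small by (simp add: tx p0 dist_real_def)
  qed
qed

text \<open>The substitute for \<open>local_series\<close> when a function is unbounded in
  \<open>x\<close>, as a marginal utility is: only the growth factor relative to the centre has
  bounded coefficients.\<close>

definition local_ratio :: "real \<Rightarrow> (real \<Rightarrow> real \<Rightarrow> real) \<Rightarrow> bool" where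
  "local_ratio t0 W \<longleftrightarrow> (\<exists>e E M. 0 < e \<and> e < 1 \<and> pser e E M \<and>
     (\<forall>t\<in>{0..1}. \<forall>\<sigma> x. \<bar>t - t0\<bar> \<le> e \<longrightarrow> \<bar>\<sigma>\<bar> \<le> e \<longrightarrow> x > 0 \<longrightarrow>
        W t ((1 + \<sigma>) * x) = W t0 x * E (t - t0) \<sigma> x))"

lemma local_ratioI:
  assumes "0 < e" "e < 1" "pser e E M"
    "\<And>t \<sigma> x. t \<in> {0..1} \<Longrightarrow> \<bar>t - t0\<bar> \<le> e \<Longrightarrow> \<bar>\<sigma>\<bar> \<le> e \<Longrightarrow> x > 0 \<Longrightarrow> W t ((1 + \<sigma>) * x) = W t0 x * E (t - t0) \<sigma> x"
  shows "local_ratio t0 W"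
  using assms unfolding local_ratio_def by blast

lemma local_ratioE:
  assumes "local_ratio t0 W" "0 < e0"
  obtains e E M where "0 < e" "e < 1" "e \<le> e0" "pser e E M"
    "\<And>t \<sigma> x. t \<in> {0..1} \<Longrightarrow> \<bar>t - t0\<bar> \<le> e \<Longrightarrow> \<bar>\<sigma>\<bar> \<le> e \<Longrightarrow> x > 0 \<Longrightarrow> W t ((1 + \<sigma>) * x) = W t0 x * E (t - t0) \<sigma> x"
proof -
  from assms(1) obtain e E M where e: "0 < e" "e < 1" "pser e E M"
    "\<And>t \<sigma> x. t \<in> {0..1} \<Longrightarrow> \<bar>t - t0\<bar> \<le> e \<Longrightarrow> \<bar>\<sigma>\<bar> \<le> e \<Longrightarrow> x > 0 \<Longrightarrow> W t ((1 + \<sigma>) * x) = W t0 x * E (t - t0) \<sigma> x"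
    unfolding local_ratio_def by blast
  show ?thesis
    by (rule that[of "min e e0" E M]) (use e assms(2) in \<open>auto intro: pser_shrink\<close>)
qed

lemma local_ratio_cong:
  assumes "local_ratio t0 W" "t0 \<in> {0..1}" "\<And>t x. t \<in> {0..1} \<Longrightarrow> x > 0 \<Longrightarrow> W' t x = W t x"
  shows "local_ratio t0 W'"
proof -
  obtain e E M where e: "0 < e" "e < 1" "pser e E M"
    "\<And>t \<sigma> x. t \<in> {0..1} \<Longrightarrow> \<bar>t - t0\<bar> \<le> e \<Longrightarrow> \<bar>\<sigma>\<bar> \<le> e \<Longrightarrow> x > 0 \<Longrightarrow> W t ((1 + \<sigma>) * x) = W t0 x * E (t - t0) \<sigma> x"
    using local_ratioE[OF assms(1) zero_less_one] by metis
  show ?thesis by (rule local_ratioI[OF e(1-3)]) (use e assms(2,3) in auto)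
qed

lemma local_ratio_mult:
  assumes "local_ratio t0 W" "local_ratio t0 V"
  shows "local_ratio t0 (\<lambda>t x. W t x * V t x)"
proof -
  obtain e1 f1 M1 where 1: "0 < e1" "e1 < 1" "pser e1 f1 M1"
    "\<And>t \<sigma> x. t \<in> {0..1} \<Longrightarrow> \<bar>t - t0\<bar> \<le> e1 \<Longrightarrow> \<bar>\<sigma>\<bar> \<le> e1 \<Longrightarrow> x > 0 \<Longrightarrow> W t ((1 + \<sigma>) * x) = W t0 x * f1 (t - t0) \<sigma> x"
    using local_ratioE[OF assms(1) zero_less_one] by metis
  obtain e f M where 2: "0 < e" "e < 1" "e \<le> e1" "pser e f M"
    "\<And>t \<sigma> x. t \<in> {0..1} \<Longrightarrow> \<bar>t - t0\<bar> \<le> e \<Longrightarrow> \<bar>\<sigma>\<bar> \<le> e \<Longrightarrow> x > 0 \<Longrightarrow> V t ((1 + \<sigma>) * x) = V t0 x * f (t - t0) \<sigma> x"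
    using local_ratioE[OF assms(2) 1(1)] by metis
  show ?thesis
    by (rule local_ratioI[OF 2(1,2) pser_mult[OF _ pser_shrink[OF 1(3) _ 2(3)] 2(4)]])
      (use 1 2 in auto)
qed

lemma local_ratio_if_local_series:
  assumes F: "local_series t0 F" and t0: "t0 \<in> {0..1}" and \<delta>: "\<delta> > 0" "\<And>x. x > 0 \<Longrightarrow> \<delta> \<le> F t0 x"
  shows "local_ratio t0 F"
proof -
  obtain e f M where 1: "0 < e" "e < 1" "pser e f M"
    "\<And>t \<sigma> x. t \<in> {0..1} \<Longrightarrow> \<bar>t - t0\<bar> \<le> e \<Longrightarrow> \<bar>\<sigma>\<bar> \<le> e \<Longrightarrow> x > 0 \<Longrightarrow> F t ((1 + \<sigma>) * x) = f (t - t0) \<sigma> x"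
    using local_seriesE[OF F zero_less_one] by metis
  have pos: "F t0 x > 0" if "x > 0" for x using \<delta>(2)[OF that] \<delta>(1) by simp
  have "pser e (\<lambda>\<tau> \<sigma> x. 1 / F t0 x) (1 / \<delta>)"
  proof (rule pser_coeff)
    show "continuous_on {0<..} (\<lambda>x. 1 / F t0 x)"
      by (intro continuous_intros local_series_center(1)[OF F t0]) (use pos in force)
    show "\<bar>1 / F t0 x\<bar> \<le> 1 / \<delta>" if "x > 0" for x
      using \<delta>(2)[OF that] \<delta>(1) by (simp add: frac_le)
  qed
  from pser_mult[OF _ this 1(3)] have "pser e (\<lambda>\<tau> \<sigma> x. 1 / F t0 x * f \<tau> \<sigma> x) (1 / \<delta> * M)" using 1(1) by simp
  then show ?thesis
    by (rule local_ratioI[OF 1(1,2)]) (use 1(4) pos in \<open>force simp: less_imp_neq[symmetric]\<close>)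
qed

lemma local_ratio_reciprocal: "local_ratio t0 (\<lambda>t x. 1 / x)"
  by (rule local_ratioI[OF _ _ pser_one_plus_inverse[of "1 / 2"]]) auto

text \<open>Numerator and denominator are divided by the sum \<open>S\<close> of the central values.
  The quotients by \<open>S\<close> lie between 0 and 1, hence are admissible coefficients, and the
  normalised denominator equals 1 at the centre, hence is invertible.\<close>

lemma local_series_weight:
  assumes W1: "local_ratio t0 W1" and W2: "local_ratio t0 W2" and t0: "t0 \<in> {0..1}"
    and c: "continuous_on {0<..} (W1 t0)" "continuous_on {0<..} (W2 t0)"
    and pos: "\<And>x. x > 0 \<Longrightarrow> W1 t0 x > 0" "\<And>x. x > 0 \<Longrightarrow> W2 t0 x > 0"
  shows "local_series t0 (\<lambda>t x. W1 t x / (W1 t x + W2 t x))"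
proof -
  obtain e1 E1 M1 where 1: "0 < e1" "e1 < 1" "pser e1 E1 M1"
    "\<And>t \<sigma> x. t \<in> {0..1} \<Longrightarrow> \<bar>t - t0\<bar> \<le> e1 \<Longrightarrow> \<bar>\<sigma>\<bar> \<le> e1 \<Longrightarrow> x > 0 \<Longrightarrow> W1 t ((1 + \<sigma>) * x) = W1 t0 x * E1 (t - t0) \<sigma> x"
    using local_ratioE[OF W1 zero_less_one] by metis
  obtain e E2 M2 where 2: "0 < e" "e < 1" "e \<le> e1" "pser e E2 M2"
    "\<And>t \<sigma> x. t \<in> {0..1} \<Longrightarrow> \<bar>t - t0\<bar> \<le> e \<Longrightarrow> \<bar>\<sigma>\<bar> \<le> e \<Longrightarrow> x > 0 \<Longrightarrow> W2 t ((1 + \<sigma>) * x) = W2 t0 x * E2 (t - t0) \<sigma> x"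
    using local_ratioE[OF W2 1(1)] by metis
  have e0: "0 \<le> e" using 2 by simp
  define S where "S = (\<lambda>x. W1 t0 x + W2 t0 x)"
  have S: "S x > 0" if "x > 0" for x using pos[OF that] by (simp add: S_def)
  have Sc: "continuous_on {0<..} S" unfolding S_def by (intro continuous_intros c)
  have w1: "pser e (\<lambda>\<tau> \<sigma> x. W1 t0 x / S x) 1"
  proof (rule pser_coeff)
    show "continuous_on {0<..} (\<lambda>x. W1 t0 x / S x)" by (intro continuous_intros c Sc) (use S in force)
    show "\<bar>W1 t0 x / S x\<bar> \<le> 1" if "x > 0" for x using pos[OF that] by (simp add: S_def)
  qed
  have w2: "pser e (\<lambda>\<tau> \<sigma> x. W2 t0 x / S x) 1"
  proof (rule pser_coeff)
    show "continuous_on {0<..} (\<lambda>x. W2 t0 x / S x)" by (intro continuous_intros c Sc) (use S in force)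
    show "\<bar>W2 t0 x / S x\<bar> \<le> 1" if "x > 0" for x using pos[OF that] by (simp add: S_def)
  qed
  define A where "A = (\<lambda>\<tau> \<sigma> x. W1 t0 x / S x * E1 \<tau> \<sigma> x)"
  define D where "D = (\<lambda>\<tau> \<sigma> x. W1 t0 x / S x * E1 \<tau> \<sigma> x + W2 t0 x / S x * E2 \<tau> \<sigma> x)"
  have A: "pser e A (1 * M1)" unfolding A_def by (intro pser_mult[OF e0] w1 pser_shrink[OF 1(3) e0 2(3)])
  have D: "pser e D (1 * M1 + 1 * M2)" unfolding D_def
    by (intro pser_add pser_mult[OF e0] w1 w2 pser_shrink[OF 1(3) e0 2(3)] 2(4))
  have "1 \<le> D 0 0 x" if "x > 0" for x
  proof -
    have "E1 0 0 x = 1" using 1(4)[of t0 0 x] t0 1(1) pos(1)[OF that] that by simp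
    moreover have "E2 0 0 x = 1" using 2(5)[of t0 0 x] t0 2(1) pos(2)[OF that] that by simp
    moreover have "W1 t0 x / S x + W2 t0 x / S x = 1"
      using S[OF that] by (simp add: S_def add_divide_distrib[symmetric])
    ultimately show ?thesis by (simp add: D_def)
  qed
  from pser_inverse[OF D 2(1) zero_less_one this] obtain e' M' where e': "0 < e'" "e' \<le> e"
    "pser e' (\<lambda>\<tau> \<sigma> x. 1 / D \<tau> \<sigma> x) M'" by metis
  have "pser e' (\<lambda>\<tau> \<sigma> x. A \<tau> \<sigma> x * (1 / D \<tau> \<sigma> x)) (1 * M1 * M')"
    by (intro pser_mult e' pser_shrink[OF A _ e'(2)]) (use e' in auto)
  note ps = this
  have lt1: "e' < 1" using e' 2 by simp
  show ?thesis
  proof (rule local_seriesI[OF e'(1) lt1 ps])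
    fix t \<sigma> x :: real assume d: "t \<in> {0..1}" "\<bar>t - t0\<bar> \<le> e'" "\<bar>\<sigma>\<bar> \<le> e'" "x > 0"
    have x: "W1 t ((1 + \<sigma>) * x) = W1 t0 x * E1 (t - t0) \<sigma> x" "W2 t ((1 + \<sigma>) * x) = W2 t0 x * E2 (t - t0) \<sigma> x"
      using 1(4)[of t \<sigma> x] 2(5)[of t \<sigma> x] d e' 2(3) by auto
    have "D (t - t0) \<sigma> x = (W1 t0 x * E1 (t - t0) \<sigma> x + W2 t0 x * E2 (t - t0) \<sigma> x) / S x"
      by (simp add: D_def add_divide_distrib)
    then show "W1 t ((1 + \<sigma>) * x) / (W1 t ((1 + \<sigma>) * x) + W2 t ((1 + \<sigma>) * x)) = A (t - t0) \<sigma> x * (1 / D (t - t0) \<sigma> x)"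
      using S[OF d(4)] by (simp add: x A_def)
  qed
qed

text \<open>The expansion of the logarithm is exponentiated; its increment from the centre has
  bounded coefficients although \<open>v\<close> itself is unbounded.\<close>

lemma local_ratio_marginal:
  assumes v: "Inada v"
    and dk: "\<And>t x. t \<in> {0..1} \<Longrightarrow> x > 0 \<Longrightarrow> (v t has_real_derivative k t x) (at x)"
    and dt: "\<And>t x. t \<in> {0..1} \<Longrightarrow> x > 0 \<Longrightarrow> ((\<lambda>s. v s x) has_real_derivative vt t x) (at t within {0..1})"
    and a: "local_series t0 (\<lambda>t x. - x * k t x / v t x)" and q: "local_series t0 (\<lambda>t x. - vt t x / v t x)"
    and t0: "t0 \<in> {0..1}" and N: "N > 0" "\<And>x. x > 0 \<Longrightarrow> 1 / N \<le> - x * k t0 x / v t0 x"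
  shows "local_ratio t0 v"
proof -
  define a0 where "a0 = (\<lambda>x. - x * k t0 x / v t0 x)"
  obtain e Q \<Phi> where x: "log_expansion v a0 t0 e Q \<Phi>"
    using log_marginal_series[OF v dk dt a q t0 N zero_less_one] unfolding a0_def by blast
  note e = log_expansionD(1,2)[OF x] and ln = log_expansionD(8)[OF x]
  obtain MQ where Q: "pser e (\<lambda>\<tau> \<sigma> x. Q \<tau> x) MQ" using log_expansionD(3)[OF x] by blast
  have e0: "0 \<le> e" using e by simp
  have \<Phi>: "pser e \<Phi> (1 / 4 * e)"
    by (rule pser_antiderivative_bound[where F = \<Phi> and M = "1 / 4", OF e(1) log_expansionD(6,7)[OF x]])
  obtain A where A: "\<forall>x>0. \<bar>a0 x\<bar> \<le> A" using local_series_center(2)[OF a t0] unfolding a0_def by blast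
  have a0: "pser e (\<lambda>\<tau> \<sigma> x. a0 x) A"
    by (rule pser_coeff) (use A local_series_center(1)[OF a t0] in \<open>auto simp: a0_def\<close>)
  have "pser e (\<lambda>\<tau> \<sigma> x. exp (- (Q \<tau> x + a0 x * (\<sigma> + \<Phi> \<tau> \<sigma> x)))) (exp (MQ + A * (e + 1 / 4 * e)))"
    by (intro pser_exp[OF e0] pser_minus[OF e0] pser_add pser_mult[OF e0] Q a0 \<Phi> pser_sigma)
  then show ?thesis
  proof (rule local_ratioI[OF e])
    fix t \<sigma> x :: real assume d: "t \<in> {0..1}" "\<bar>t - t0\<bar> \<le> e" "\<bar>\<sigma>\<bar> \<le> e" "x > 0"
    have "(1 + \<sigma>) * x > 0" using d e by simp
    then have "v t ((1 + \<sigma>) * x) = exp (ln (v t ((1 + \<sigma>) * x)))" using InadaD(1)[OF v d(1)] by simp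
    also have "\<dots> = exp (ln (v t0 x)) * exp (- (Q (t - t0) x + a0 x * (\<sigma> + \<Phi> (t - t0) \<sigma> x)))"
      unfolding ln[OF d] exp_add[symmetric] by (simp add: algebra_simps)
    also have "exp (ln (v t0 x)) = v t0 x" using InadaD(1)[OF v t0 d(4)] by simp
    finally show "v t ((1 + \<sigma>) * x) = v t0 x * exp (- (Q (t - t0) x + a0 x * (\<sigma> + \<Phi> (t - t0) \<sigma> x)))" .
  qed
qed

text \<open>With \<open>x = J t0 y\<close> the equation \<open>v t ((1 + w) x) = (1 + \<sigma>) y\<close> becomes, after taking
  logarithms, a fixed point equation for \<open>w\<close>, and \<open>J t ((1 + \<sigma>) y) = (1 + w) x\<close>.\<close>

lemma local_series_marginal_inverse:
  assumes v: "Inada v"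
    and dk: "\<And>t x. t \<in> {0..1} \<Longrightarrow> x > 0 \<Longrightarrow> (v t has_real_derivative k t x) (at x)"
    and dt: "\<And>t x. t \<in> {0..1} \<Longrightarrow> x > 0 \<Longrightarrow> ((\<lambda>s. v s x) has_real_derivative vt t x) (at t within {0..1})"
    and a: "local_series t0 (\<lambda>t x. - x * k t x / v t x)" and q: "local_series t0 (\<lambda>t x. - vt t x / v t x)"
    and t0: "t0 \<in> {0..1}" and N: "N > 0" "\<And>x. x > 0 \<Longrightarrow> 1 / N \<le> - x * k t0 x / v t0 x"
    and G: "local_series t0 G"
  shows "local_series t0 (\<lambda>t y. G t (marginal_inverse v t y))"
proof -
  define a0 where "a0 = (\<lambda>x. - x * k t0 x / v t0 x)"
  define J where "J = marginal_inverse v"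
  obtain eg g Mg where g: "0 < eg" "eg < 1" "pser eg g Mg"
    "\<And>t \<sigma> x. t \<in> {0..1} \<Longrightarrow> \<bar>t - t0\<bar> \<le> eg \<Longrightarrow> \<bar>\<sigma>\<bar> \<le> eg \<Longrightarrow> x > 0 \<Longrightarrow> G t ((1 + \<sigma>) * x) = g (t - t0) \<sigma> x"
    using local_seriesE[OF G zero_less_one] by metis
  obtain e Q \<Phi> where "e \<le> eg" and le: "log_expansion v a0 t0 e Q \<Phi>"
    using log_marginal_series[OF v dk dt a q t0 N g(1)] unfolding a0_def by blast
  then have e: "0 < e" "e < 1" "e \<le> eg" using log_expansionD(1,2)[OF le] by auto
  note Q0 = log_expansionD(4)[OF le] and ln = log_expansionD(8)[OF le]
  obtain MQ where Q: "pser e (\<lambda>\<tau> \<sigma> x. Q \<tau> x) MQ" using log_expansionD(3)[OF le] by blast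
  have e0: "0 \<le> e" using e by simp
  have a0: "1 / N \<le> a0 x" "a0 x > 0" if "x > 0" for x
  proof -
    show "1 / N \<le> a0 x" using N(2)[OF that] by (simp add: a0_def)
    moreover have "0 < 1 / N" using N(1) by simp
    ultimately show "a0 x > 0" by linarith
  qed
  have inv: "pser e (\<lambda>\<tau> \<sigma> x. 1 / a0 x) N"
  proof (rule pser_coeff)
    have a0c: "continuous_on {0<..} a0" unfolding a0_def by (rule local_series_center(1)[OF a t0])
    show "continuous_on {0<..} (\<lambda>x. 1 / a0 x)"
      by (intro continuous_intros a0c) (use a0(2) in force)
    show "\<bar>1 / a0 x\<bar> \<le> N" if "x > 0" for x
      using a0[OF that] N(1) by (simp add: pos_divide_le_eq mult.commute)
  qed
  obtain L where L: "pser e (\<lambda>\<tau> \<sigma> x. ln (1 + \<sigma>)) L" using pser_ln[OF e(1,2)] by blast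
  \<comment> \<open>The equation to solve is \<open>a0 x * (w + \<Phi> \<tau> w x) = - (Q \<tau> x +
    ln (1 + \<sigma>))\<close>; division by \<open>a0 x\<close> isolates \<open>w\<close>.\<close>
  define R where "R = (\<lambda>\<tau> \<sigma> x. - ((Q \<tau> x + ln (1 + \<sigma>)) * (1 / a0 x)))"
  define MR where "MR = (MQ + L) * N"
  have R: "pser e R MR" unfolding R_def MR_def
    by (intro pser_minus[OF e0] pser_mult[OF e0] pser_add Q L inv)
  have MR: "0 \<le> MR" by (rule pser_nonneg[OF R e0])
  \<comment> \<open>\<open>R\<close> vanishes at the centre, so its norm is at most
    \<open>e' / e * MR \<le> e / 2\<close> on the smaller polydisc, as the fixed point
    requires.\<close>
  define e' where "e' = min e (e * e / (2 * (MR + 1)))"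
  have e': "0 < e'" "e' \<le> e" using e MR by (auto simp: e'_def)
  have e'0: "0 \<le> e'" using e' by simp
  have "e' \<le> e * e / (2 * (MR + 1))" by (simp add: e'_def)
  then have "e' * (2 * (MR + 1)) \<le> e * e" using MR by (simp add: pos_le_divide_eq)
  moreover have "e' * MR \<le> e' * (MR + 1)" using e' by simp
  ultimately have "e' * MR * 2 \<le> e * e" by linarith
  then have small: "e' / e * MR \<le> e / 2" using e(1) by (simp add: field_simps)
  have R0: "R 0 0 x = 0" if "x > 0" for x using Q0[OF that] by (simp add: R_def)
  have R': "pser e' R (e / 2)"
    by (rule pser_cong[OF pser_mono[OF pser_diff_center[OF R e'0 e'(2) e(1)] small]]) (use R0 in simp)
  obtain w where w: "pser e' w e"
    "\<And>\<tau> \<sigma> x. \<bar>\<tau>\<bar> \<le> e' \<Longrightarrow> \<bar>\<sigma>\<bar> \<le> e' \<Longrightarrow> x > 0 \<Longrightarrow> w \<tau> \<sigma> x = R \<tau> \<sigma> x - \<Phi> \<tau> (w \<tau> \<sigma> x) x"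
    by (rule pser_fixpoint[where \<Phi> = \<Phi>, OF e(1) e'0 e'(2) R' log_expansionD(5-7)[OF le]], assumption+) (rule that)
  have Jc: "continuous_on {0<..} (J t0)"
    unfolding J_def by (rule InadaD(6)[OF Inada_marginal_inverse[OF v] t0])
  have J: "J t y > 0" "v t (J t y) = y" if "t \<in> {0..1}" "y > 0" for t y
    using marginal_inverse[OF v that] by (auto simp: J_def)
  have "pser e' (\<lambda>\<tau> \<sigma> x. g \<tau> (w \<tau> \<sigma> x) x) Mg"
    by (rule pser_compose[OF g(3) w(1) e'0]) (use e e' in auto)
  \<comment> \<open>The fixed point is a series with coefficients depending on
    \<open>x = J t0 y\<close>; here they become functions of \<open>y\<close>.\<close>
  from pser_reparametrize[OF this Jc J(1)[OF t0]]
  have "pser e' (\<lambda>\<tau> \<sigma> y. g \<tau> (w \<tau> \<sigma> (J t0 y)) (J t0 y)) Mg" .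
  note ps = this
  have lt1: "e' < 1" using e e' by simp
  show ?thesis unfolding J_def[symmetric]
  proof (rule local_seriesI[OF e'(1) lt1 ps])
    fix t \<sigma> y :: real assume d: "t \<in> {0..1}" "\<bar>t - t0\<bar> \<le> e'" "\<bar>\<sigma>\<bar> \<le> e'" "y > 0"
    define x where "x = J t0 y"
    have x: "x > 0" "v t0 x = y" using J[OF t0 d(4)] by (auto simp: x_def)
    define z where "z = w (t - t0) \<sigma> x"
    have z: "\<bar>z\<bar> \<le> e" unfolding z_def by (rule pser_bound[OF w(1) d(2,3) x(1)])
    have \<sigma>: "1 + \<sigma> > 0" using d e e' by simp
    have z1: "(1 + z) * x > 0" using z e x by simp
    have "z + \<Phi> (t - t0) z x = R (t - t0) \<sigma> x" using w(2)[OF d(2,3) x(1)] by (simp add: z_def)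
    then have "a0 x * (z + \<Phi> (t - t0) z x) = - (Q (t - t0) x + ln (1 + \<sigma>))"
      using a0(2)[OF x(1)] by (simp add: R_def)
    then have "ln (v t ((1 + z) * x)) = ln y + ln (1 + \<sigma>)"
      using ln[OF d(1) _ z x(1)] d(2) e'(2) x(2) by simp
    also have "\<dots> = ln ((1 + \<sigma>) * y)" using \<sigma> d(4) by (simp add: ln_mult)
    finally have "v t ((1 + z) * x) = (1 + \<sigma>) * y"
      using InadaD(1)[OF v d(1) z1] \<sigma> d(4) by simp
    then have "J t ((1 + \<sigma>) * y) = (1 + z) * x"
      using marginal_inverse_apply[OF v d(1) z1] by (simp add: J_def)
    then show "G t (J t ((1 + \<sigma>) * y)) = g (t - t0) (w (t - t0) \<sigma> (J t0 y)) (J t0 y)"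
      using g(4)[of t z x] d(1,2) e(3) e'(2) z x(1) by (simp add: x_def z_def)
  qed
qed

text \<open>Both \<open>v s (J s y)\<close> and \<open>v t (J t y)\<close> equal \<open>y\<close>.
  The mean value theorem in \<open>x\<close> at time \<open>s\<close> turns the increment of
  \<open>J\<close> into the increment of \<open>v\<close> in time divided by
  \<open>- k s (\<xi> s)\<close>, and joint continuity of \<open>k\<close> handles the moving
  intermediate point. One-sided derivatives at 0 and 1 are included.\<close>

lemma marginal_inverse_has_t_derivative:
  assumes v: "Inada v"
    and dk: "\<And>t x. t \<in> {0..1} \<Longrightarrow> x > 0 \<Longrightarrow> (v t has_real_derivative k t x) (at x)"
    and dt: "\<And>t x. t \<in> {0..1} \<Longrightarrow> x > 0 \<Longrightarrow> ((\<lambda>s. v s x) has_real_derivative vt t x) (at t within {0..1})"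
    and kc: "continuous_on Dom (\<lambda>p. k (fst p) (snd p))"
    and neg: "\<And>t x. t \<in> {0..1} \<Longrightarrow> x > 0 \<Longrightarrow> k t x < 0"
    and t: "t \<in> {0..1}" and y: "y > 0"
  defines "J \<equiv> marginal_inverse v"
  shows "((\<lambda>s. J s y) has_real_derivative - vt t (J t y) / k t (J t y)) (at t within {0..1})"
proof -
  have J: "J s y > 0" "v s (J s y) = y" if "s \<in> {0..1}" for s
    using marginal_inverse[OF v that y] by (auto simp: J_def)
  define x where "x = J t y"
  have x: "x > 0" "v t x = y" using J[OF t] by (auto simp: x_def)
  have "\<exists>\<xi>. \<bar>\<xi> - x\<bar> \<le> \<bar>J s y - x\<bar> \<and> \<xi> > 0 \<and> v s (J s y) - v s x = (J s y - x) * k s \<xi>" if s: "s \<in> {0..1}" for s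
  proof (cases "J s y" x rule: linorder_cases)
    case less
    have "\<exists>z>J s y. z < x \<and> v s x - v s (J s y) = (x - J s y) * k s z"
      by (rule MVT2[OF less]) (use dk[OF s] J(1)[OF s] in auto)
    then obtain z where "J s y < z" "z < x" "v s x - v s (J s y) = (x - J s y) * k s z" by blast
    then show ?thesis using J(1)[OF s] by (intro exI[of _ z]) (auto simp: algebra_simps)
  next
    case equal then show ?thesis using x by (intro exI[of _ x]) auto
  next
    case greater
    have "\<exists>z>x. z < J s y \<and> v s (J s y) - v s x = (J s y - x) * k s z"
      by (rule MVT2[OF greater]) (use dk[OF s] x in auto)
    then obtain z where "x < z" "z < J s y" "v s (J s y) - v s x = (J s y - x) * k s z" by blast
    then show ?thesis using x by (intro exI[of _ z]) auto
  qed
  then have "\<forall>s\<in>{0..1}. \<exists>\<xi>. \<bar>\<xi> - x\<bar> \<le> \<bar>J s y - x\<bar> \<and> \<xi> > 0 \<and> v s (J s y) - v s x = (J s y - x) * k s \<xi>" by blast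
  from bchoice[OF this] obtain \<xi> where \<xi>: "\<And>s. s \<in> {0..1} \<Longrightarrow> \<bar>\<xi> s - x\<bar> \<le> \<bar>J s y - x\<bar>"
    "\<And>s. s \<in> {0..1} \<Longrightarrow> \<xi> s > 0" "\<And>s. s \<in> {0..1} \<Longrightarrow> v s (J s y) - v s x = (J s y - x) * k s (\<xi> s)"
    by blast
  have ev: "eventually (\<lambda>s. s \<in> {0..1} \<and> s \<noteq> t) (at t within {0..1})" by (simp add: eventually_at_filter)
  have Jc: "continuous_on Dom (\<lambda>p. J (fst p) (snd p))"
    using Inada_marginal_inverse[OF v] by (auto simp: Inada_def J_def)
  have "continuous_on {0..1} (\<lambda>s. (s, y))" by (intro continuous_intros)
  from continuous_on_compose2[OF Jc this]
  have "(\<lambda>s. (s, y)) ` {0..1} \<subseteq> Dom \<Longrightarrow> continuous_on {0..1} (\<lambda>s. J s y)" by simp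
  moreover have "(\<lambda>s. (s, y)) ` {0..1} \<subseteq> Dom" using y by auto
  ultimately have "continuous_on {0..1} (\<lambda>s. J s y)" by blast
  then have "((\<lambda>s. J s y) \<longlongrightarrow> x) (at t within {0..1})" using t by (auto simp: continuous_on_def x_def)
  then have "((\<lambda>s. J s y - x) \<longlongrightarrow> 0) (at t within {0..1})" by (simp add: LIM_zero)
  then have "((\<lambda>s. \<xi> s - x) \<longlongrightarrow> 0) (at t within {0..1})"
    by (rule Lim_null_comparison[rotated, OF tendsto_rabs_zero]) (use ev \<xi>(1) in \<open>auto elim!: eventually_mono\<close>)
  then have "(\<xi> \<longlongrightarrow> x) (at t within {0..1})" by (rule LIM_zero_cancel)
  then have "((\<lambda>s. (s, \<xi> s)) \<longlongrightarrow> (t, x)) (at t within {0..1})" by (intro tendsto_intros)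
  moreover have "\<forall>\<^sub>F s in at t within {0..1}. (s, \<xi> s) \<in> Dom"
    using ev by eventually_elim (use \<xi>(2) in auto)
  moreover have "(t, x) \<in> Dom" using t x by simp
  ultimately have klim: "((\<lambda>s. k s (\<xi> s)) \<longlongrightarrow> k t x) (at t within {0..1})"
    using continuous_on_tendsto_compose[OF kc] by fastforce
  have "((\<lambda>s. (v s x - v t x) / (s - t)) \<longlongrightarrow> vt t x) (at t within {0..1})"
    using dt[OF t x(1)] by (simp add: has_field_derivative_iff)
  then have "((\<lambda>s. - ((v s x - v t x) / (s - t)) / k s (\<xi> s)) \<longlongrightarrow> - vt t x / k t x) (at t within {0..1})"
    by (intro tendsto_intros klim) (use neg[OF t x(1)] in auto)
  then have "((\<lambda>s. (J s y - J t y) / (s - t)) \<longlongrightarrow> - vt t x / k t x) (at t within {0..1})"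
  proof (rule Lim_transform_eventually)
    show "\<forall>\<^sub>F s in at t within {0..1}. - ((v s x - v t x) / (s - t)) / k s (\<xi> s) = (J s y - J t y) / (s - t)"
      using ev
    proof eventually_elim
      case (elim s)
      then have s: "s \<in> {0..1}" by simp
      have "- (v s x - v t x) = (J s y - x) * k s (\<xi> s)" using \<xi>(3)[OF s] J(2)[OF s] x(2) by simp
      moreover have "k s (\<xi> s) < 0" by (rule neg[OF s \<xi>(2)[OF s]])
      ultimately have "J s y - x = - (v s x - v t x) / k s (\<xi> s)" by (simp add: eq_divide_eq)
      then have "(J s y - J t y) / (s - t) = - (v s x - v t x) / k s (\<xi> s) / (s - t)" by (simp only: x_def)
      moreover have "- (a / b) / c = - a / c / b" for a b c :: real by (simp add: mult.commute)
      ultimately show ?case by (simp only:)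
    qed
  qed
  then show ?thesis by (simp add: has_field_derivative_iff x_def)
qed

section \<open>Marginal utilities of class \<open>U4\<close> and the closure of
  \<open>U4\<close>\<close>

definition smooth_marginal ::
    "(real \<Rightarrow> real \<Rightarrow> real) \<Rightarrow> (real \<Rightarrow> real \<Rightarrow> real) \<Rightarrow> (real \<Rightarrow> real \<Rightarrow> real) \<Rightarrow> (real \<Rightarrow> real \<Rightarrow> real) \<Rightarrow> bool" where
  "smooth_marginal v k h vt \<longleftrightarrow> Inada v \<and> elastic v \<and> weak_deriv_x v k \<and> weak_deriv_x k h \<and>
     (\<forall>t\<in>{0..1}. \<forall>x>0. ((\<lambda>s. v s x) has_real_derivative vt t x) (at t within {0..1})) \<and>
     (\<forall>t\<in>{0..1}. local_series t (\<lambda>t x. - x * k t x / v t x) \<and> local_series t (\<lambda>t x. - x * h t x / k t x) \<and>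
        local_series t (\<lambda>t x. - vt t x / v t x))"

lemma smooth_marginalD:
  assumes "smooth_marginal v k h vt"
  shows "Inada v" "elastic v" "weak_deriv_x v k" "weak_deriv_x k h"
    "\<And>t x. t \<in> {0..1} \<Longrightarrow> x > 0 \<Longrightarrow> ((\<lambda>s. v s x) has_real_derivative vt t x) (at t within {0..1})"
    "\<And>t. t \<in> {0..1} \<Longrightarrow> local_series t (\<lambda>t x. - x * k t x / v t x)"
    "\<And>t. t \<in> {0..1} \<Longrightarrow> local_series t (\<lambda>t x. - x * h t x / k t x)"
    "\<And>t. t \<in> {0..1} \<Longrightarrow> local_series t (\<lambda>t x. - vt t x / v t x)"
    "\<And>t x. t \<in> {0..1} \<Longrightarrow> x > 0 \<Longrightarrow> (v t has_real_derivative k t x) (at x)"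
    "\<And>t. t \<in> {0..1} \<Longrightarrow> continuous_on {0<..} (k t)"
proof -
  show 1: "Inada v" "elastic v" "weak_deriv_x v k" "weak_deriv_x k h"
    "\<And>t x. t \<in> {0..1} \<Longrightarrow> x > 0 \<Longrightarrow> ((\<lambda>s. v s x) has_real_derivative vt t x) (at t within {0..1})"
    "\<And>t. t \<in> {0..1} \<Longrightarrow> local_series t (\<lambda>t x. - x * k t x / v t x)"
    "\<And>t. t \<in> {0..1} \<Longrightarrow> local_series t (\<lambda>t x. - x * h t x / k t x)"
    "\<And>t. t \<in> {0..1} \<Longrightarrow> local_series t (\<lambda>t x. - vt t x / v t x)"
    using assms unfolding smooth_marginal_def by blast+
  show kc: "continuous_on {0<..} (k t)" if "t \<in> {0..1}" for t by (rule weak_deriv_x_continuous[OF 1(4) that])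
  show "(v t has_real_derivative k t x) (at x)" if "t \<in> {0..1}" "x > 0" for t x
    by (rule weak_deriv_x_has_derivative[OF 1(3) that(1) kc[OF that(1)] that(2)])
qed

lemma smooth_marginal_bounds:
  assumes "smooth_marginal v k h vt"
  obtains N where "N > 0" "\<And>t x. t \<in> {0..1} \<Longrightarrow> x > 0 \<Longrightarrow> 1 / N \<le> - x * k t x / v t x"
    "\<And>t x. t \<in> {0..1} \<Longrightarrow> x > 0 \<Longrightarrow> k t x < 0"
  using elastic_derivativeD[OF smooth_marginalD(1,2,3,10)[OF assms]] by metis

lemma smooth_marginal_cong:
  assumes s: "smooth_marginal v k h vt" and eq: "\<And>t x. t \<in> {0..1} \<Longrightarrow> x > 0 \<Longrightarrow> v' t x = v t x"
  shows "smooth_marginal v' k h vt"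
  unfolding smooth_marginal_def
proof (intro conjI ballI allI impI)
  note d = smooth_marginalD[OF s]
  show "Inada v'" by (rule Inada_cong[OF d(1) eq])
  show "elastic v'" by (rule elastic_cong[OF d(2) eq])
  show "weak_deriv_x v' k" by (rule weak_deriv_x_cong[OF d(3) eq])
  show "weak_deriv_x k h" by (rule d)
  fix t :: real assume t: "t \<in> {0..1}"
  show "((\<lambda>s. v' s x) has_real_derivative vt t x) (at t within {0..1})" if "x > 0" for x
    by (rule has_field_derivative_transform_within[OF d(5)[OF t that] zero_less_one t]) (use eq that in auto)
  show "local_series t (\<lambda>t x. - x * k t x / v' t x)" by (rule local_series_cong[OF d(6)[OF t]]) (simp add: eq)
  show "local_series t (\<lambda>t x. - x * h t x / k t x)" by (rule d(7)[OF t])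
  show "local_series t (\<lambda>t x. - vt t x / v' t x)" by (rule local_series_cong[OF d(8)[OF t]]) (simp add: eq)
qed

text \<open>\<open>U3\<close> remains a separate conjunct because its bounds may refer to other weak
  derivatives than the analytic ratios do. The continuity in time demanded by \<open>U4\<close> is
  recovered from \<open>u_xt = - q * u_x\<close>.\<close>

lemma U4_iff: "U4 u \<longleftrightarrow> U3 u \<and> (\<exists>k h vt. smooth_marginal (ux u) k h vt)"
proof
  assume "U4 u"
  then obtain k h vt where u: "U3 u" "weak_deriv_x (ux u) k" "weak_deriv_x k h"
     "\<forall>x>0. \<forall>t\<in>{0..1}. ((\<lambda>s. ux u s x) has_real_derivative vt t x) (at t within {0..1})"
     "analytic_C (\<lambda>t x. - x * k t x / ux u t x)" "analytic_C (\<lambda>t x. - x * h t x / k t x)"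
     "analytic_C (\<lambda>t x. - vt t x / ux u t x)"
    unfolding U4_def by blast
  from u(1) have "U1 u" "elastic (ux u)" by (auto simp: U3_iff)
  then have "Inada (ux u)" using U1D by blast
  then have "smooth_marginal (ux u) k h vt"
    unfolding smooth_marginal_def using u \<open>elastic (ux u)\<close>
    by (auto intro!: local_series_if_analytic_C)
  with u(1) show "U3 u \<and> (\<exists>k h vt. smooth_marginal (ux u) k h vt)" by blast
next
  assume "U3 u \<and> (\<exists>k h vt. smooth_marginal (ux u) k h vt)"
  then obtain k h vt where u: "U3 u" and s: "smooth_marginal (ux u) k h vt" by blast
  note d = smooth_marginalD[OF s]
  have "continuous_on {0..1} (\<lambda>t. vt t x)" if x: "x > 0" for x
  proof -
    have "continuous_on Dom (\<lambda>p. - vt (fst p) (snd p) / ux u (fst p) (snd p))"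
      by (rule local_series_continuous) (rule d(8))
    moreover have "continuous_on Dom (\<lambda>p. ux u (fst p) (snd p))" using d(1) by (auto simp: Inada_def)
    ultimately have "continuous_on Dom (\<lambda>p. - (- vt (fst p) (snd p) / ux u (fst p) (snd p)) * ux u (fst p) (snd p))"
      by (intro continuous_on_mult continuous_on_minus)
    then have c: "continuous_on Dom (\<lambda>p. vt (fst p) (snd p))"
      by (rule continuous_on_eq) (use InadaD(1)[OF d(1)] in \<open>force simp: Dom_def\<close>)
    have "continuous_on {0..1} (\<lambda>t. (t, x))" by (intro continuous_intros)
    from continuous_on_compose2[OF c this]
    have "(\<lambda>t. (t, x)) ` {0..1} \<subseteq> Dom \<Longrightarrow> continuous_on {0..1} (\<lambda>t. vt t x)" by simp
    moreover have "(\<lambda>t. (t, x)) ` {0..1} \<subseteq> Dom" using x by auto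
    ultimately show ?thesis by blast
  qed
  moreover have "analytic_C (\<lambda>t x. - x * k t x / ux u t x)" "analytic_C (\<lambda>t x. - x * h t x / k t x)"
     "analytic_C (\<lambda>t x. - vt t x / ux u t x)"
    by (rule analytic_C_if_local_series, rule d, assumption)+
  ultimately show "U4 u" unfolding U4_def using u d(3,4,5) by blast
qed

lemma smooth_marginal_scale:
  assumes s: "smooth_marginal v k h vt" and c: "c > 0" and i: "Inada (\<lambda>t x. c * v t x)"
  shows "smooth_marginal (\<lambda>t x. c * v t x) (\<lambda>t x. c * k t x) (\<lambda>t x. c * h t x) (\<lambda>t x. c * vt t x)"
  unfolding smooth_marginal_def
proof (intro conjI ballI allI impI)
  note d = smooth_marginalD[OF s]
  show "elastic (\<lambda>t x. c * v t x)" by (rule elastic_scale[OF d(2) c])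
  show "weak_deriv_x (\<lambda>t x. c * v t x) (\<lambda>t x. c * k t x)" "weak_deriv_x (\<lambda>t x. c * k t x) (\<lambda>t x. c * h t x)"
    by (rule weak_deriv_x_cmult, rule d)+
  fix t :: real assume t: "t \<in> {0..1}"
  show "((\<lambda>s. c * v s x) has_real_derivative c * vt t x) (at t within {0..1})" if "x > 0" for x
    by (rule DERIV_cmult[OF d(5)[OF t that]])
  show "local_series t (\<lambda>t x. - x * (c * k t x) / (c * v t x))" "local_series t (\<lambda>t x. - x * (c * h t x) / (c * k t x))"
    "local_series t (\<lambda>t x. - (c * vt t x) / (c * v t x))"
    using d(6)[OF t] d(7)[OF t] d(8)[OF t] c by (simp_all add: mult.left_commute)
qed (rule i)

text \<open>The second growth factor comes from \<open>- k = v * a / x\<close>, where each factor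
  has one; for \<open>a\<close> this rests on its positive lower bound.\<close>

lemma smooth_marginal_local_ratios:
  assumes s: "smooth_marginal v k h vt" and t: "t \<in> {0..1}"
  shows "local_ratio t v" "local_ratio t (\<lambda>t x. - k t x)"
proof -
  note d = smooth_marginalD[OF s]
  obtain N where N: "N > 0" "\<And>t x. t \<in> {0..1} \<Longrightarrow> x > 0 \<Longrightarrow> 1 / N \<le> - x * k t x / v t x"
    using smooth_marginal_bounds[OF s] by metis
  show v: "local_ratio t v"
    by (rule local_ratio_marginal[OF d(1,9,5) d(6)[OF t] d(8)[OF t] t N(1) N(2)[OF t]])
  have a: "local_ratio t (\<lambda>t x. - x * k t x / v t x)"
    by (rule local_ratio_if_local_series[OF d(6)[OF t] t _ N(2)[OF t]]) (use N(1) in auto)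
  show "local_ratio t (\<lambda>t x. - k t x)"
    by (rule local_ratio_cong[OF local_ratio_mult[OF local_ratio_mult[OF v a] local_ratio_reciprocal] t])
      (use InadaD(1)[OF d(1)] in force)
qed

lemma local_series_weighted_mean:
  assumes W: "local_ratio t0 W1" "local_ratio t0 W2" and t0: "t0 \<in> {0..1}"
    and c: "continuous_on {0<..} (W1 t0)" "continuous_on {0<..} (W2 t0)"
    and pos: "\<And>t x. t \<in> {0..1} \<Longrightarrow> x > 0 \<Longrightarrow> W1 t x > 0" "\<And>t x. t \<in> {0..1} \<Longrightarrow> x > 0 \<Longrightarrow> W2 t x > 0"
    and F: "local_series t0 (\<lambda>t x. n1 t x / W1 t x)" "local_series t0 (\<lambda>t x. n2 t x / W2 t x)"
  shows "local_series t0 (\<lambda>t x. (n1 t x + n2 t x) / (W1 t x + W2 t x))"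
proof -
  have 1: "local_series t0 (\<lambda>t x. W1 t x / (W1 t x + W2 t x))"
    by (rule local_series_weight[OF W t0 c pos(1)[OF t0] pos(2)[OF t0]])
  have 2: "local_series t0 (\<lambda>t x. W2 t x / (W2 t x + W1 t x))"
    by (rule local_series_weight[OF W(2,1) t0 c(2,1) pos(2)[OF t0] pos(1)[OF t0]])
  show ?thesis
  proof (rule local_series_cong[OF local_series_add[OF local_series_mult[OF 1 F(1)] local_series_mult[OF 2 F(2)]]])
    fix t x :: real assume t: "t \<in> {0..1}" "x > 0"
    show "(n1 t x + n2 t x) / (W1 t x + W2 t x) =
        W1 t x / (W1 t x + W2 t x) * (n1 t x / W1 t x) + W2 t x / (W2 t x + W1 t x) * (n2 t x / W2 t x)"
      using pos(1)[OF t] pos(2)[OF t] by (simp add: add_divide_distrib add.commute)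
  qed
qed

lemma smooth_marginal_add:
  assumes s1: "smooth_marginal v1 k1 h1 w1" and s2: "smooth_marginal v2 k2 h2 w2"
    and i: "Inada (\<lambda>t x. v1 t x + v2 t x)"
  shows "smooth_marginal (\<lambda>t x. v1 t x + v2 t x) (\<lambda>t x. k1 t x + k2 t x) (\<lambda>t x. h1 t x + h2 t x) (\<lambda>t x. w1 t x + w2 t x)"
  unfolding smooth_marginal_def
proof (intro conjI ballI allI impI)
  note d1 = smooth_marginalD[OF s1] and d2 = smooth_marginalD[OF s2]
  show "elastic (\<lambda>t x. v1 t x + v2 t x)" by (rule elastic_add[OF d1(2) d2(2) d1(1) d2(1)])
  show "weak_deriv_x (\<lambda>t x. v1 t x + v2 t x) (\<lambda>t x. k1 t x + k2 t x)" by (rule weak_deriv_x_add[OF d1(3) d2(3)])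
  show "weak_deriv_x (\<lambda>t x. k1 t x + k2 t x) (\<lambda>t x. h1 t x + h2 t x)" by (rule weak_deriv_x_add[OF d1(4) d2(4)])
  have neg: "k1 t x < 0" "k2 t x < 0" if "t \<in> {0..1}" "x > 0" for t x
    using smooth_marginal_bounds[OF s1] smooth_marginal_bounds[OF s2] that by metis+
  have pos: "v1 t x > 0" "v2 t x > 0" if "t \<in> {0..1}" "x > 0" for t x
    using InadaD(1)[OF d1(1)] InadaD(1)[OF d2(1)] that by auto
  fix t :: real assume t: "t \<in> {0..1}"
  note r1 = smooth_marginal_local_ratios[OF s1 t] and r2 = smooth_marginal_local_ratios[OF s2 t]
  have vc: "continuous_on {0<..} (v1 t)" "continuous_on {0<..} (v2 t)"
    by (rule InadaD(6)[OF d1(1) t], rule InadaD(6)[OF d2(1) t])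
  have kc: "continuous_on {0<..} (\<lambda>x. - k1 t x)" "continuous_on {0<..} (\<lambda>x. - k2 t x)"
    by (intro continuous_intros d1(10)[OF t] d2(10)[OF t])+
  show "((\<lambda>s. v1 s x + v2 s x) has_real_derivative w1 t x + w2 t x) (at t within {0..1})" if "x > 0" for x
    by (rule DERIV_add[OF d1(5)[OF t that] d2(5)[OF t that]])
  show "local_series t (\<lambda>t x. - x * (k1 t x + k2 t x) / (v1 t x + v2 t x))"
    by (rule local_series_cong[OF local_series_weighted_mean[OF r1(1) r2(1) t vc pos d1(6)[OF t] d2(6)[OF t]]])
      (auto simp: algebra_simps)
  show "local_series t (\<lambda>t x. - (w1 t x + w2 t x) / (v1 t x + v2 t x))"
    by (rule local_series_cong[OF local_series_weighted_mean[OF r1(1) r2(1) t vc pos d1(8)[OF t] d2(8)[OF t]]])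
      (auto simp: algebra_simps)
  \<comment> \<open>The minus sign moves to the denominator, so that the weights \<open>- k1\<close>
    and \<open>- k2\<close> are positive.\<close>
  have p: "local_series t (\<lambda>t x. x * h1 t x / - k1 t x)" "local_series t (\<lambda>t x. x * h2 t x / - k2 t x)"
    using d1(7)[OF t] d2(7)[OF t] by simp_all
  have "local_series t (\<lambda>t x. (x * h1 t x + x * h2 t x) / (- k1 t x + - k2 t x))"
    by (rule local_series_weighted_mean[OF r1(2) r2(2) t kc _ _ p]) (use neg in auto)
  then show "local_series t (\<lambda>t x. - x * (h1 t x + h2 t x) / (k1 t x + k2 t x))"
  proof (rule local_series_cong)
    fix t x :: real
    have "x * h1 t x + x * h2 t x = x * (h1 t x + h2 t x)" "- k1 t x + - k2 t x = - (k1 t x + k2 t x)"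
      by (simp_all add: distrib_left)
    then show "- x * (h1 t x + h2 t x) / (k1 t x + k2 t x) = (x * h1 t x + x * h2 t x) / (- k1 t x + - k2 t x)"
      by (metis minus_divide_left minus_divide_right mult_minus_left)
  qed
qed (rule i)

lemma smooth_marginal_inverse:
  assumes s: "smooth_marginal v k h vt"
  defines "J \<equiv> marginal_inverse v"
  shows "smooth_marginal J (\<lambda>t y. 1 / k t (J t y)) (\<lambda>t y. - h t (J t y) / (k t (J t y)) ^ 3)
    (\<lambda>t y. - vt t (J t y) / k t (J t y))"
  unfolding smooth_marginal_def
proof (intro conjI ballI allI impI)
  note d = smooth_marginalD[OF s]
  obtain N where N: "N > 0" "\<And>t x. t \<in> {0..1} \<Longrightarrow> x > 0 \<Longrightarrow> 1 / N \<le> - x * k t x / v t x"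
    and neg: "\<And>t x. t \<in> {0..1} \<Longrightarrow> x > 0 \<Longrightarrow> k t x < 0"
    using smooth_marginal_bounds[OF s] by metis
  show "Inada J" unfolding J_def by (rule Inada_marginal_inverse[OF d(1)])
  show "elastic J" unfolding J_def by (rule elastic_marginal_inverse[OF d(2,1)])
  note w = weak_deriv_marginal_inverse[OF d(1,3,4) neg, folded J_def]
  show "weak_deriv_x J (\<lambda>t y. 1 / k t (J t y))" by (rule w)
  show "weak_deriv_x (\<lambda>t y. 1 / k t (J t y)) (\<lambda>t y. - h t (J t y) / (k t (J t y)) ^ 3)" by (rule w)
  have J: "J t y > 0" "v t (J t y) = y" if "t \<in> {0..1}" "y > 0" for t y
    using marginal_inverse[OF d(1) that] by (auto simp: J_def)
  \<comment> \<open>\<open>k = - a * v / x\<close> is jointly continuous because \<open>a\<close>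
    and \<open>v\<close> are; the time derivative of the inverse depends on this.\<close>
  have kc: "continuous_on Dom (\<lambda>p. k (fst p) (snd p))"
  proof -
    have a: "continuous_on Dom (\<lambda>p. - snd p * k (fst p) (snd p) / v (fst p) (snd p))"
      by (rule local_series_continuous) (rule d(6))
    have b: "continuous_on Dom (\<lambda>p. v (fst p) (snd p))" using d(1) by (auto simp: Inada_def)
    have c: "continuous_on Dom (\<lambda>p. snd p)" by (intro continuous_intros)
    have "continuous_on Dom (\<lambda>p. - (- snd p * k (fst p) (snd p) / v (fst p) (snd p)) * v (fst p) (snd p) / snd p)"
      by (rule continuous_on_divide[OF continuous_on_mult[OF continuous_on_minus[OF a] b] c]) (auto simp: Dom_def)
    then show ?thesis
      by (rule continuous_on_eq) (use InadaD(1)[OF d(1)] in \<open>force simp: Dom_def\<close>)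
  qed
  fix t :: real assume t: "t \<in> {0..1}"
  show "((\<lambda>s. J s y) has_real_derivative - vt t (J t y) / k t (J t y)) (at t within {0..1})" if "y > 0" for y
    unfolding J_def by (rule marginal_inverse_has_t_derivative[OF d(1,9,5) kc neg t that])
  define A where "A = (\<lambda>t x. - x * k t x / v t x)"
  have comp: "local_series t (\<lambda>t y. G t (J t y))" if "local_series t G" for G
    unfolding J_def
    by (rule local_series_marginal_inverse[OF d(1,9,5) d(6)[OF t] d(8)[OF t] t N(1) N(2)[OF t] that])
  \<comment> \<open>All three ratios of the inverse contain the factor \<open>1 / a\<close> at the
    optimiser, so it is expanded once.\<close>
  have iA: "local_series t (\<lambda>t y. 1 / A t (J t y))"
  proof (rule local_series_inverse)
    show "local_series t (\<lambda>t y. A t (J t y))" unfolding A_def by (rule comp[OF d(6)[OF t]])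
    show "1 / N > 0" using N(1) by simp
    show "1 / N \<le> A t (J t y)" if "y > 0" for y unfolding A_def by (rule N(2)[OF t J(1)[OF t that]])
  qed (rule t)
  show "local_series t (\<lambda>t y. - y * (1 / k t (J t y)) / J t y)"
  proof (rule local_series_cong[OF iA])
    fix t y :: real assume ty: "t \<in> {0..1}" "y > 0"
    show "- y * (1 / k t (J t y)) / J t y = 1 / A t (J t y)"
      unfolding A_def J(2)[OF ty] by (rule conj_ratios(1)[OF J(1)[OF ty] ty(2) neg[OF ty(1) J(1)[OF ty]]])
  qed
  show "local_series t (\<lambda>t y. - y * (- h t (J t y) / (k t (J t y)) ^ 3) / (1 / k t (J t y)))"
  proof (rule local_series_cong[OF local_series_mult[OF comp[OF d(7)[OF t]] iA]])
    fix t y :: real assume ty: "t \<in> {0..1}" "y > 0"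
    show "- y * (- h t (J t y) / (k t (J t y)) ^ 3) / (1 / k t (J t y)) =
        - J t y * h t (J t y) / k t (J t y) * (1 / A t (J t y))"
      unfolding A_def J(2)[OF ty] conj_ratios(2)[OF J(1)[OF ty] ty(2) neg[OF ty(1) J(1)[OF ty]]] by simp
  qed
  show "local_series t (\<lambda>t y. - (- vt t (J t y) / k t (J t y)) / J t y)"
  proof (rule local_series_cong[OF local_series_mult[OF comp[OF d(8)[OF t]] iA]])
    fix t y :: real assume ty: "t \<in> {0..1}" "y > 0"
    show "- (- vt t (J t y) / k t (J t y)) / J t y = - vt t (J t y) / v t (J t y) * (1 / A t (J t y))"
      unfolding A_def J(2)[OF ty] using J(1)[OF ty] ty(2) neg[OF ty(1) J(1)[OF ty]] by (simp add: field_simps)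
  qed
qed

lemma U4I:
  assumes "U3 u" "smooth_marginal v k h vt" "\<And>t x. t \<in> {0..1} \<Longrightarrow> x > 0 \<Longrightarrow> ux u t x = v t x"
  shows "U4 u"
proof -
  have "smooth_marginal (ux u) k h vt" by (rule smooth_marginal_cong[OF assms(2,3)])
  with assms(1) show ?thesis by (auto simp: U4_iff)
qed

lemma closed_cone_family_U4: "closed_cone_family U4"
proof (rule closed_cone_familyI)
  note U3 = closed_cone_family_U3[unfolded closed_cone_family_def]
  fix u assume "U4 u"
  then obtain k h vt where u: "U3 u" and s: "smooth_marginal (ux u) k h vt" by (auto simp: U4_iff)
  have u1: "U1 u" using u by (simp add: U3_iff)
  show "U1 u" by (rule u1)
  show "U4 u'" if eq: "\<And>t x. t \<in> {0..1} \<Longrightarrow> x > 0 \<Longrightarrow> u' t x = u t x" for u'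
  proof (rule U4I[OF _ s])
    note c = U1_cong[OF u1 eq]
    have "elastic (ux u')" by (rule elastic_cong[OF _ c(2)]) (use u in \<open>simp add: U3_iff\<close>)
    moreover have "prudent (ux u')" by (rule prudent_cong[OF _ c(2)]) (use u in \<open>simp add: U3_iff\<close>)
    ultimately show "U3 u'" using c(1) by (simp add: U3_iff)
    show "ux u' t x = ux u t x" if "t \<in> {0..1}" "x > 0" for t x by (rule U1_cong(2)[OF u1 eq that])
  qed
  show "U4 (\<lambda>t x. c * u t x)" if c: "c > 0" for c
  proof -
    note d = U1_scale[OF u1 c]
    have "Inada (ux (\<lambda>t x. c * u t x))" by (rule U1D[OF d(1)])
    then have i: "Inada (\<lambda>t x. c * ux u t x)" by (rule Inada_cong) (simp add: d(2))
    show ?thesis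
      by (rule U4I[OF U3[THEN conjunct1, rule_format, OF u c] smooth_marginal_scale[OF s c i] d(2)])
  qed
  show "U4 (conj_x u)"
    by (rule U4I[OF U3[THEN conjunct2, THEN conjunct2, THEN conjunct2, rule_format, OF u]
          smooth_marginal_inverse[OF s] U1_conj_x(2)[OF u1]])
  fix w assume "U4 w"
  then obtain l m wt where w: "U3 w" and s': "smooth_marginal (ux w) l m wt" by (auto simp: U4_iff)
  have w1: "U1 w" using w by (simp add: U3_iff)
  note d = U1_add[OF u1 w1]
  have "Inada (ux (\<lambda>t x. u t x + w t x))" by (rule U1D[OF d(1)])
  then have i: "Inada (\<lambda>t x. ux u t x + ux w t x)" by (rule Inada_cong) (simp add: d(2))
  show "U4 (\<lambda>t x. u t x + w t x)"
    by (rule U4I[OF U3[THEN conjunct2, THEN conjunct1, rule_format, OF u w] smooth_marginal_add[OF s s' i] d(2)])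
qed

theorem theorem9:
  shows "closed_cone_family U1 \<and> closed_cone_family U2 \<and> closed_cone_family U3 \<and> closed_cone_family U4"
  by (intro conjI closed_cone_family_U1 closed_cone_family_U2 closed_cone_family_U3 closed_cone_family_U4)

end
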